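(* Let $\alpha\in(0,1)$, $d\in\mathbb{N}$ and $\epsilon>0$. There exists a pair $(K,K')$ of holomorphic Cantor sets in $\mathbb{C}^d\cong\mathbb{R}^{2d}$ which has stable intersection in the space of holomorphic Cantor sets and satisfies $\dim_{\mathrm{HD}}(K)<\epsilon$. Moreover, for every $\delta>0$ the pair $(K,K')$ with these properties can be chosen so that, in addition, $K$ and $K'$ are affine and each of them is $\delta$-close to some conformal (indeed to some homothetical) holomorphic Cantor set.
   Context: $\dim_{\mathrm{HD}}$ is Hausdorff dimension. For a linear map $A$, $\|A\|_{op}=\sup_{|v|=1}|Av|$ and $m(A)=\inf_{|v|=1}|Av|$. $\mathrm{GL}(d,\mathbb{C})$ is regarded as a subgroup of $\mathrm{GL}(2d,\mathbb{R})$. Regular Cantor sets. A ($\mathcal{C}^{1+\alpha}$) regular Cantor set $K$ in $\mathbb{R}^{2d}$ is given by the following data: a finite alphabet $\mathfrak{A}$ and a set $\mathfrak{B}\subset\mathfrak{A}\times\mathfrak{A}$ of admissible pairs; for each $a\in\mathfrak{A}$ a compact connected set $G(a)\subset\mathbb{R}^{2d}$, these sets being pairwise disjoint; and a $\mathcal{C}^{1+\alpha}$ map $g:V\to\mathbb{R}^{2d}$ on an open neighborhood $V$ of $\bigsqcup_a G(a)$ such that: $(a,b)\in\mathfrak{B}$ implies $G(b)\subset g(G(a))$, and otherwise $G(b)\cap g(G(a))=\emptyset$; each $g|_{G(a)}$ extends to a $\mathcal{C}^{1+\alpha}$ embedding (with $\mathcal{C}^{1+\alpha}$ inverse) of an open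 neighborhood of $G(a)$; there is $\mu\in(0,1)$ with $m(Dg(x))>\mu^{-1}$ for all $x\in V$; the subshift $\Sigma=\{(a_0,a_1,\dots)\in\mathfrak{A}^{\mathbb{N}}:(a_i,a_{i+1})\in\mathfrak{B}\ \forall i\ge0\}$ (the symbolic type) with the left shift is topologically mixing. Then $K=\bigcap_{n\ge0}g^{-n}\big(\bigsqcup_a G(a)\big)$, a nonempty, perfect, compact, totally disconnected set. A Cantor set is always considered together with its data. Types. $K$ is holomorphic if $Dg(x)\in\mathrm{GL}(d,\mathbb{C})\subset\mathrm{GL}(2d,\mathbb{R})$ for all $x\in K$; affine if $g$ is an expanding affine map on each $G(a)$; homothetical if $Dg(x)/\|Dg(x)\|_{op}=\mathrm{Id}$ for all $x\in K$; conformal if $Dg(x)/\|Dg(x)\|_{op}\in \mathrm{O}(2d)$ for all $x\in K$; bunched if there is $N\in\mathbb{N}$ with $\|Dg^N(x)\|_{op}\, m(Dg^N(x))^{-1}\mu^{\alpha N}<1$ for all $x\in K$. Closeness. Two $\mathcal{C}^{r}$ diffeomorphisms $f_1,f_2$ between open subsets of $\mathbb{R}^{2d}$ are $\mathcal{C}^r$-close if there is a diffeomorphism $\phi:\mathrm{Dom}(f_1)\to\mathrm{Dom}(f_2)$ that is $\mathcal{C}^r$-close to the identity and such that $f_2\circ \phi$ is $\mathcal{C}^r$-close to $f_1$. Let $G^*(a)$ denote a small open neighborhood of $G(a)$ (of a fixed small radius) such that $g$ extends to a neighborhood of $\overline{G^*(a)}$ and the sets $\overline{G^*(a)}$, $a\in\mathfrak{A}$,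 together with $g$ satisfy the conditions in the definition of a regular Cantor set with $\overline{G^*(a)}$ in place of $G(a)$, that is: the sets $\overline{G^*(a)}$ are pairwise disjoint; $(a,b)\in\mathfrak{B}$ implies $\overline{G^*(b)}\subset g(\overline{G^*(a)})$, and otherwise $\overline{G^*(b)}\cap g(\overline{G^*(a)})=\emptyset$; $g$ restricted to each $\overline{G^*(a)}$ extends to a $\mathcal{C}^{1+\alpha}$ embedding (with $\mathcal{C}^{1+\alpha}$ inverse) of an open neighborhood of $\overline{G^*(a)}$; and $m(Dg)>\mu^{-1}$ there. A bunched holomorphic Cantor set $\tilde K$ with the same symbolic type as $K$, generated by $\tilde g$ with pieces $\tilde G(a)$, is $\delta$-close to $K$ if $\tilde g|_{\tilde G^*(a)}$ is $\delta$-close to $g|_{G^*(a)}$ in this $\mathcal{C}^{1+\alpha}$ topology for all $a\in\mathfrak{A}$. The sets of bunched holomorphic Cantor sets $\delta$-close to a given $K$ define the topology on the space of bunched holomorphic Cantor sets with given symbolic type. Stable intersection. A pair $(K,K')$ of holomorphic Cantor sets has stable intersection in the space of holomorphic Cantor sets if there is $\delta_0>0$ such that $\tilde K\cap\tilde K'\neq\emptyset$ for all pairs $(\tilde K,\tilde K')$ of bunched holomorphic Cantor sets with $\tilde K$ $\delta_0$-close to $K$ and $\tilde K'$ $\delta_0$-close to $K'$. *)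

theory Defs
  imports "HOL-Analysis.Analysis"
begin

section \<open>Hausdorff dimension\<close>

definition hausdorff_pre :: "real \<Rightarrow> real \<Rightarrow> 'a::metric_space set \<Rightarrow> ennreal" where
  "hausdorff_pre s \<eta> S =
     (INF U \<in> {U :: nat \<Rightarrow> 'a set. S \<subseteq> (\<Union>i. U i) \<and> (\<forall>i. bounded (U i) \<and> diameter (U i) \<le> \<eta>)}.
        (\<Sum>i. ennreal (diameter (U i) powr s)))"

text \<open>Only used for \<open>s > 0\<close>: \<open>0 powr 0 = 0\<close>, so \<open>s = 0\<close> would not give counting measure.\<close>

definition hausdorff_measure :: "real \<Rightarrow> 'a::metric_space set \<Rightarrow> ennreal" where
  "hausdorff_measure s S = (SUP \<eta> \<in> {0<..}. hausdorff_pre s \<eta> S)"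

definition hausdorff_dim :: "'a::metric_space set \<Rightarrow> ereal" where
  "hausdorff_dim S = (INF s \<in> {s. 0 < s \<and> hausdorff_measure s S = 0}. ereal s)"


section \<open>Maps of class \<open>C\<^sup>1\<^sup>+\<^sup>\<alpha>\<close>\<close>

abbreviation Dat :: "('a::real_normed_vector \<Rightarrow> 'b::real_normed_vector) \<Rightarrow> 'a \<Rightarrow> 'a \<Rightarrow> 'b" where
  "Dat f x \<equiv> frechet_derivative f (at x)"

text \<open>\<open>m(A) = inf\<^bsub>|v|=1\<^esub> |A v|\<close>; the operator norm is \<^const>\<open>onorm\<close>.\<close>

definition conorm :: "('a::real_normed_vector \<Rightarrow> 'b::real_normed_vector) \<Rightarrow> real" where
  "conorm A = (INF v \<in> {v. norm v = 1}. norm (A v))"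

text \<open>The derivative is only required to be locally Hoelder.  Maps that are not defined
  everywhere are total functions that are only looked at on an open set \<open>U\<close>.\<close>

definition C1_holder_on :: "real \<Rightarrow> 'a::real_normed_vector set \<Rightarrow> ('a \<Rightarrow> 'b::real_normed_vector) \<Rightarrow> bool" where
  "C1_holder_on \<alpha> U f \<longleftrightarrow> open U \<and> (\<forall>x\<in>U. f differentiable (at x)) \<and>
     (\<forall>x\<in>U. \<exists>e>0. \<exists>C. \<forall>y \<in> U \<inter> ball x e. \<forall>z \<in> U \<inter> ball x e.
        onorm (\<lambda>v. Dat f y v - Dat f z v) \<le> C * dist y z powr \<alpha>)"

definition C1_holder_diffeo ::
    "real \<Rightarrow> 'a::real_normed_vector set \<Rightarrow> 'b::real_normed_vector set \<Rightarrow> ('a \<Rightarrow> 'b) \<Rightarrow> bool" where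
  "C1_holder_diffeo \<alpha> U W f \<longleftrightarrow>
     bij_betw f U W \<and> C1_holder_on \<alpha> U f \<and> C1_holder_on \<alpha> W (inv_into U f)"

text \<open>The \<open>C\<^sup>1\<^sup>+\<^sup>\<alpha>\<close> norm of \<open>f\<^sub>1 - f\<^sub>2\<close> over \<open>U\<close> (maximum of the sup norm, the sup norm of the
  derivative and the Hoelder seminorm of the derivative) is less than \<open>\<delta>\<close>.\<close>

definition C1_holder_near ::
    "real \<Rightarrow> real \<Rightarrow> 'a::real_normed_vector set \<Rightarrow> ('a \<Rightarrow> 'b::real_normed_vector) \<Rightarrow> ('a \<Rightarrow> 'b) \<Rightarrow> bool" where
  "C1_holder_near \<alpha> \<delta> U f\<^sub>1 f\<^sub>2 \<longleftrightarrow>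
     C1_holder_on \<alpha> U f\<^sub>1 \<and> C1_holder_on \<alpha> U f\<^sub>2 \<and>
     (\<exists>c<\<delta>.
        (\<forall>x\<in>U. norm (f\<^sub>1 x - f\<^sub>2 x) \<le> c) \<and>
        (\<forall>x\<in>U. onorm (\<lambda>v. Dat f\<^sub>1 x v - Dat f\<^sub>2 x v) \<le> c) \<and>
        (\<forall>x\<in>U. \<forall>y\<in>U.
           onorm (\<lambda>v. (Dat f\<^sub>1 x v - Dat f\<^sub>2 x v) - (Dat f\<^sub>1 y v - Dat f\<^sub>2 y v)) \<le> c * dist x y powr \<alpha>))"

text \<open>Closeness of \<open>f\<^sub>2\<close> with domain \<open>U\<^sub>2\<close> to \<open>f\<^sub>1\<close> with domain \<open>U\<^sub>1\<close>.\<close>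

definition C1_holder_close ::
    "real \<Rightarrow> real \<Rightarrow> 'a::real_normed_vector set \<Rightarrow> ('a \<Rightarrow> 'b::real_normed_vector) \<Rightarrow>
     'a set \<Rightarrow> ('a \<Rightarrow> 'b) \<Rightarrow> bool" where
  "C1_holder_close \<alpha> \<delta> U\<^sub>2 f\<^sub>2 U\<^sub>1 f\<^sub>1 \<longleftrightarrow>
     (\<exists>\<phi>. C1_holder_diffeo \<alpha> U\<^sub>1 U\<^sub>2 \<phi> \<and> C1_holder_near \<alpha> \<delta> U\<^sub>1 \<phi> id \<and>
        C1_holder_near \<alpha> \<delta> U\<^sub>1 (f\<^sub>2 \<circ> \<phi>) f\<^sub>1)"


section \<open>Subshifts\<close>

definition subshift :: "'s set \<Rightarrow> ('s \<times> 's) set \<Rightarrow> (nat \<Rightarrow> 's) set" where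
  "subshift A B = {w. (\<forall>i. w i \<in> A) \<and> (\<forall>i. (w i, w (Suc i)) \<in> B)}"

definition left_shift :: "(nat \<Rightarrow> 's) \<Rightarrow> (nat \<Rightarrow> 's)" where
  "left_shift w = (\<lambda>i. w (Suc i))"

definition topologically_mixing :: "'a topology \<Rightarrow> ('a \<Rightarrow> 'a) \<Rightarrow> bool" where
  "topologically_mixing X T \<longleftrightarrow>
     (\<forall>U W. openin X U \<and> openin X W \<and> U \<noteq> {} \<and> W \<noteq> {} \<longrightarrow>
        (\<exists>N. \<forall>n\<ge>N. (T ^^ n) ` U \<inter> W \<noteq> {}))"


section \<open>Regular Cantor sets\<close>

text \<open>\<open>\<complex>\<^sup>d\<close> is \<^typ>\<open>complex ^ 'n\<close> with \<open>d = CARD('n)\<close>; its norm and (real) inner product are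
  those of \<open>\<real>\<^sup>2\<^sup>d\<close>, and derivatives are real-linear.

  The data of a Cantor set comprise, besides the alphabet, the admissible pairs, the pieces
  \<open>G(a)\<close>, the open set \<open>V\<close> and the map \<open>g\<close>, also the expansion constant \<open>\<mu>\<close> (which enters
  bunching) and the small radius of the neighbourhoods \<open>G\<^sup>*(a)\<close>.\<close>

record ('s, 'n) cantor_data =
  alphabet :: "'s set"
  admissible :: "('s \<times> 's) set"
  piece :: "'s \<Rightarrow> (complex ^ 'n) set"
  nbhd :: "(complex ^ 'n) set"
  expander :: "complex ^ 'n \<Rightarrow> complex ^ 'n"
  rate :: real
  radius :: real

definition symbolic_type :: "('s, 'n::finite) cantor_data \<Rightarrow> (nat \<Rightarrow> 's) set" where
  "symbolic_type K = subshift (alphabet K) (admissible K)"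

text \<open>\<open>G\<^sup>*(a)\<close>\<close>

definition star_piece :: "('s, 'n::finite) cantor_data \<Rightarrow> 's \<Rightarrow> (complex ^ 'n) set" where
  "star_piece K a = (\<Union>x \<in> piece K a. ball x (radius K))"

text \<open>The geometric conditions on a Cantor set, for a family of pieces \<open>P\<close>, which will be
  both \<open>G\<close> and the closure of \<open>G\<^sup>*\<close>.\<close>

definition markov_pieces ::
    "real \<Rightarrow> ('s, 'n::finite) cantor_data \<Rightarrow> ('s \<Rightarrow> (complex ^ 'n) set) \<Rightarrow> bool" where
  "markov_pieces \<alpha> K P \<longleftrightarrow>
     (\<forall>a \<in> alphabet K. compact (P a) \<and> connected (P a) \<and> P a \<noteq> {} \<and> P a \<subseteq> nbhd K) \<and>
     disjoint_family_on P (alphabet K) \<and>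
     (\<forall>a \<in> alphabet K. \<forall>b \<in> alphabet K.
        if (a, b) \<in> admissible K then P b \<subseteq> expander K ` P a
        else P b \<inter> expander K ` P a = {}) \<and>
     (\<forall>a \<in> alphabet K. \<exists>U W h. P a \<subseteq> U \<and> C1_holder_diffeo \<alpha> U W h \<and>
        (\<forall>x \<in> P a. h x = expander K x))"

text \<open>Points of \<open>\<Inter>\<^sub>n g\<^sup>-\<^sup>n(\<Squnion>\<^sub>a G(a))\<close> never leave the pieces, so the values of the total
  function \<^const>\<open>expander\<close> outside \<open>V\<close> are irrelevant.\<close>

definition cantor_set :: "('s, 'n::finite) cantor_data \<Rightarrow> (complex ^ 'n) set" where
  "cantor_set K = (\<Inter>n. (expander K ^^ n) -` (\<Union>a \<in> alphabet K. piece K a))"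

text \<open>The last two clauses (\<open>K\<close> is nonempty and perfect) only exclude the empty and the one-point
  subshift, which are trivially mixing; otherwise they follow from the others, as do
  compactness and total disconnectedness.\<close>

definition regular_cantor :: "real \<Rightarrow> ('s, 'n::finite) cantor_data \<Rightarrow> bool" where
  "regular_cantor \<alpha> K \<longleftrightarrow>
     finite (alphabet K) \<and> admissible K \<subseteq> alphabet K \<times> alphabet K \<and>
     C1_holder_on \<alpha> (nbhd K) (expander K) \<and>
     0 < rate K \<and> rate K < 1 \<and> (\<forall>x \<in> nbhd K. conorm (Dat (expander K) x) > inverse (rate K)) \<and>
     markov_pieces \<alpha> K (piece K) \<and>
     0 < radius K \<and> markov_pieces \<alpha> K (\<lambda>a. closure (star_piece K a)) \<and>
     topologically_mixing
       (subtopology (product_topology (\<lambda>_. discrete_topology (alphabet K)) UNIV) (symbolic_type K))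
       left_shift \<and>
     cantor_set K \<noteq> {} \<and> (\<forall>x \<in> cantor_set K. x islimpt cantor_set K)"


section \<open>Types of Cantor sets\<close>

definition GL_complex :: "(complex ^ 'n \<Rightarrow> complex ^ 'n::finite) set" where
  "GL_complex = {A. \<exists>M :: complex ^ 'n ^ 'n. invertible M \<and> A = (\<lambda>v. M *v v)}"

definition holomorphic_cantor :: "real \<Rightarrow> ('s, 'n::finite) cantor_data \<Rightarrow> bool" where
  "holomorphic_cantor \<alpha> K \<longleftrightarrow>
     regular_cantor \<alpha> K \<and> (\<forall>x \<in> cantor_set K. Dat (expander K) x \<in> GL_complex)"

definition affine_cantor :: "('s, 'n::finite) cantor_data \<Rightarrow> bool" where
  "affine_cantor K \<longleftrightarrow>
     (\<forall>a \<in> alphabet K. \<exists>A c. linear A \<and> conorm A > 1 \<and> (\<forall>x \<in> piece K a. expander K x = A x + c))"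

definition homothetical_cantor :: "('s, 'n::finite) cantor_data \<Rightarrow> bool" where
  "homothetical_cantor K \<longleftrightarrow>
     (\<forall>x \<in> cantor_set K. (\<lambda>v. Dat (expander K) x v /\<^sub>R onorm (Dat (expander K) x)) = id)"

definition conformal_cantor :: "('s, 'n::finite) cantor_data \<Rightarrow> bool" where
  "conformal_cantor K \<longleftrightarrow>
     (\<forall>x \<in> cantor_set K.
        orthogonal_transformation (\<lambda>v. Dat (expander K) x v /\<^sub>R onorm (Dat (expander K) x)))"

definition bunched_cantor :: "real \<Rightarrow> ('s, 'n::finite) cantor_data \<Rightarrow> bool" where
  "bunched_cantor \<alpha> K \<longleftrightarrow>
     (\<exists>N::nat. \<forall>x \<in> cantor_set K.
        onorm (Dat (expander K ^^ N) x) * inverse (conorm (Dat (expander K ^^ N) x))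
          * rate K powr (\<alpha> * real N) < 1)"


section \<open>Closeness and stable intersection\<close>

text \<open>\<open>L\<close> is a bunched holomorphic Cantor set that is \<open>\<delta>\<close>-close to \<open>K\<close>.\<close>

definition close_cantor ::
    "real \<Rightarrow> real \<Rightarrow> ('s, 'n::finite) cantor_data \<Rightarrow> ('s, 'n) cantor_data \<Rightarrow> bool" where
  "close_cantor \<alpha> \<delta> L K \<longleftrightarrow>
     holomorphic_cantor \<alpha> L \<and> bunched_cantor \<alpha> L \<and>
     alphabet L = alphabet K \<and> symbolic_type L = symbolic_type K \<and>
     (\<forall>a \<in> alphabet K.
        C1_holder_close \<alpha> \<delta> (star_piece L a) (expander L) (star_piece K a) (expander K))"

definition stable_intersection ::
    "real \<Rightarrow> ('s, 'n::finite) cantor_data \<Rightarrow> ('s, 'n) cantor_data \<Rightarrow> bool" where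
  "stable_intersection \<alpha> K K' \<longleftrightarrow>
     (\<exists>\<delta>\<^sub>0>0. \<forall>L L'. close_cantor \<alpha> \<delta>\<^sub>0 L K \<and> close_cantor \<alpha> \<delta>\<^sub>0 L' K' \<longrightarrow>
        cantor_set L \<inter> cantor_set L' \<noteq> {})"

end

theory Submission
  imports Defs
begin

text \<open>
  Both Cantor sets are full shifts on small round balls, expanded by the same factor
  \<open>1/\<theta>\<close>.  The thick set \<open>K'\<close> uses homotheties only; the centres of its balls of radius \<open>\<theta>\<close> form
  a \<open>4\<theta>\<close>-separated and \<open>5\<theta>\<close>-dense subset of a ball, so there are about \<open>\<theta>\<^sup>-\<^sup>2\<^sup>d\<close> of them.  The thin
  set \<open>K\<close> has \<open>m\<close> pieces, with \<open>m\<close> independent of \<open>\<theta>\<close>, so that its dimension tends to \<open>0\<close> with \<open>\<theta>\<close>.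
  The linear part of its \<open>a\<close>-th branch is \<open>\<theta>\<^sup>-\<^sup>1 (I + \<rho> Y\<^sub>a)\<close> and the centre of its \<open>a\<close>-th piece is \<open>\<theta> q\<^sub>a\<close>.
  The pairs \<open>(Y\<^sub>a, q\<^sub>a)\<close> form a finite net of the product of the unit ball of \<open>\<complex>\<close>-linear maps with a ball
  of \<open>\<complex>\<^sup>d\<close>: every combination of a linear correction and a translation is available, up to a small
  error.  The number of pairs does not depend on \<open>\<rho>\<close>, so \<open>\<rho>\<close> may be taken as small as the
  distance to the homothetical set (\<open>Y = 0\<close>) requires, even after \<open>\<theta>\<close> is fixed.

  Let \<open>L\<close>, \<open>L'\<close> be perturbations of \<open>K\<close>, \<open>K'\<close>.  The two sets are compared at smaller and smaller scales
  through a relative position \<open>\<Phi>\<close>, a map that expresses the points of a small cylinder of \<open>L\<close>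
  in the coordinates of a cylinder of \<open>L'\<close>.  Zooming in on a piece \<open>a\<close> of \<open>L\<close> and a piece \<open>b\<close> of \<open>L'\<close>
  replaces \<open>\<Phi>\<close> by \<open>g' \<circ> \<Phi> \<circ> f\<^sub>a\<close>, where \<open>f\<^sub>a\<close> is the inverse branch of \<open>g\<close> and \<open>g'\<close> acts on the piece \<open>b\<close>.
  It must be shown that \<open>\<Phi>\<close> can be kept in a bounded region close to the identity for ever
  (lemma \<open>step\<close>); then the distance of \<open>L\<close> and \<open>L'\<close> is at most of order \<open>(2\<theta>)\<^sup>n\<close> for every \<open>n\<close>, and
  two compact sets at distance \<open>0\<close> meet (theorem \<open>intersect\<close>).

  There are three quantities to control.
  \<^item> The nonlinearity of \<open>\<Phi>\<close>: it is measured by a Hoelder constant, which zooming multiplies by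
    at most \<open>4 (2\<theta>)\<^sup>\<alpha> \<le> 1/2\<close> while the perturbation adds only little.
  \<^item> The linear part of \<open>\<Phi>\<close>: the errors of the perturbation would accumulate, but one of the
    corrections \<open>Y\<^sub>a\<close> brings it back to the identity.  This works only for \<open>\<complex>\<close>-linear
    parts, and the derivative of a holomorphic Cantor set is \<open>\<complex>\<close>-linear only on the set itself.  The
    linear part is therefore a function \<open>\<Psi> x y\<close> of a point \<open>x \<in> L\<close> and a point \<open>y \<in> L'\<close>, in
    general different from the derivative of \<open>\<Phi>\<close> at \<open>x\<close>.
  \<^item> The translation part of \<open>\<Phi>\<close>: for the \<open>Y\<^sub>a\<close> just chosen all the centres in a net are available, so
    \<open>a\<close> can be chosen such that \<open>\<Phi>\<close> maps the piece \<open>a\<close> of \<open>L\<close> well inside one of the balls of \<open>K'\<close>.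

  The argument only evaluates \<open>\<Phi>\<close> at points of \<open>L\<close>.  What it needs to know about the
  perturbed maps is a first-order Taylor estimate between points of the pieces, and lemma
  \<open>close_to_affine\<close> extracts this from \<open>C\<^sup>1\<^sup>+\<^sup>\<alpha>\<close>-closeness.
\<close>

section \<open>Linear maps near the identity\<close>

text \<open>Derivatives are elements of the normed space of real-linear maps; complex linearity is a
  predicate on them, so that norms and limits of arbitrary real-linear maps remain available.\<close>

definition complex_linear :: "((complex ^ 'n) \<Rightarrow>\<^sub>L (complex ^ 'n::finite)) \<Rightarrow> bool" where
  "complex_linear B \<longleftrightarrow> (\<forall>c x. blinfun_apply B (c *s x) = c *s blinfun_apply B x)"

lemma complex_linear_id: "complex_linear id_blinfun"
  by (simp add: complex_linear_def)

lemma complex_linear_compose: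
  "complex_linear A \<Longrightarrow> complex_linear B \<Longrightarrow> complex_linear (A o\<^sub>L B)"
  by (simp add: complex_linear_def)

lemma complex_linear_inverse:
  assumes "complex_linear Z" "Z o\<^sub>L R = id_blinfun" "R o\<^sub>L Z = id_blinfun"
  shows "complex_linear R"
  unfolding complex_linear_def
proof (intro allI)
  fix c x
  have ZR: "Z (R y) = y" and RZ: "R (Z y) = y" for y
    using assms(2,3) by (metis blinfun_apply_blinfun_compose blinfun_apply_id_blinfun)+
  have "R (c *s x) = R (c *s Z (R x))" by (simp add: ZR)
  also have "\<dots> = R (Z (c *s R x))" using assms(1) by (simp add: complex_linear_def)
  finally show "R (c *s x) = c *s R x" by (simp add: RZ)
qed

lemma norm_compose_le:
  fixes A :: "'b::real_normed_vector \<Rightarrow>\<^sub>L 'c::real_normed_vector" and B :: "'a::real_normed_vector \<Rightarrow>\<^sub>L 'b"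
  assumes "norm A \<le> a" "norm B \<le> b"
  shows "norm (A o\<^sub>L B) \<le> a * b"
  using norm_blinfun_compose[of A B] mult_mono[OF assms order_trans[OF norm_ge_zero assms(1)] norm_ge_zero] 
  by linarith

lemma norm_apply_le:
  assumes "norm A \<le> a" "norm x \<le> b"
  shows "norm (blinfun_apply A x) \<le> a * b"
  using norm_blinfun[of A x] mult_mono[OF assms order_trans[OF norm_ge_zero assms(1)] norm_ge_zero] 
  by linarith

lemma norm_near_id:
  fixes Z :: "'a::euclidean_space \<Rightarrow>\<^sub>L 'a"
  assumes "norm (Z - id_blinfun) \<le> c"
  shows "norm Z \<le> 1 + c"
proof -
  have "norm Z \<le> norm (Z - id_blinfun) + norm (id_blinfun :: 'a \<Rightarrow>\<^sub>L 'a)"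
    by (metis diff_add_cancel norm_triangle_ineq)
  then show ?thesis using assms norm_blinfun_id_le[where 'a='a] by linarith
qed

lemma near_id_lower:
  fixes Z :: "'a::euclidean_space \<Rightarrow>\<^sub>L 'a"
  assumes "norm (Z - id_blinfun) \<le> c"
  shows "(1 - c) * norm x \<le> norm (Z x)"
proof -
  have "norm ((Z - id_blinfun) x) \<le> c * norm x"
    by (rule order_trans[OF norm_blinfun mult_right_mono[OF assms norm_ge_zero]])
  moreover have "norm x \<le> norm (Z x) + norm ((Z - id_blinfun) x)"
    using norm_triangle_ineq4[of "Z x" "(Z - id_blinfun) x"] by (simp add: blinfun.diff_left)
  ultimately show ?thesis by (simp add: algebra_simps)
qed

lemma near_id_inverse:
  fixes Z :: "'a::euclidean_space \<Rightarrow>\<^sub>L 'a"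
  assumes "norm (Z - id_blinfun) \<le> 1/2"
  shows "\<exists>R. Z o\<^sub>L R = id_blinfun \<and> R o\<^sub>L Z = id_blinfun \<and> norm R \<le> 2"
proof -
  have lin: "linear (blinfun_apply Z)"
    by (simp add: blinfun.bounded_linear_right bounded_linear.linear)
  have "inj (blinfun_apply Z)"
  proof (rule injI)
    fix x y assume "Z x = Z y"
    then have "Z (x - y) = 0" by (simp add: blinfun.diff_right)
    then show "x = y" using near_id_lower[OF assms, of "x - y"] by simp
  qed
  then obtain f where f: "linear f" "\<And>x. f (Z x) = x" "\<And>x. Z (f x) = x"
    using linear_injective_isomorphism[OF lin] by blast
  have bl: "bounded_linear f" using f(1) linear_conv_bounded_linear by blast
  have ap: "blinfun_apply (Blinfun f) = f" by (simp add: bl bounded_linear_Blinfun_apply)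
  have "norm (Blinfun f) \<le> 2"
  proof (rule norm_blinfun_bound)
    fix x show "norm (Blinfun f x) \<le> 2 * norm x"
      using near_id_lower[OF assms, of "f x"] by (simp add: ap f)
  qed simp
  then show ?thesis
    by (intro exI[of _ "Blinfun f"]) (auto intro!: blinfun_eqI simp: ap f)
qed

text \<open>Meaningful for \<^term>\<open>Z\<close> within \<open>1/2\<close> of the identity.\<close>

definition blinfun_inv :: "('a::euclidean_space \<Rightarrow>\<^sub>L 'a) \<Rightarrow> 'a \<Rightarrow>\<^sub>L 'a" where
  "blinfun_inv Z = (SOME R. Z o\<^sub>L R = id_blinfun \<and> R o\<^sub>L Z = id_blinfun \<and> norm R \<le> 2)"

lemma blinfun_inv:
  assumes "norm (Z - id_blinfun) \<le> 1/2"
  shows "Z o\<^sub>L blinfun_inv Z = id_blinfun" "blinfun_inv Z o\<^sub>L Z = id_blinfun"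
    "norm (blinfun_inv Z) \<le> 2" "Z (blinfun_inv Z x) = x" "blinfun_inv Z (Z x) = x"
proof -
  show *: "Z o\<^sub>L blinfun_inv Z = id_blinfun" "blinfun_inv Z o\<^sub>L Z = id_blinfun"
    "norm (blinfun_inv Z) \<le> 2"
    using someI_ex[OF near_id_inverse[OF assms]] unfolding blinfun_inv_def by auto
  show "Z (blinfun_inv Z x) = x" "blinfun_inv Z (Z x) = x"
    using *(1,2) by (metis blinfun_apply_blinfun_compose blinfun_apply_id_blinfun)+
qed

lemma blinfun_inv_diff:
  fixes Z W :: "'a::euclidean_space \<Rightarrow>\<^sub>L 'a"
  assumes Z: "norm (Z - id_blinfun) \<le> 1/2" and W: "norm (W - id_blinfun) \<le> 1/2"
  shows "norm (blinfun_inv Z - blinfun_inv W) \<le> 4 * norm (Z - W)"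
proof -
  have "blinfun_inv Z - blinfun_inv W = blinfun_inv Z o\<^sub>L (W - Z) o\<^sub>L blinfun_inv W"
    by (rule blinfun_eqI) (simp add: blinfun.diff_left blinfun.diff_right blinfun_inv[OF Z] blinfun_inv[OF W])
  also have "norm \<dots> \<le> 2 * norm (W - Z) * 2"
    by (intro norm_compose_le blinfun_inv Z W order_refl)
  finally show ?thesis by (simp add: norm_minus_commute)
qed

section \<open>Renormalisation of a pair of expanding maps\<close>

text \<open>One of the two Cantor sets, reduced to what the renormalisation uses: the set \<open>X\<close>, the expanding
  map \<open>g\<close> on the pieces \<open>D a\<close>, the inverse branches \<open>f a\<close> of \<open>g\<close> on \<open>X\<close>, and the derivative of \<open>g\<close> multiplied
  by \<open>\<theta>\<close>, called \<open>Z\<close>, which is within \<open>\<eta>\<close> of the constant \<open>T a\<close> on \<open>D a\<close>.  In the Taylor estimate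
  \<open>jet\<close> the derivative is taken at a third point \<open>w\<close>, since \<open>Z\<close> is complex linear at the points of \<open>X\<close>
  only, and \<open>u\<close>, \<open>v\<close> need not be among them.  Estimates between points replace derivatives along
  segments, since the pieces need not be convex.\<close>

locale near_affine_branches =
  fixes \<alpha> \<theta> \<eta> :: real and I :: "'s set" and X :: "(complex ^ 'n::finite) set"
    and D :: "'s \<Rightarrow> (complex ^ 'n) set" and g :: "complex ^ 'n \<Rightarrow> complex ^ 'n"
    and Z :: "complex ^ 'n \<Rightarrow> (complex ^ 'n) \<Rightarrow>\<^sub>L (complex ^ 'n)"
    and T :: "'s \<Rightarrow> (complex ^ 'n) \<Rightarrow>\<^sub>L (complex ^ 'n)"
    and f :: "'s \<Rightarrow> complex ^ 'n \<Rightarrow> complex ^ 'n"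
  assumes \<alpha>: "0 < \<alpha>" "\<alpha> \<le> 1" and \<theta>: "0 < \<theta>" and \<eta>: "0 \<le> \<eta>" "\<eta> \<le> 1/8"
    and jet: "\<And>a u v w. a \<in> I \<Longrightarrow> u \<in> D a \<Longrightarrow> v \<in> D a \<Longrightarrow> w \<in> D a \<Longrightarrow>
        norm (\<theta> *\<^sub>R (g u - g v) - Z w (u - v))
          \<le> \<eta> * (norm (u - w) powr \<alpha> + norm (v - w) powr \<alpha>) * norm (u - v)"
    and Z_holder: "\<And>a u v. a \<in> I \<Longrightarrow> u \<in> D a \<Longrightarrow> v \<in> D a \<Longrightarrow> norm (Z u - Z v) \<le> \<eta> * norm (u - v) powr \<alpha>"
    and Z_near: "\<And>a w. a \<in> I \<Longrightarrow> w \<in> D a \<Longrightarrow> norm (Z w - T a) \<le> \<eta>"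
    and T_near_id: "\<And>a. a \<in> I \<Longrightarrow> norm (T a - id_blinfun) \<le> 1/8"
    and small: "\<And>a u v. a \<in> I \<Longrightarrow> u \<in> D a \<Longrightarrow> v \<in> D a \<Longrightarrow> norm (u - v) \<le> 1"
    and branch: "\<And>a x. a \<in> I \<Longrightarrow> x \<in> X \<Longrightarrow> f a x \<in> X \<and> f a x \<in> D a \<and> g (f a x) = x"
    and Z_complex: "\<And>x. x \<in> X \<Longrightarrow> complex_linear (Z x)"
begin

lemma Z_near_id:
  assumes "a \<in> I" "w \<in> D a"
  shows "norm (Z w - id_blinfun) \<le> 1/4"
  using Z_near[OF assms] T_near_id[OF assms(1)] \<eta> norm_triangle_ineq[of "Z w - T a" "T a - id_blinfun"]
  by simp

lemma expanding:
  assumes a: "a \<in> I" and u: "u \<in> D a" and v: "v \<in> D a"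
  shows "norm (u - v) \<le> 2 * \<theta> * norm (g u - g v)"
proof -
  have "norm (u - v) powr \<alpha> \<le> 1"
    using small[OF a u v] \<alpha> by (simp add: powr_le1)
  then have "\<eta> * (norm (u - v) powr \<alpha> + norm (v - v) powr \<alpha>) * norm (u - v) \<le> 1/8 * 1 * norm (u - v)"
    using \<eta> by (intro mult_right_mono mult_mono) auto
  then have "norm (\<theta> *\<^sub>R (g u - g v) - Z v (u - v)) \<le> 1/8 * norm (u - v)"
    using jet[OF a u v v] by linarith
  moreover have "3/4 * norm (u - v) \<le> norm (Z v (u - v))"
    using near_id_lower[OF Z_near_id[OF a v], of "u - v"] by simp
  moreover have "norm (Z v (u - v)) \<le> norm (\<theta> *\<^sub>R (g u - g v)) + norm (\<theta> *\<^sub>R (g u - g v) - Z v (u - v))"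
    using norm_triangle_sub norm_minus_commute by metis
  ultimately have "1/2 * norm (u - v) \<le> norm (\<theta> *\<^sub>R (g u - g v))"
    using norm_ge_zero[of "u - v"] by linarith
  then show ?thesis using \<theta> by simp
qed

lemma expanding_powr:
  assumes a: "a \<in> I" and u: "u \<in> D a" and v: "v \<in> D a"
  shows "norm (u - v) powr \<alpha> \<le> (2 * \<theta>) powr \<alpha> * norm (g u - g v) powr \<alpha>"
proof -
  have "norm (u - v) powr \<alpha> \<le> (2 * \<theta> * norm (g u - g v)) powr \<alpha>"
    using expanding[OF assms] \<alpha> by (intro powr_mono2) auto
  then show ?thesis using \<theta> by (simp add: powr_mult)
qed

end

text \<open>The assumption \<open>correction\<close> is where the geometry of the two Cantor sets enters: for every
  relative linear part \<open>B\<close> and relative translation \<open>t\<close> in the admissible range, a pair of pieces exists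
  that resets \<open>B\<close> to the identity up to \<open>\<rho>/8\<close> and centres the piece of \<open>X\<close> in the piece of \<open>X'\<close> up to \<open>\<theta>/16\<close>.
  The numerical assumptions say \<open>\<eta> \<lless> \<kappa> \<lless> \<rho> \<lless> \<theta>\<close>.\<close>

locale renormalization =
  A: near_affine_branches \<alpha> \<theta> \<eta> I X D g Z T f + A': near_affine_branches \<alpha> \<theta> \<eta> I' X' D' g' Z' "\<lambda>_. id_blinfun" f'
  for \<alpha> \<theta> \<eta> :: real and I :: "'s set" and X :: "(complex ^ 'n::finite) set" and D g Z T f
    and I' :: "'t set" and X' D' g' Z' f' +
  fixes p :: "'s \<Rightarrow> complex ^ 'n" and c :: "'t \<Rightarrow> complex ^ 'n" and \<rho> \<kappa> :: real
  assumes \<theta>_powr: "(2 * \<theta>) powr \<alpha> \<le> 1/8"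
    and \<kappa>: "0 \<le> \<kappa>" "22 * \<eta> \<le> \<kappa>" "4 * \<kappa> + 3 * \<eta> \<le> 3/8 * \<rho>" "\<rho> + 5 * \<kappa> \<le> \<theta> / 2" "\<rho> \<le> 1/8" "\<kappa> \<le> 1/8"
    and X_small: "X \<subseteq> cball 0 (1/16)" and X'_small: "X' \<subseteq> cball 0 1"
    and X_nonempty: "X \<noteq> {}" and X'_nonempty: "X' \<noteq> {}"
    and f_near: "\<And>a x. a \<in> I \<Longrightarrow> x \<in> X \<Longrightarrow> norm (f a x - p a) \<le> \<theta> / 8"
    and D'_large: "\<And>b. b \<in> I' \<Longrightarrow> cball (c b) (\<theta> / 2) \<subseteq> D' b"
    and g'_near: "\<And>b u. b \<in> I' \<Longrightarrow> u \<in> D' b \<Longrightarrow> norm (g' u - (u - c b) /\<^sub>R \<theta>) \<le> 1/16"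
    and correction: "\<And>B t. complex_linear B \<Longrightarrow> norm (B - id_blinfun) \<le> \<rho> \<Longrightarrow> norm t \<le> 1/2 \<Longrightarrow>
        \<exists>a\<in>I. \<exists>b\<in>I'. norm (B - T a) \<le> \<rho> / 8 \<and> norm (t + p a - c b) \<le> \<theta> / 16"
begin

text \<open>How far the pair \<open>x\<^sub>1, x\<^sub>2\<close> and its image are from the base points \<open>x\<close> and \<open>y\<close>.  All four terms
  shrink at least by the factor \<open>(2\<theta>)\<^sup>\<alpha>\<close> when both sides are pulled back by one branch.\<close>

definition scale_errors where
  "scale_errors \<Phi> x\<^sub>1 x\<^sub>2 x y = norm (x\<^sub>1 - x) powr \<alpha> + norm (x\<^sub>2 - x) powr \<alpha>
     + norm (\<Phi> x\<^sub>1 - y) powr \<alpha> + norm (\<Phi> x\<^sub>2 - y) powr \<alpha>"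

text \<open>The state of the renormalisation.  The last clause is a Taylor estimate for \<open>\<Phi>\<close>, in which any
  \<open>\<Psi> x y\<close> serves as derivative at the price of the distance from the base points.\<close>

definition renormalized where
  "renormalized \<Phi> \<Psi> \<longleftrightarrow>
     (\<forall>x\<in>X. norm (\<Phi> x) \<le> 3/8) \<and>
     (\<forall>x\<in>X. \<forall>y\<in>X'. complex_linear (\<Psi> x y) \<and> norm (\<Psi> x y - id_blinfun) \<le> \<rho>) \<and>
     (\<forall>x\<in>X. \<forall>y\<in>X'. \<forall>x\<^sub>1\<in>X. \<forall>y\<^sub>1\<in>X'.
        norm (\<Psi> x y - \<Psi> x\<^sub>1 y\<^sub>1) \<le> \<kappa> * (norm (x - x\<^sub>1) powr \<alpha> + norm (y - y\<^sub>1) powr \<alpha>)) \<and>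
     (\<forall>x\<^sub>1\<in>X. \<forall>x\<^sub>2\<in>X. \<forall>x\<in>X. \<forall>y\<in>X'.
        norm (\<Phi> x\<^sub>1 - \<Phi> x\<^sub>2 - \<Psi> x y (x\<^sub>1 - x\<^sub>2)) \<le> \<kappa> * scale_errors \<Phi> x\<^sub>1 x\<^sub>2 x y * norm (x\<^sub>1 - x\<^sub>2))"

lemma powr_le_self_2:
  assumes "0 \<le> t" "t \<le> 2" shows "t powr \<alpha> \<le> 2"
proof -
  have "t powr \<alpha> \<le> 2 powr \<alpha>" using assms A.\<alpha> by (intro powr_mono2) auto
  also have "\<dots> \<le> 2 powr 1" using A.\<alpha> by (intro powr_mono) auto
  finally show ?thesis by simp
qed

lemma renormalized_id: "renormalized (\<lambda>x. x) (\<lambda>_ _. id_blinfun)"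
  unfolding renormalized_def scale_errors_def using X_small \<kappa> A.\<eta>
  by (force simp: complex_linear_id subset_iff intro!: mult_nonneg_nonneg add_nonneg_nonneg)

lemma X_dist:
  assumes "x \<in> X" "x\<^sub>1 \<in> X" shows "norm (x - x\<^sub>1) \<le> 1/8"
proof -
  have "norm x \<le> 1/16" "norm x\<^sub>1 \<le> 1/16" using assms X_small by auto
  then show ?thesis using norm_triangle_ineq4[of x x\<^sub>1] by linarith
qed

lemma X_powr:
  assumes "x \<in> X" "x\<^sub>1 \<in> X" shows "norm (x - x\<^sub>1) powr \<alpha> \<le> 1"
  using X_dist[OF assms] A.\<alpha> by (intro powr_le1) auto

lemma X'_powr:
  assumes "norm u \<le> 1" "y \<in> X'" shows "norm (u - y) powr \<alpha> \<le> 2"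
proof -
  have "norm y \<le> 1" using assms X'_small by auto
  then show ?thesis using norm_triangle_ineq4[of u y] assms by (intro powr_le_self_2) auto
qed

definition next_\<Phi> where "next_\<Phi> \<Phi> a x = g' (\<Phi> (f a x))"
definition next_\<Psi> where
  "next_\<Psi> \<Psi> a b x y = Z' (f' b y) o\<^sub>L \<Psi> (f a x) (f' b y) o\<^sub>L blinfun_inv (Z (f a x))"

text \<open>The heart of the argument.  The new Hoelder and Taylor constants are at most
  \<open>(4\<kappa> + 22\<eta>) (2\<theta>)\<^sup>\<alpha> \<le> \<kappa>\<close>, since pulling back shrinks all distances from the base points.
  The linear part and the position are restored by the choice of \<open>a\<close> and \<open>b\<close>.\<close>

lemma step:
  assumes R: "renormalized \<Phi> \<Psi>"
  shows "\<exists>a\<in>I. \<exists>b\<in>I'. renormalized (next_\<Phi> \<Phi> a) (next_\<Psi> \<Psi> a b) \<and> (\<forall>x\<in>X. \<Phi> (f a x) \<in> D' b)"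
proof -
  obtain x\<^sub>0 where x0: "x\<^sub>0 \<in> X" using X_nonempty by auto
  obtain y\<^sub>0 where y0: "y\<^sub>0 \<in> X'" using X'_nonempty by auto
  have \<Phi>_small: "norm (\<Phi> x) \<le> 3/8" if "x \<in> X" for x
    using R that unfolding renormalized_def by blast
  have \<Psi>_complex: "complex_linear (\<Psi> x y)" and \<Psi>_near: "norm (\<Psi> x y - id_blinfun) \<le> \<rho>"
    if "x \<in> X" "y \<in> X'" for x y
    using R that unfolding renormalized_def by blast+
  have \<Psi>_holder: "norm (\<Psi> x y - \<Psi> x\<^sub>1 y\<^sub>1) \<le> \<kappa> * (norm (x - x\<^sub>1) powr \<alpha> + norm (y - y\<^sub>1) powr \<alpha>)"
    if "x \<in> X" "y \<in> X'" "x\<^sub>1 \<in> X" "y\<^sub>1 \<in> X'" for x y x\<^sub>1 y\<^sub>1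
    using R that unfolding renormalized_def by blast
  have \<Phi>_jet: "norm (\<Phi> x\<^sub>1 - \<Phi> x\<^sub>2 - \<Psi> x y (x\<^sub>1 - x\<^sub>2)) \<le> \<kappa> * scale_errors \<Phi> x\<^sub>1 x\<^sub>2 x y * norm (x\<^sub>1 - x\<^sub>2)"
    if "x\<^sub>1 \<in> X" "x\<^sub>2 \<in> X" "x \<in> X" "y \<in> X'" for x\<^sub>1 x\<^sub>2 x y
    using R that unfolding renormalized_def by blast
  have \<Psi>_le2: "norm (\<Psi> x y) \<le> 2" if "x \<in> X" "y \<in> X'" for x y
    using norm_near_id[OF \<Psi>_near[OF that]] \<kappa> by linarith
  \<comment> \<open>As the linear part is near the identity, \<open>\<Phi>\<close> is close to the translation by \<open>\<Phi> x\<^sub>0 - x\<^sub>0\<close>.\<close>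
  have "norm (\<Phi> x\<^sub>0 - x\<^sub>0) \<le> 1/2"
    using norm_triangle_ineq4[of "\<Phi> x\<^sub>0" "x\<^sub>0"] \<Phi>_small[OF x0] x0 X_small by auto
  then obtain a b where a: "a \<in> I" and b: "b \<in> I'" and lin: "norm (\<Psi> x\<^sub>0 y\<^sub>0 - T a) \<le> \<rho> / 8"
    and pos: "norm (\<Phi> x\<^sub>0 - x\<^sub>0 + p a - c b) \<le> \<theta> / 16"
    using correction[OF \<Psi>_complex[OF x0 y0] \<Psi>_near[OF x0 y0]] by blast
  have fX: "f a x \<in> X" and fD: "f a x \<in> D a" and gf: "g (f a x) = x" if "x \<in> X" for x
    using A.branch[OF a that] by auto
  have fX': "f' b y \<in> X'" and fD': "f' b y \<in> D' b" and gf': "g' (f' b y) = y" if "y \<in> X'" for y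
    using A'.branch[OF b that] by auto
  have near_c: "norm (\<Phi> (f a x) - c b) \<le> \<theta> / 4" if x: "x \<in> X" for x
  proof -
    let ?e = "f a x - x\<^sub>0"
    let ?E = "\<Phi> (f a x) - \<Phi> x\<^sub>0 - \<Psi> x\<^sub>0 y\<^sub>0 ?e"
    have "scale_errors \<Phi> (f a x) x\<^sub>0 x\<^sub>0 y\<^sub>0 \<le> 1 + 0 + 2 + 2"
      unfolding scale_errors_def using \<Phi>_small[OF fX[OF x]] \<Phi>_small[OF x0]
      by (intro add_mono X_powr X'_powr fX x x0 y0) auto
    then have "\<kappa> * scale_errors \<Phi> (f a x) x\<^sub>0 x\<^sub>0 y\<^sub>0 * norm ?e \<le> \<kappa> * 5 * (1/8)"
      using \<kappa> X_dist[OF fX[OF x] x0] by (intro mult_mono mult_nonneg_nonneg) (auto simp: scale_errors_def)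
    then have 1: "norm ?E \<le> \<kappa> * 5 * (1/8)"
      using \<Phi>_jet[OF fX[OF x] x0 x0 y0] by linarith
    have 2: "norm ((\<Psi> x\<^sub>0 y\<^sub>0 - id_blinfun) ?e) \<le> \<rho> * (1/8)"
      by (intro norm_apply_le \<Psi>_near X_dist fX x x0 y0)
    have eq: "\<Phi> (f a x) - c b = (\<Phi> x\<^sub>0 - x\<^sub>0 + p a - c b) + (f a x - p a) + (\<Psi> x\<^sub>0 y\<^sub>0 - id_blinfun) ?e + ?E"
      by (simp add: blinfun.diff_left)
    show ?thesis
      unfolding eq
      using pos f_near[OF a x] 1 2 \<kappa>
        norm_triangle_ineq[of "\<Phi> x\<^sub>0 - x\<^sub>0 + p a - c b" "f a x - p a"]
        norm_triangle_ineq[of "\<Phi> x\<^sub>0 - x\<^sub>0 + p a - c b + (f a x - p a)" "(\<Psi> x\<^sub>0 y\<^sub>0 - id_blinfun) ?e"]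
        norm_triangle_ineq[of "\<Phi> x\<^sub>0 - x\<^sub>0 + p a - c b + (f a x - p a) + (\<Psi> x\<^sub>0 y\<^sub>0 - id_blinfun) ?e" ?E]
      by linarith
  qed
  have \<Phi>D: "\<Phi> (f a x) \<in> D' b" if x: "x \<in> X" for x
    using D'_large[OF b] near_c[OF x] A.\<theta>
    by (auto simp: subset_iff dist_norm norm_minus_commute)
  have Z2: "norm (Z' (f' b y)) \<le> 2" if "y \<in> X'" for y
    using norm_near_id[OF A'.Z_near_id[OF b fD'[OF that]]] by simp
  have Zh: "norm (Z (f a x) - id_blinfun) \<le> 1/2" if "x \<in> X" for x
    using A.Z_near_id[OF a fD[OF that]] by simp
  note inv = blinfun_inv[OF Zh]
  have ex: "norm (f a x - f a x\<^sub>1) powr \<alpha> \<le> 1/8 * norm (x - x\<^sub>1) powr \<alpha>" if "x \<in> X" "x\<^sub>1 \<in> X" for x x\<^sub>1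
    using order_trans[OF A.expanding_powr[OF a fD[OF that(1)] fD[OF that(2)]] mult_right_mono[OF \<theta>_powr powr_ge_zero]]
    by (simp add: gf that)
  have ex': "norm (u - v) powr \<alpha> \<le> 1/8 * norm (g' u - g' v) powr \<alpha>" if "u \<in> D' b" "v \<in> D' b" for u v
    by (rule order_trans[OF A'.expanding_powr[OF b that] mult_right_mono[OF \<theta>_powr powr_ge_zero]])
  have "renormalized (next_\<Phi> \<Phi> a) (next_\<Psi> \<Psi> a b)"
    unfolding renormalized_def
  proof (intro conjI ballI)
    fix x assume x: "x \<in> X"
    have "norm ((\<Phi> (f a x) - c b) /\<^sub>R \<theta>) \<le> 1/4"
      unfolding norm_scaleR using near_c[OF x] A.\<theta> by (simp add: field_simps)
    then show "norm (next_\<Phi> \<Phi> a x) \<le> 3/8"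
      using g'_near[OF b \<Phi>D[OF x]] norm_triangle_sub[of "g' (\<Phi> (f a x))" "(\<Phi> (f a x) - c b) /\<^sub>R \<theta>"]
      unfolding next_\<Phi>_def by linarith
  next
    fix x y assume x: "x \<in> X" and y: "y \<in> X'"
    show "complex_linear (next_\<Psi> \<Psi> a b x y)"
      unfolding next_\<Psi>_def
      by (intro complex_linear_compose A'.Z_complex \<Psi>_complex fX fX' x y
          complex_linear_inverse[OF A.Z_complex[OF fX[OF x]] inv(1)[OF x] inv(2)[OF x]])
    let ?Z = "Z (f a x)" and ?Z' = "Z' (f' b y)" and ?P = "\<Psi> (f a x) (f' b y)"
    have 1: "norm ((?Z' - id_blinfun) o\<^sub>L ?P) \<le> \<eta> * 2"
      by (intro norm_compose_le A'.Z_near[OF b] \<Psi>_le2 fD' fX fX' x y)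
    have "norm (f a x - x\<^sub>0) powr \<alpha> + norm (f' b y - y\<^sub>0) powr \<alpha> \<le> 1 + 2"
      using fX'[OF y] X'_small by (intro add_mono X_powr X'_powr fX x x0 y0) auto
    then have "\<kappa> * (norm (f a x - x\<^sub>0) powr \<alpha> + norm (f' b y - y\<^sub>0) powr \<alpha>) \<le> \<kappa> * 3"
      using \<kappa> by (intro mult_left_mono) auto
    then have 2: "norm (?P - \<Psi> x\<^sub>0 y\<^sub>0) \<le> \<kappa> * 3"
      using \<Psi>_holder[OF fX[OF x] fX'[OF y] x0 y0] by linarith
    have 3: "norm (T a - ?Z) \<le> \<eta>"
      using A.Z_near[OF a fD[OF x]] by (simp add: norm_minus_commute)
    \<comment> \<open>\<open>?N\<close> is \<open>?Z' o\<^sub>L ?P - ?Z\<close>; the correction makes its main part \<open>\<Psi> x\<^sub>0 y\<^sub>0 - T a\<close> small.\<close>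
    let ?N = "((?Z' - id_blinfun) o\<^sub>L ?P) + (?P - \<Psi> x\<^sub>0 y\<^sub>0) + (\<Psi> x\<^sub>0 y\<^sub>0 - T a) + (T a - ?Z)"
    have N: "norm ?N \<le> \<rho> / 2"
      using 1 2 3 lin \<kappa> A.\<eta>
        norm_triangle_ineq[of "(?Z' - id_blinfun) o\<^sub>L ?P" "?P - \<Psi> x\<^sub>0 y\<^sub>0"]
        norm_triangle_ineq[of "((?Z' - id_blinfun) o\<^sub>L ?P) + (?P - \<Psi> x\<^sub>0 y\<^sub>0)" "\<Psi> x\<^sub>0 y\<^sub>0 - T a"]
        norm_triangle_ineq[of "((?Z' - id_blinfun) o\<^sub>L ?P) + (?P - \<Psi> x\<^sub>0 y\<^sub>0) + (\<Psi> x\<^sub>0 y\<^sub>0 - T a)" "T a - ?Z"]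
      by linarith
    have "next_\<Psi> \<Psi> a b x y - id_blinfun = ?N o\<^sub>L blinfun_inv ?Z"
      unfolding next_\<Psi>_def
      by (rule blinfun_eqI) (simp add: blinfun.diff_left blinfun.add_left blinfun.diff_right inv[OF x])
    also have "norm \<dots> \<le> \<rho> / 2 * 2"
      by (intro norm_compose_le N inv x)
    finally show "norm (next_\<Psi> \<Psi> a b x y - id_blinfun) \<le> \<rho>" by simp
  next
    fix x y x\<^sub>1 y\<^sub>1 assume x: "x \<in> X" and y: "y \<in> X'" and x1: "x\<^sub>1 \<in> X" and y1: "y\<^sub>1 \<in> X'"
    let ?Z = "Z (f a x)" and ?Z' = "Z' (f' b y)" and ?P = "\<Psi> (f a x) (f' b y)"
    let ?Z1 = "Z (f a x\<^sub>1)" and ?Z1' = "Z' (f' b y\<^sub>1)" and ?P1 = "\<Psi> (f a x\<^sub>1) (f' b y\<^sub>1)"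
    let ?dx = "norm (f a x - f a x\<^sub>1) powr \<alpha>" and ?dy = "norm (f' b y - f' b y\<^sub>1) powr \<alpha>"
    have 1: "norm ((?Z' - ?Z1') o\<^sub>L ?P o\<^sub>L blinfun_inv ?Z) \<le> (\<eta> * ?dy) * 2 * 2"
      by (intro norm_compose_le A'.Z_holder[OF b] \<Psi>_le2 inv fD' fX fX' x y y1)
    have 2: "norm (?Z1' o\<^sub>L (?P - ?P1) o\<^sub>L blinfun_inv ?Z) \<le> 2 * (\<kappa> * (?dx + ?dy)) * 2"
      by (intro norm_compose_le Z2 \<Psi>_holder inv fX fX' x y x1 y1)
    have "norm (blinfun_inv ?Z - blinfun_inv ?Z1) \<le> 4 * (\<eta> * ?dx)"
      using blinfun_inv_diff[OF Zh[OF x] Zh[OF x1]] A.Z_holder[OF a fD[OF x] fD[OF x1]] by linarith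
    then have 3: "norm (?Z1' o\<^sub>L ?P1 o\<^sub>L (blinfun_inv ?Z - blinfun_inv ?Z1)) \<le> 2 * 2 * (4 * (\<eta> * ?dx))"
      by (intro norm_compose_le Z2 \<Psi>_le2 fX fX' x1 y1)
    have "next_\<Psi> \<Psi> a b x y - next_\<Psi> \<Psi> a b x\<^sub>1 y\<^sub>1 = ((?Z' - ?Z1') o\<^sub>L ?P o\<^sub>L blinfun_inv ?Z)
      + (?Z1' o\<^sub>L (?P - ?P1) o\<^sub>L blinfun_inv ?Z) + (?Z1' o\<^sub>L ?P1 o\<^sub>L (blinfun_inv ?Z - blinfun_inv ?Z1))"
      unfolding next_\<Psi>_def
      by (rule blinfun_eqI) (simp add: blinfun.diff_left blinfun.add_left blinfun.diff_right)
    then have "norm (next_\<Psi> \<Psi> a b x y - next_\<Psi> \<Psi> a b x\<^sub>1 y\<^sub>1)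
      \<le> (\<eta> * ?dy) * 2 * 2 + 2 * (\<kappa> * (?dx + ?dy)) * 2 + 2 * 2 * (4 * (\<eta> * ?dx))"
      using norm_triangle_mono[OF norm_triangle_mono[OF 1 2] 3] by simp
    also have "\<dots> \<le> (4 * \<kappa> + 16 * \<eta>) * (?dx + ?dy)"
      using A.\<eta> by (simp add: algebra_simps)
    also have "\<dots> \<le> (4 * \<kappa> + 16 * \<eta>) * (1/8 * (norm (x - x\<^sub>1) powr \<alpha> + norm (y - y\<^sub>1) powr \<alpha>))"
      using ex[OF x x1] ex'[OF fD'[OF y] fD'[OF y1]] \<kappa> A.\<eta> gf' y y1 by (intro mult_left_mono) auto
    also have "\<dots> = ((4 * \<kappa> + 16 * \<eta>) / 8) * (norm (x - x\<^sub>1) powr \<alpha> + norm (y - y\<^sub>1) powr \<alpha>)"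
      by simp
    also have "\<dots> \<le> \<kappa> * (norm (x - x\<^sub>1) powr \<alpha> + norm (y - y\<^sub>1) powr \<alpha>)"
      using \<kappa> by (intro mult_right_mono add_nonneg_nonneg) auto
    finally show "norm (next_\<Psi> \<Psi> a b x y - next_\<Psi> \<Psi> a b x\<^sub>1 y\<^sub>1)
      \<le> \<kappa> * (norm (x - x\<^sub>1) powr \<alpha> + norm (y - y\<^sub>1) powr \<alpha>)" .
  next
    fix x\<^sub>1 x\<^sub>2 x y assume x1: "x\<^sub>1 \<in> X" and x2: "x\<^sub>2 \<in> X" and x: "x \<in> X" and y: "y \<in> X'"
    let ?u = "\<Phi> (f a x\<^sub>1)" and ?v = "\<Phi> (f a x\<^sub>2)" and ?w = "f' b y"
    let ?e = "f a x\<^sub>1 - f a x\<^sub>2"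
    let ?B = "\<Psi> (f a x) ?w" and ?Z = "Z (f a x)" and ?Z' = "Z' ?w"
    let ?\<omega> = "scale_errors \<Phi> (f a x\<^sub>1) (f a x\<^sub>2) (f a x) ?w"
    have \<omega>: "0 \<le> ?\<omega>" unfolding scale_errors_def by (intro add_nonneg_nonneg) auto
    have "?\<omega> \<le> 1 + 1 + 2 + 2"
      unfolding scale_errors_def using \<Phi>_small[OF fX[OF x1]] \<Phi>_small[OF fX[OF x2]]
      by (intro add_mono X_powr X'_powr fX fX' x x1 x2 y) auto
    then have k6: "\<kappa> * ?\<omega> \<le> 1/8 * 6" using \<kappa> \<omega> by (intro mult_mono) auto
    have j: "norm (?u - ?v - ?B ?e) \<le> \<kappa> * ?\<omega> * norm ?e"
      by (intro \<Phi>_jet fX fX' x x1 x2 y)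
    have "norm (?B ?e) \<le> 2 * norm ?e" by (intro norm_apply_le \<Psi>_le2 fX fX' x y order_refl)
    moreover have "\<kappa> * ?\<omega> * norm ?e \<le> 1 * norm ?e" using k6 by (intro mult_right_mono) auto
    ultimately have uv: "norm (?u - ?v) \<le> 3 * norm ?e"
      using j norm_triangle_sub[of "?u - ?v" "?B ?e"] by linarith
    have 1: "norm (\<theta> *\<^sub>R (g' ?u - g' ?v) - ?Z' (?u - ?v)) \<le> \<eta> * ?\<omega> * (3 * norm ?e)"
    proof -
      have "norm (\<theta> *\<^sub>R (g' ?u - g' ?v) - ?Z' (?u - ?v))
          \<le> \<eta> * (norm (?u - ?w) powr \<alpha> + norm (?v - ?w) powr \<alpha>) * norm (?u - ?v)"
        by (intro A'.jet[OF b] \<Phi>D fD' x1 x2 y)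
      also have "\<dots> \<le> \<eta> * ?\<omega> * (3 * norm ?e)"
        using uv A.\<eta> \<omega> by (intro mult_mono mult_nonneg_nonneg) (auto simp: scale_errors_def)
      finally show ?thesis .
    qed
    have 2: "norm (?Z' (?u - ?v - ?B ?e)) \<le> 2 * (\<kappa> * ?\<omega> * norm ?e)"
      by (intro norm_apply_le Z2 j y)
    have r: "norm (\<theta> *\<^sub>R (x\<^sub>1 - x\<^sub>2) - ?Z ?e) \<le> \<eta> * ?\<omega> * norm ?e"
    proof -
      have "norm (\<theta> *\<^sub>R (g (f a x\<^sub>1) - g (f a x\<^sub>2)) - ?Z ?e)
         \<le> \<eta> * (norm (f a x\<^sub>1 - f a x) powr \<alpha> + norm (f a x\<^sub>2 - f a x) powr \<alpha>) * norm ?e"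
        by (intro A.jet[OF a] fD x x1 x2)
      also have "\<dots> \<le> \<eta> * ?\<omega> * norm ?e"
        using A.\<eta> by (intro mult_mono mult_nonneg_nonneg) (auto simp: scale_errors_def)
      finally show ?thesis by (simp add: gf x1 x2)
    qed
    have "norm ((?Z' o\<^sub>L ?B o\<^sub>L blinfun_inv ?Z) (\<theta> *\<^sub>R (x\<^sub>1 - x\<^sub>2) - ?Z ?e)) \<le> 2 * 2 * 2 * (\<eta> * ?\<omega> * norm ?e)"
      by (intro norm_apply_le norm_compose_le Z2 \<Psi>_le2 inv fX fX' x y r)
    then have 3: "norm (?Z' (?B ?e) - \<theta> *\<^sub>R next_\<Psi> \<Psi> a b x y (x\<^sub>1 - x\<^sub>2)) \<le> 2 * 2 * 2 * (\<eta> * ?\<omega> * norm ?e)"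
      unfolding next_\<Psi>_def
      by (simp add: blinfun.diff_right blinfun.scaleR_right inv[OF x] norm_minus_commute)
    \<comment> \<open>Three Taylor errors: of \<open>g'\<close>, of \<open>\<Phi>\<close>, and of the inverse branch \<open>f a\<close>.\<close>
    have eq: "\<theta> *\<^sub>R (next_\<Phi> \<Phi> a x\<^sub>1 - next_\<Phi> \<Phi> a x\<^sub>2 - next_\<Psi> \<Psi> a b x y (x\<^sub>1 - x\<^sub>2))
      = (\<theta> *\<^sub>R (g' ?u - g' ?v) - ?Z' (?u - ?v)) + ?Z' (?u - ?v - ?B ?e)
        + (?Z' (?B ?e) - \<theta> *\<^sub>R next_\<Psi> \<Psi> a b x y (x\<^sub>1 - x\<^sub>2))"
      unfolding next_\<Phi>_def blinfun.diff_right[of ?Z' "?u - ?v" "?B ?e"]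
      by (simp add: scaleR_diff_right)
    have "norm (\<theta> *\<^sub>R (next_\<Phi> \<Phi> a x\<^sub>1 - next_\<Phi> \<Phi> a x\<^sub>2 - next_\<Psi> \<Psi> a b x y (x\<^sub>1 - x\<^sub>2)))
      \<le> \<eta> * ?\<omega> * (3 * norm ?e) + 2 * (\<kappa> * ?\<omega> * norm ?e) + 2 * 2 * 2 * (\<eta> * ?\<omega> * norm ?e)"
      unfolding eq by (intro norm_triangle_mono 1 2 3)
    then have "\<theta> * norm (next_\<Phi> \<Phi> a x\<^sub>1 - next_\<Phi> \<Phi> a x\<^sub>2 - next_\<Psi> \<Psi> a b x y (x\<^sub>1 - x\<^sub>2))
      \<le> \<eta> * ?\<omega> * (3 * norm ?e) + 2 * (\<kappa> * ?\<omega> * norm ?e) + 2 * 2 * 2 * (\<eta> * ?\<omega> * norm ?e)"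
      by (simp only: norm_scaleR abs_of_pos[OF A.\<theta>])
    also have "\<dots> = (2 * \<kappa> + 11 * \<eta>) * ?\<omega> * norm ?e" by (simp add: algebra_simps)
    also have "\<dots> \<le> (2 * \<kappa> + 11 * \<eta>) * (1/8 * scale_errors (next_\<Phi> \<Phi> a) x\<^sub>1 x\<^sub>2 x y) * (2 * \<theta> * norm (x\<^sub>1 - x\<^sub>2))"
    proof (intro mult_mono)
      show "?\<omega> \<le> 1/8 * scale_errors (next_\<Phi> \<Phi> a) x\<^sub>1 x\<^sub>2 x y"
        using ex[OF x1 x] ex[OF x2 x] ex'[OF \<Phi>D[OF x1] fD'[OF y]] ex'[OF \<Phi>D[OF x2] fD'[OF y]] gf'[OF y]
        unfolding scale_errors_def next_\<Phi>_def by simp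
      then show "0 \<le> (2 * \<kappa> + 11 * \<eta>) * (1/8 * scale_errors (next_\<Phi> \<Phi> a) x\<^sub>1 x\<^sub>2 x y)"
        using \<omega> \<kappa> A.\<eta> by (intro mult_nonneg_nonneg) auto
      show "norm ?e \<le> 2 * \<theta> * norm (x\<^sub>1 - x\<^sub>2)"
        using A.expanding[OF a fD[OF x1] fD[OF x2]] by (simp add: gf x1 x2)
    qed (use \<kappa> A.\<eta> \<omega> in auto)
    also have "\<dots> = \<theta> * (((4 * \<kappa> + 22 * \<eta>) / 8) * (scale_errors (next_\<Phi> \<Phi> a) x\<^sub>1 x\<^sub>2 x y * norm (x\<^sub>1 - x\<^sub>2)))"
      by (simp add: field_simps)
    finally have "norm (next_\<Phi> \<Phi> a x\<^sub>1 - next_\<Phi> \<Phi> a x\<^sub>2 - next_\<Psi> \<Psi> a b x y (x\<^sub>1 - x\<^sub>2))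
      \<le> ((4 * \<kappa> + 22 * \<eta>) / 8) * (scale_errors (next_\<Phi> \<Phi> a) x\<^sub>1 x\<^sub>2 x y * norm (x\<^sub>1 - x\<^sub>2))"
      using A.\<theta> mult_le_cancel_left_pos by blast
    also have "\<dots> \<le> \<kappa> * (scale_errors (next_\<Phi> \<Phi> a) x\<^sub>1 x\<^sub>2 x y * norm (x\<^sub>1 - x\<^sub>2))"
      using \<kappa> by (intro mult_right_mono) (auto simp: scale_errors_def)
    finally show "norm (next_\<Phi> \<Phi> a x\<^sub>1 - next_\<Phi> \<Phi> a x\<^sub>2 - next_\<Psi> \<Psi> a b x y (x\<^sub>1 - x\<^sub>2))
      \<le> \<kappa> * scale_errors (next_\<Phi> \<Phi> a) x\<^sub>1 x\<^sub>2 x y * norm (x\<^sub>1 - x\<^sub>2)" by (simp add: mult.assoc)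
  qed
  then show ?thesis using a b \<Phi>D by blast
qed

text \<open>The bound on the distance is transported along with the state: composing with the branches
  of one more step costs a factor \<open>2\<theta>\<close>, so the compositions themselves need not be recorded.\<close>

lemma renormalized_sequence:
  "\<exists>\<Phi> \<Psi>. renormalized \<Phi> \<Psi> \<and>
     (\<forall>x\<in>X. \<forall>y\<in>X'. \<exists>z\<in>X. \<exists>z'\<in>X'. norm (z - z') \<le> (2 * \<theta>) ^ n * norm (\<Phi> x - y))"
proof (induction n)
  case 0
  show ?case using renormalized_id by (metis mult_1 order_refl power_0)
next
  case (Suc n)
  then obtain \<Phi> \<Psi> where R: "renormalized \<Phi> \<Psi>"
    and close: "\<And>x y. x \<in> X \<Longrightarrow> y \<in> X' \<Longrightarrow> \<exists>z\<in>X. \<exists>z'\<in>X'. norm (z - z') \<le> (2 * \<theta>) ^ n * norm (\<Phi> x - y)"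
    by blast
  obtain a b where a: "a \<in> I" and b: "b \<in> I'" and R': "renormalized (next_\<Phi> \<Phi> a) (next_\<Psi> \<Psi> a b)"
    and D: "\<And>x. x \<in> X \<Longrightarrow> \<Phi> (f a x) \<in> D' b"
    using step[OF R] by blast
  have "\<exists>z\<in>X. \<exists>z'\<in>X'. norm (z - z') \<le> (2 * \<theta>) ^ Suc n * norm (next_\<Phi> \<Phi> a x - y)" if x: "x \<in> X" and y: "y \<in> X'" for x y
  proof -
    obtain z z' where z: "z \<in> X" "z' \<in> X'" "norm (z - z') \<le> (2 * \<theta>) ^ n * norm (\<Phi> (f a x) - f' b y)"
      using close A.branch[OF a x] A'.branch[OF b y] by blast
    have "norm (\<Phi> (f a x) - f' b y) \<le> 2 * \<theta> * norm (next_\<Phi> \<Phi> a x - y)"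
      using A'.expanding[OF b D[OF x], of "f' b y"] A'.branch[OF b y] by (simp add: next_\<Phi>_def)
    then have "(2 * \<theta>) ^ n * norm (\<Phi> (f a x) - f' b y) \<le> (2 * \<theta>) ^ n * (2 * \<theta> * norm (next_\<Phi> \<Phi> a x - y))"
      using A.\<theta> by (intro mult_left_mono) auto
    then have "norm (z - z') \<le> (2 * \<theta>) ^ Suc n * norm (next_\<Phi> \<Phi> a x - y)"
      using z(3) unfolding power_Suc2 mult.assoc by (rule order_trans[rotated])
    then show ?thesis using z(1,2) by blast
  qed
  then show ?case using R' by blast
qed

theorem intersect:
  assumes "compact X" "compact X'"
  shows "X \<inter> X' \<noteq> {}"
proof
  assume "X \<inter> X' = {}"
  then obtain d where d: "0 < d" "\<And>x y. x \<in> X \<Longrightarrow> y \<in> X' \<Longrightarrow> d \<le> dist x y"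
    using separate_compact_closed[OF assms(1) compact_imp_closed[OF assms(2)]] by blast
  have "2 * \<theta> < 1"
  proof (rule ccontr)
    assume "\<not> 2 * \<theta> < 1"
    then have "1 \<le> (2 * \<theta>) powr \<alpha>" using A.\<alpha> by (simp add: ge_one_powr_ge_zero)
    then show False using \<theta>_powr by simp
  qed
  then obtain n where n: "(2 * \<theta>) ^ n < d / 2"
    using real_arch_pow_inv[OF half_gt_zero[OF d(1)]] by blast
  obtain \<Phi> \<Psi> where R: "renormalized \<Phi> \<Psi>" and
    close: "\<And>x y. x \<in> X \<Longrightarrow> y \<in> X' \<Longrightarrow> \<exists>z\<in>X. \<exists>z'\<in>X'. norm (z - z') \<le> (2 * \<theta>) ^ n * norm (\<Phi> x - y)"
    using renormalized_sequence[of n] by blast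
  obtain x y where xy: "x \<in> X" "y \<in> X'" using X_nonempty X'_nonempty by auto
  have "norm (\<Phi> x) \<le> 3/8" "norm y \<le> 1"
    using R xy X'_small unfolding renormalized_def by auto
  then have "norm (\<Phi> x - y) \<le> 2" using norm_triangle_ineq4[of "\<Phi> x" y] by linarith
  then have "(2 * \<theta>) ^ n * norm (\<Phi> x - y) \<le> (2 * \<theta>) ^ n * 2"
    using A.\<theta> by (intro mult_left_mono) auto
  moreover obtain z z' where "z \<in> X" "z' \<in> X'" "norm (z - z') \<le> (2 * \<theta>) ^ n * norm (\<Phi> x - y)"
    using close xy by blast
  ultimately show False using d(2)[of z z'] n unfolding dist_norm by linarith
qed

end

section \<open>Perturbations of affine maps\<close>

definition derivative_blinfun :: "('a::real_normed_vector \<Rightarrow> 'b::real_normed_vector) \<Rightarrow> 'a \<Rightarrow> 'a \<Rightarrow>\<^sub>L 'b" where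
  "derivative_blinfun f x = Blinfun (Dat f x)"

lemma derivative_blinfun_apply:
  assumes "f differentiable (at x)"
  shows "blinfun_apply (derivative_blinfun f x) = Dat f x"
    and "(f has_derivative derivative_blinfun f x) (at x)"
proof -
  have d: "(f has_derivative Dat f x) (at x)" using assms frechet_derivative_works by blast
  then show e: "blinfun_apply (derivative_blinfun f x) = Dat f x"
    unfolding derivative_blinfun_def by (intro bounded_linear_Blinfun_apply has_derivative_bounded_linear)
  show "(f has_derivative derivative_blinfun f x) (at x)" unfolding e by (rule d)
qed

lemma derivative_blinfun_unique:
  assumes "(f has_derivative blinfun_apply A) (at x)"
  shows "derivative_blinfun f x = A"
  unfolding derivative_blinfun_def frechet_derivative_at[OF assms, symmetric] by (rule blinfun_apply_inverse)

lemma derivative_blinfun_compose: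
  assumes "\<phi> differentiable (at x)" "g differentiable (at (\<phi> x))"
  shows "derivative_blinfun (g \<circ> \<phi>) x = derivative_blinfun g (\<phi> x) o\<^sub>L derivative_blinfun \<phi> x"
proof (rule derivative_blinfun_unique)
  have "(g \<circ> \<phi> has_derivative derivative_blinfun g (\<phi> x) \<circ> derivative_blinfun \<phi> x) (at x)"
    by (rule diff_chain_at[OF derivative_blinfun_apply(2)[OF assms(1)] derivative_blinfun_apply(2)[OF assms(2)]])
  then show "(g \<circ> \<phi> has_derivative derivative_blinfun g (\<phi> x) o\<^sub>L derivative_blinfun \<phi> x) (at x)"
    by (simp add: o_def blinfun_compose.rep_eq)
qed

lemma C1_holder_nearD:
  assumes near: "C1_holder_near \<alpha> \<delta> U f\<^sub>1 f\<^sub>2"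
  shows "\<And>x. x \<in> U \<Longrightarrow> f\<^sub>1 differentiable (at x)" "\<And>x. x \<in> U \<Longrightarrow> f\<^sub>2 differentiable (at x)"
    "\<And>x. x \<in> U \<Longrightarrow> norm (f\<^sub>1 x - f\<^sub>2 x) \<le> \<delta>"
    "\<And>x. x \<in> U \<Longrightarrow> norm (derivative_blinfun f\<^sub>1 x - derivative_blinfun f\<^sub>2 x) \<le> \<delta>"
    "\<And>x y. x \<in> U \<Longrightarrow> y \<in> U \<Longrightarrow> norm ((derivative_blinfun f\<^sub>1 x - derivative_blinfun f\<^sub>2 x)
        - (derivative_blinfun f\<^sub>1 y - derivative_blinfun f\<^sub>2 y)) \<le> \<delta> * norm (x - y) powr \<alpha>"
proof -
  show d1: "f\<^sub>1 differentiable (at x)" and d2: "f\<^sub>2 differentiable (at x)" if "x \<in> U" for x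
    using near that unfolding C1_holder_near_def C1_holder_on_def by blast+
  obtain c where c: "c < \<delta>" "\<And>x. x \<in> U \<Longrightarrow> norm (f\<^sub>1 x - f\<^sub>2 x) \<le> c"
    "\<And>x. x \<in> U \<Longrightarrow> onorm (\<lambda>v. Dat f\<^sub>1 x v - Dat f\<^sub>2 x v) \<le> c"
    "\<And>x y. x \<in> U \<Longrightarrow> y \<in> U \<Longrightarrow>
       onorm (\<lambda>v. (Dat f\<^sub>1 x v - Dat f\<^sub>2 x v) - (Dat f\<^sub>1 y v - Dat f\<^sub>2 y v)) \<le> c * dist x y powr \<alpha>"
    using near unfolding C1_holder_near_def by blast
  show "norm (f\<^sub>1 x - f\<^sub>2 x) \<le> \<delta>" if "x \<in> U" for x using c(1) c(2)[OF that] by linarith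
  have e: "blinfun_apply (derivative_blinfun f\<^sub>1 x - derivative_blinfun f\<^sub>2 x) = (\<lambda>v. Dat f\<^sub>1 x v - Dat f\<^sub>2 x v)"
    if "x \<in> U" for x
    by (simp add: fun_eq_iff blinfun.diff_left derivative_blinfun_apply(1)[OF d1[OF that]] derivative_blinfun_apply(1)[OF d2[OF that]])
  show "norm (derivative_blinfun f\<^sub>1 x - derivative_blinfun f\<^sub>2 x) \<le> \<delta>" if "x \<in> U" for x
    unfolding norm_blinfun.rep_eq e[OF that] using c(1) c(3)[OF that] by linarith
  show "norm ((derivative_blinfun f\<^sub>1 x - derivative_blinfun f\<^sub>2 x)
        - (derivative_blinfun f\<^sub>1 y - derivative_blinfun f\<^sub>2 y)) \<le> \<delta> * norm (x - y) powr \<alpha>"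
    if x: "x \<in> U" and y: "y \<in> U" for x y
  proof -
    have "blinfun_apply ((derivative_blinfun f\<^sub>1 x - derivative_blinfun f\<^sub>2 x) - (derivative_blinfun f\<^sub>1 y - derivative_blinfun f\<^sub>2 y))
      = (\<lambda>v. (Dat f\<^sub>1 x v - Dat f\<^sub>2 x v) - (Dat f\<^sub>1 y v - Dat f\<^sub>2 y v))"
      using fun_cong[OF e[OF x]] fun_cong[OF e[OF y]] by (simp add: fun_eq_iff blinfun.diff_left)
    then have "norm ((derivative_blinfun f\<^sub>1 x - derivative_blinfun f\<^sub>2 x)
        - (derivative_blinfun f\<^sub>1 y - derivative_blinfun f\<^sub>2 y)) \<le> c * norm (x - y) powr \<alpha>"
      using c(4)[OF x y] by (simp add: norm_blinfun.rep_eq dist_norm)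
    also have "\<dots> \<le> \<delta> * norm (x - y) powr \<alpha>" using c(1) by (intro mult_right_mono) auto
    finally show ?thesis .
  qed
qed

lemma norm_diff_le:
  fixes x a b :: "'a::real_normed_vector"
  assumes "x = a - b" "norm a \<le> s" "norm b \<le> t"
  shows "norm x \<le> s + t"
  unfolding assms(1) using assms(2,3) norm_triangle_ineq4[of a b] by linarith

lemma norm_le_compose_near_id:
  fixes A :: "'a::euclidean_space \<Rightarrow>\<^sub>L 'b::real_normed_vector"
  assumes "norm (W - id_blinfun) \<le> 1/2"
  shows "norm A \<le> 2 * norm (A o\<^sub>L W)"
proof -
  have "A = (A o\<^sub>L W) - (A o\<^sub>L (W - id_blinfun))"
    by (rule blinfun_eqI) (simp add: blinfun.diff_left blinfun.diff_right)
  then have "norm A \<le> norm (A o\<^sub>L W) + norm (A o\<^sub>L (W - id_blinfun))"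
    using norm_triangle_ineq4 by metis
  moreover have "norm (A o\<^sub>L (W - id_blinfun)) \<le> norm A * (1/2)"
    by (intro norm_compose_le assms order_refl)
  ultimately show ?thesis by linarith
qed

lemma derivative_blinfun_affine:
  fixes T :: "'a::euclidean_space \<Rightarrow>\<^sub>L 'a"
  assumes "open S" "x \<in> S" "\<And>y. y \<in> S \<Longrightarrow> g y = T (y - p) /\<^sub>R \<theta>"
  shows "(g has_derivative blinfun_apply (T /\<^sub>R \<theta>)) (at x)"
proof -
  have "((\<lambda>y. T (y - p) /\<^sub>R \<theta>) has_derivative (\<lambda>v. T v /\<^sub>R \<theta>)) (at x)"
    by (auto intro!: derivative_eq_intros)
  then have "((\<lambda>y. T (y - p) /\<^sub>R \<theta>) has_derivative blinfun_apply (T /\<^sub>R \<theta>)) (at x)"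
    by (simp add: scaleR_blinfun.rep_eq)
  then show ?thesis
    using has_derivative_transform_within_open[OF _ assms(1,2)] assms(3) by fastforce
qed

text \<open>The domain \<open>D\<close> of \<open>g\<close> is only known as the image of a ball under a map \<open>\<phi>\<close> close to the identity, so all
  mean value arguments are made in the ball, for \<open>\<phi>\<close> and \<open>g \<circ> \<phi>\<close>, and the derivative of \<open>g\<close> is
  recovered from the chain rule.  That \<open>D\<close> contains a slightly smaller ball is Brouwer's theorem.\<close>

lemma close_to_affine:
  fixes g :: "'a::euclidean_space \<Rightarrow> 'a" and T :: "'a \<Rightarrow>\<^sub>L 'a"
  assumes \<alpha>: "0 < \<alpha>" "\<alpha> \<le> 1" and \<theta>: "0 < \<theta>" "\<theta> \<le> 1" and \<eta>: "0 < \<eta>" "\<eta> \<le> 1/8"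
    and T: "norm (T - id_blinfun) \<le> 1/8"
    and close: "C1_holder_close \<alpha> (\<theta> * \<eta> / 12) D g (ball p r) g\<^sub>0"
    and g0: "\<And>x. x \<in> ball p r \<Longrightarrow> g\<^sub>0 x = T (x - p) /\<^sub>R \<theta>"
    and diff: "\<And>x. x \<in> D \<Longrightarrow> g differentiable (at x)"
  defines "Z \<equiv> \<lambda>w. \<theta> *\<^sub>R derivative_blinfun g w"
  shows "\<And>u v w. u \<in> D \<Longrightarrow> v \<in> D \<Longrightarrow> w \<in> D \<Longrightarrow>
        norm (\<theta> *\<^sub>R (g u - g v) - Z w (u - v))
          \<le> \<eta> * (norm (u - w) powr \<alpha> + norm (v - w) powr \<alpha>) * norm (u - v)"
    and "\<And>u v. u \<in> D \<Longrightarrow> v \<in> D \<Longrightarrow> norm (Z u - Z v) \<le> \<eta> * norm (u - v) powr \<alpha>"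
    and "\<And>w. w \<in> D \<Longrightarrow> norm (Z w - T) \<le> \<eta>"
    and "\<And>w. w \<in> D \<Longrightarrow> norm (g w - T (w - p) /\<^sub>R \<theta>) \<le> \<eta>"
    and "D \<subseteq> ball p (r + \<theta> * \<eta> / 12)"
    and "\<And>s. 0 < s \<Longrightarrow> s + \<theta> * \<eta> / 12 < r \<Longrightarrow> cball p s \<subseteq> D"
proof -
  define c where "c = \<theta> * \<eta> / 12"
  let ?B = "ball p r"
  have "\<theta> * \<eta> \<le> 1 * \<eta>" using \<theta> \<eta> by (intro mult_right_mono) auto
  then have c: "0 < c" "c \<le> \<theta> * \<eta> / 12" "c \<le> \<eta> / 12" "c \<le> 1/96"
    using mult_pos_pos[OF \<theta>(1) \<eta>(1)] \<eta>(2) unfolding c_def by linarith+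
  obtain \<phi> where bij: "bij_betw \<phi> ?B D" and near1: "C1_holder_near \<alpha> c ?B \<phi> id"
    and near2: "C1_holder_near \<alpha> c ?B (g \<circ> \<phi>) g\<^sub>0"
    using close unfolding C1_holder_close_def C1_holder_diffeo_def c_def by blast
  note n1 = C1_holder_nearD[OF near1] and n2 = C1_holder_nearD[OF near2]
  define F where "F = derivative_blinfun \<phi>"
  define H where "H = (\<lambda>x. Z (\<phi> x) o\<^sub>L F x)"
  have \<phi>D: "\<phi> x \<in> D" if "x \<in> ?B" for x using bij that by (auto simp: bij_betw_def)
  have id': "derivative_blinfun id x = id_blinfun" for x :: 'a
    by (rule derivative_blinfun_unique) (simp add: id_def)
  have g0': "derivative_blinfun g\<^sub>0 x = T /\<^sub>R \<theta>" if "x \<in> ?B" for x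
    by (rule derivative_blinfun_unique[OF derivative_blinfun_affine[OF open_ball that g0]])
  have HD: "H x = \<theta> *\<^sub>R derivative_blinfun (g \<circ> \<phi>) x" if "x \<in> ?B" for x
    unfolding H_def Z_def F_def derivative_blinfun_compose[OF n1(1)[OF that] diff[OF \<phi>D[OF that]]]
    by (rule blinfun_eqI) (simp add: scaleR_blinfun.rep_eq)
  have F1: "norm (F x - id_blinfun) \<le> c" if "x \<in> ?B" for x
    using n1(4)[OF that] by (simp add: F_def id')
  have F2: "norm (F x - F y) \<le> c * norm (x - y) powr \<alpha>" if "x \<in> ?B" "y \<in> ?B" for x y
    using n1(5)[OF that] by (simp add: F_def id')
  have H1: "norm (H x - T) \<le> c" if x: "x \<in> ?B" for x
  proof -
    have "H x - T = \<theta> *\<^sub>R (derivative_blinfun (g \<circ> \<phi>) x - derivative_blinfun g\<^sub>0 x)"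
      using \<theta> by (simp add: HD[OF x] g0'[OF x] scaleR_diff_right)
    then have "norm (H x - T) = \<theta> * norm (derivative_blinfun (g \<circ> \<phi>) x - derivative_blinfun g\<^sub>0 x)"
      using \<theta> by simp
    also have "\<dots> \<le> 1 * c" using n2(4)[OF x] \<theta> by (intro mult_mono) auto
    finally show ?thesis by simp
  qed
  have H2: "norm (H x - H y) \<le> c * norm (x - y) powr \<alpha>" if x: "x \<in> ?B" and y: "y \<in> ?B" for x y
  proof -
    have "H x - H y = \<theta> *\<^sub>R ((derivative_blinfun (g \<circ> \<phi>) x - derivative_blinfun g\<^sub>0 x)
       - (derivative_blinfun (g \<circ> \<phi>) y - derivative_blinfun g\<^sub>0 y))"
      by (simp add: HD[OF x] HD[OF y] g0'[OF x] g0'[OF y] scaleR_diff_right)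
    then have "norm (H x - H y) = \<theta> * norm ((derivative_blinfun (g \<circ> \<phi>) x - derivative_blinfun g\<^sub>0 x)
       - (derivative_blinfun (g \<circ> \<phi>) y - derivative_blinfun g\<^sub>0 y))"
      using \<theta> by simp
    also have "\<dots> \<le> 1 * (c * norm (x - y) powr \<alpha>)" using n2(5)[OF x y] \<theta> by (intro mult_mono) auto
    finally show ?thesis by simp
  qed
  have F1': "norm (F x - id_blinfun) \<le> 1/2" if "x \<in> ?B" for x using F1[OF that] c by linarith
  have ZT: "norm (Z (\<phi> x) - T) \<le> 6 * c" if x: "x \<in> ?B" for x
  proof -
    have "norm ((Z (\<phi> x) - T) o\<^sub>L F x) \<le> c + (1 + 1/8) * c"
    proof (rule norm_diff_le)
      show "(Z (\<phi> x) - T) o\<^sub>L F x = (H x - T) - (T o\<^sub>L (F x - id_blinfun))"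
        unfolding H_def by (rule blinfun_eqI) (simp add: blinfun.diff_left blinfun.diff_right)
      show "norm (T o\<^sub>L (F x - id_blinfun)) \<le> (1 + 1/8) * c"
        by (intro norm_compose_le norm_near_id T F1 x)
    qed (rule H1[OF x])
    then show ?thesis
      using norm_le_compose_near_id[OF F1'[OF x], of "Z (\<phi> x) - T"] c(1) by argo
  qed
  have Z2: "norm (Z (\<phi> x)) \<le> 2" if x: "x \<in> ?B" for x
    using ZT[OF x] norm_near_id[OF T] norm_triangle_sub[of "Z (\<phi> x)" T] c by linarith
  have lip: "norm (x - y) \<le> 2 * norm (\<phi> x - \<phi> y)" if x: "x \<in> ?B" and y: "y \<in> ?B" for x y
  proof -
    have "norm ((\<phi> x - id_blinfun x) - (\<phi> y - id_blinfun y)) \<le> c * norm (x - y)"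
    proof (rule differentiable_bound[where f'="\<lambda>z. F z - id_blinfun", OF convex_ball _ _ x y])
      fix z assume z: "z \<in> ?B"
      have "((\<lambda>x. \<phi> x - id_blinfun x) has_derivative (\<lambda>v. F z v - id_blinfun v)) (at z within ?B)"
        unfolding F_def
        by (intro has_derivative_diff has_derivative_at_withinI[OF derivative_blinfun_apply(2)[OF n1(1)[OF z]]]
          bounded_linear_imp_has_derivative blinfun.bounded_linear_right)
      then show "((\<lambda>x. \<phi> x - id_blinfun x) has_derivative blinfun_apply (F z - id_blinfun)) (at z within ?B)"
        by (simp add: minus_blinfun.rep_eq)
      show "onorm (blinfun_apply (F z - id_blinfun)) \<le> c"
        using F1[OF z] by (simp add: norm_blinfun.rep_eq)
    qed
    moreover have "c * norm (x - y) \<le> 1/2 * norm (x - y)" using c by (intro mult_right_mono) auto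
    moreover have "x - y = (\<phi> x - \<phi> y) - ((\<phi> x - id_blinfun x) - (\<phi> y - id_blinfun y))" by simp
    then have "norm (x - y) \<le> norm (\<phi> x - \<phi> y) + norm ((\<phi> x - id_blinfun x) - (\<phi> y - id_blinfun y))"
      using norm_triangle_ineq4 by metis
    ultimately show ?thesis by linarith
  qed
  have lip_powr: "norm (x - y) powr \<alpha> \<le> 2 * norm (\<phi> x - \<phi> y) powr \<alpha>" if x: "x \<in> ?B" and y: "y \<in> ?B" for x y
  proof -
    have "norm (x - y) powr \<alpha> \<le> (2 * norm (\<phi> x - \<phi> y)) powr \<alpha>"
      using lip[OF x y] \<alpha> by (intro powr_mono2) auto
    also have "\<dots> = 2 powr \<alpha> * norm (\<phi> x - \<phi> y) powr \<alpha>" by (simp add: powr_mult)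
    also have "\<dots> \<le> 2 powr 1 * norm (\<phi> x - \<phi> y) powr \<alpha>"
      using \<alpha> by (intro mult_right_mono powr_mono) auto
    finally show ?thesis by simp
  qed
  have pre: "\<exists>x\<in>?B. u = \<phi> x" if "u \<in> D" for u using bij that by (auto simp: bij_betw_def)
  show "norm (\<theta> *\<^sub>R (g u - g v) - Z w (u - v))
          \<le> \<eta> * (norm (u - w) powr \<alpha> + norm (v - w) powr \<alpha>) * norm (u - v)"
    if "u \<in> D" "v \<in> D" "w \<in> D" for u v w
  proof -
    obtain s t x where s: "s \<in> ?B" "u = \<phi> s" and t: "t \<in> ?B" "v = \<phi> t" and x: "x \<in> ?B" "w = \<phi> x"
      using pre[OF \<open>u \<in> D\<close>] pre[OF \<open>v \<in> D\<close>] pre[OF \<open>w \<in> D\<close>] by blast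
    define S where "S = closed_segment s t"
    have SB: "S \<subseteq> ?B" unfolding S_def using s t by (intro closed_segment_subset convex_ball)
    let ?m = "norm (s - x) powr \<alpha> + norm (t - x) powr \<alpha>"
    have m: "norm (z - x) powr \<alpha> \<le> ?m" if z: "z \<in> S" for z
    proof -
      have "norm (z - x) \<le> max (norm (s - x)) (norm (t - x))"
        using segment_furthest_le[of z s t x] z unfolding S_def by (auto simp: norm_minus_commute)
      then have "norm (z - x) powr \<alpha> \<le> max (norm (s - x)) (norm (t - x)) powr \<alpha>"
        using \<alpha> by (intro powr_mono2) auto
      then show ?thesis by (auto simp: max_def split: if_splits intro: order_trans)
    qed
    \<comment> \<open>The derivative of \<open>?\<psi>\<close> vanishes at \<open>x\<close>, the preimage of the base point.\<close>
    let ?\<psi> = "\<lambda>z. \<theta> *\<^sub>R (g \<circ> \<phi>) z - Z w (\<phi> z)" and ?\<psi>' = "\<lambda>z. H z - (Z w o\<^sub>L F z)"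
    have "norm (?\<psi> s - ?\<psi> t) \<le> (3 * c * ?m) * norm (s - t)"
    proof (rule differentiable_bound[where f'="?\<psi>'" and S=S])
      show "convex S" "s \<in> S" "t \<in> S" unfolding S_def by auto
      fix z assume z: "z \<in> S"
      then have zB: "z \<in> ?B" using SB by auto
      have "(?\<psi> has_derivative (\<lambda>v. \<theta> *\<^sub>R derivative_blinfun (g \<circ> \<phi>) z v - Z w (F z v))) (at z within S)"
        unfolding F_def
        by (intro has_derivative_diff has_derivative_scaleR_right
            bounded_linear.has_derivative[OF blinfun.bounded_linear_right]
            has_derivative_at_withinI[OF derivative_blinfun_apply(2)] n1(1) n2(1) zB)
      then show "(?\<psi> has_derivative blinfun_apply (?\<psi>' z)) (at z within S)"
        by (simp add: minus_blinfun.rep_eq HD[OF zB] scaleR_blinfun.rep_eq)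
      have "norm (?\<psi>' z) \<le> c * norm (z - x) powr \<alpha> + 2 * (c * norm (z - x) powr \<alpha>)"
      proof (rule norm_diff_le)
        show "?\<psi>' z = (H z - H x) - (Z w o\<^sub>L (F z - F x))"
          unfolding H_def x(2) by (rule blinfun_eqI) (simp add: blinfun.diff_left blinfun.diff_right)
        show "norm (Z w o\<^sub>L (F z - F x)) \<le> 2 * (c * norm (z - x) powr \<alpha>)"
          unfolding x(2) by (intro norm_compose_le Z2 F2 x zB)
      qed (rule H2[OF zB x(1)])
      also have "\<dots> = 3 * c * norm (z - x) powr \<alpha>" by simp
      also have "\<dots> \<le> 3 * c * ?m" using m[OF z] c by (intro mult_left_mono) auto
      finally show "onorm (blinfun_apply (?\<psi>' z)) \<le> 3 * c * ?m" by (simp add: norm_blinfun.rep_eq)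
    qed
    also have "\<dots> \<le> (3 * c * (2 * norm (u - w) powr \<alpha> + 2 * norm (v - w) powr \<alpha>)) * (2 * norm (u - v))"
      unfolding s(2) t(2) x(2) using c
      by (intro mult_mono add_mono lip lip_powr s t x mult_nonneg_nonneg add_nonneg_nonneg) auto
    also have "\<dots> = 12 * c * ((norm (u - w) powr \<alpha> + norm (v - w) powr \<alpha>) * norm (u - v))"
      by (simp add: algebra_simps)
    also have "\<dots> \<le> \<eta> * ((norm (u - w) powr \<alpha> + norm (v - w) powr \<alpha>) * norm (u - v))"
      using c by (intro mult_right_mono mult_nonneg_nonneg add_nonneg_nonneg) auto
    finally show ?thesis
      unfolding s(2) t(2) by (simp add: blinfun.diff_right scaleR_diff_right algebra_simps)
  qed
  show "norm (Z u - Z v) \<le> \<eta> * norm (u - v) powr \<alpha>" if "u \<in> D" "v \<in> D" for u v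
  proof -
    obtain s t where s: "s \<in> ?B" "u = \<phi> s" and t: "t \<in> ?B" "v = \<phi> t"
      using pre[OF \<open>u \<in> D\<close>] pre[OF \<open>v \<in> D\<close>] by blast
    have "norm ((Z u - Z v) o\<^sub>L F s) \<le> c * norm (s - t) powr \<alpha> + 2 * (c * norm (s - t) powr \<alpha>)"
    proof (rule norm_diff_le)
      show "(Z u - Z v) o\<^sub>L F s = (H s - H t) - (Z v o\<^sub>L (F s - F t))"
        unfolding H_def s(2) t(2) by (rule blinfun_eqI) (simp add: blinfun.diff_left blinfun.diff_right)
      show "norm (Z v o\<^sub>L (F s - F t)) \<le> 2 * (c * norm (s - t) powr \<alpha>)"
        unfolding t(2) by (intro norm_compose_le Z2 F2 s t)
    qed (rule H2[OF s(1) t(1)])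
    then have "norm (Z u - Z v) \<le> 6 * c * norm (s - t) powr \<alpha>"
      using norm_le_compose_near_id[OF F1'[OF s(1)], of "Z u - Z v"] by argo
    also have "\<dots> \<le> 6 * c * (2 * norm (u - v) powr \<alpha>)"
      using lip_powr[OF s(1) t(1)] c unfolding s(2) t(2) by (intro mult_left_mono) auto
    also have "\<dots> = 12 * c * norm (u - v) powr \<alpha>" by simp
    also have "\<dots> \<le> \<eta> * norm (u - v) powr \<alpha>" using c by (intro mult_right_mono) auto
    finally show ?thesis .
  qed
  show "norm (Z w - T) \<le> \<eta>" if "w \<in> D" for w
    using pre[OF that] ZT c by fastforce
  show "norm (g w - T (w - p) /\<^sub>R \<theta>) \<le> \<eta>" if w: "w \<in> D" for w
  proof -
    obtain x where x: "x \<in> ?B" "w = \<phi> x" using pre[OF w] by blast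
    have 1: "norm (g w - T (x - p) /\<^sub>R \<theta>) \<le> c"
      using n2(3)[OF x(1)] g0[OF x(1)] x(2) by simp
    have "norm (T (x - w)) \<le> (1 + 1/8) * c"
      using n1(3)[OF x(1)] x(2) by (intro norm_apply_le norm_near_id T) (simp add: norm_minus_commute)
    also have "\<dots> \<le> 2 * c" using c by simp
    also have "\<dots> \<le> 2 * (\<theta> * \<eta> / 12)" using c(2) by linarith
    finally have "norm (T (x - w) /\<^sub>R \<theta>) \<le> \<eta> / 6"
      unfolding norm_scaleR using \<theta> by (simp add: field_simps)
    moreover have eq: "g w - T (w - p) /\<^sub>R \<theta> = (g w - T (x - p) /\<^sub>R \<theta>) + T (x - w) /\<^sub>R \<theta>"
      by (simp add: blinfun.diff_right scaleR_diff_right)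
    ultimately show ?thesis
      unfolding eq
      using 1 c \<eta> norm_triangle_ineq[of "g w - T (x - p) /\<^sub>R \<theta>" "T (x - w) /\<^sub>R \<theta>"] by linarith
  qed
  have "w \<in> ball p (r + c)" if w: "w \<in> D" for w
  proof -
    obtain x where x: "x \<in> ?B" "w = \<phi> x" using pre[OF w] by blast
    have "dist p w \<le> dist p x + dist x w" by (rule dist_triangle)
    also have "dist x w \<le> c" using n1(3)[OF x(1)] by (simp add: x(2) dist_norm norm_minus_commute)
    finally show ?thesis using x(1) by simp
  qed
  then show "D \<subseteq> ball p (r + \<theta> * \<eta> / 12)" unfolding c_def by blast
  show "cball p s \<subseteq> D" if s: "0 < s" and sr: "s + \<theta> * \<eta> / 12 < r" for s
  proof
    fix y assume y: "y \<in> cball p s"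
    have sub: "cball p (s + c) \<subseteq> ?B" using sr unfolding c_def by auto
    have "\<exists>x\<in>cball p (s + c). \<phi> x = y"
    proof (rule brouwer_surjective_cball[where S="{y}"])
      show "continuous_on (cball p (s + c)) \<phi>"
        using n1(1) sub by (auto intro!: continuous_at_imp_continuous_on differentiable_imp_continuous_within)
      show "0 < s + c" using s c by simp
      fix z x assume z: "z \<in> {y}" and x: "x \<in> cball p (s + c)"
      then have "norm (\<phi> x - x) \<le> c" using n1(3)[of x] sub by auto
      moreover have "dist p (y + (x - \<phi> x)) \<le> dist p y + dist y (y + (x - \<phi> x))" by (rule dist_triangle)
      ultimately show "z + (x - \<phi> x) \<in> cball p (s + c)"
        using z y by (simp add: dist_norm norm_minus_commute)
    qed simp
    then show "y \<in> D" using \<phi>D sub by blast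
  qed
qed

section \<open>Cantor sets in general\<close>

lemma mem_cantor_set:
  "x \<in> cantor_set K \<longleftrightarrow> (\<forall>n. (expander K ^^ n) x \<in> (\<Union>a \<in> alphabet K. piece K a))"
  by (auto simp: cantor_set_def)

lemma cantor_set_piece:
  assumes "x \<in> cantor_set K"
  obtains a where "a \<in> alphabet K" "x \<in> piece K a"
  using assms[unfolded mem_cantor_set, rule_format, of 0] by auto

lemma cantor_set_expander:
  assumes "x \<in> cantor_set K" shows "expander K x \<in> cantor_set K"
  unfolding mem_cantor_set
proof
  fix n show "(expander K ^^ n) (expander K x) \<in> (\<Union>a \<in> alphabet K. piece K a)"
    using assms[unfolded mem_cantor_set, rule_format, of "Suc n"] by (simp add: funpow_swap1)
qed

lemma cantor_set_branch:
  assumes full: "\<And>a b. a \<in> alphabet K \<Longrightarrow> b \<in> alphabet K \<Longrightarrow> piece K b \<subseteq> expander K ` piece K a"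
    and x: "x \<in> cantor_set K" and a: "a \<in> alphabet K"
  shows "\<exists>y \<in> cantor_set K. y \<in> piece K a \<and> expander K y = x"
proof -
  obtain b where b: "b \<in> alphabet K" "x \<in> piece K b" using cantor_set_piece[OF x] .
  then obtain y where y: "y \<in> piece K a" "expander K y = x" using full[OF a] by blast
  have "(expander K ^^ n) y \<in> (\<Union>a \<in> alphabet K. piece K a)" for n
  proof (cases n)
    case 0 then show ?thesis using y a by auto
  next
    case (Suc k)
    then show ?thesis using x[unfolded mem_cantor_set, rule_format, of k] y(2) by (simp add: funpow_swap1)
  qed
  then show ?thesis using y by (auto simp: mem_cantor_set)
qed

text \<open>The map \<open>g\<close> is known to be continuous only near the pieces, so closedness is shown for the finite stages of the
  intersection, each of which is a relative preimage of the previous one.\<close>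

lemma compact_cantor_set:
  assumes "regular_cantor \<alpha> K"
  shows "compact (cantor_set K)"
proof -
  let ?g = "expander K" and ?S = "\<Union>a \<in> alphabet K. piece K a"
  have mp: "markov_pieces \<alpha> K (piece K)" and fin: "finite (alphabet K)" and C1: "C1_holder_on \<alpha> (nbhd K) ?g"
    using assms unfolding regular_cantor_def by auto
  have S: "compact ?S" using mp fin by (auto simp: markov_pieces_def intro!: compact_UN)
  have "?S \<subseteq> nbhd K" using mp by (auto simp: markov_pieces_def)
  then have cont: "continuous_on ?S ?g"
    using C1 unfolding C1_holder_on_def
    by (intro continuous_at_imp_continuous_on ballI differentiable_imp_continuous_within) auto
  define C where "C = rec_nat ?S (\<lambda>_ Q. {x \<in> ?S. ?g x \<in> Q})"
  have C: "C 0 = ?S" "C (Suc n) = {x \<in> ?S. ?g x \<in> C n}" for n by (simp_all add: C_def)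
  have "closed (C n)" for n
  proof (induction n)
    case 0 then show ?case using S compact_imp_closed by (simp add: C)
  next
    case (Suc n)
    have "closed (?S \<inter> ?g -` C n)"
      by (intro continuous_closed_preimage cont compact_imp_closed S Suc)
    moreover have "?S \<inter> ?g -` C n = C (Suc n)" unfolding C by auto
    ultimately show ?case by simp
  qed
  then have "closed (\<Inter>n. C n)" by auto
  moreover have CM: "x \<in> C n \<longleftrightarrow> (\<forall>k\<le>n. (?g ^^ k) x \<in> ?S)" for x n
  proof (induction n arbitrary: x)
    case 0 then show ?case by (simp add: C)
  next
    case (Suc n)
    have "(\<forall>k\<le>Suc n. (?g ^^ k) x \<in> ?S) \<longleftrightarrow> x \<in> ?S \<and> (\<forall>k\<le>n. (?g ^^ Suc k) x \<in> ?S)"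
      by (metis funpow_0 le0 not0_implies_Suc Suc_le_mono)
    then show ?case unfolding C by (simp add: Suc funpow_swap1)
  qed
  have "cantor_set K = (\<Inter>n. C n)"
  proof (rule set_eqI)
    show "x \<in> cantor_set K \<longleftrightarrow> x \<in> (\<Inter>n. C n)" for x
      unfolding mem_cantor_set INT_iff CM by blast
  qed
  ultimately have "closed (cantor_set K)" by simp
  moreover have "cantor_set K \<subseteq> ?S" by (auto elim: cantor_set_piece)
  ultimately show ?thesis using S compact_Int_closed[of ?S "cantor_set K"] by (simp add: Int_absorb1)
qed

lemma funpow_left_shift: "(left_shift ^^ n) w i = w (i + n)"
  by (induction n arbitrary: w i) (simp_all add: left_shift_def)

text \<open>A basic open set restricts finitely many coordinates; beyond them a sequence can be continued
  by an arbitrary one.\<close>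

lemma full_shift_mixing:
  "topologically_mixing
     (subtopology (product_topology (\<lambda>_. discrete_topology A) UNIV) (subshift A (A \<times> A))) left_shift"
  unfolding topologically_mixing_def
proof (intro allI impI, elim conjE)
  let ?P = "product_topology (\<lambda>_::nat. discrete_topology A) UNIV"
  fix U W assume U: "openin (subtopology ?P (subshift A (A \<times> A))) U"
    and W: "openin (subtopology ?P (subshift A (A \<times> A))) W" and ne: "U \<noteq> {}" "W \<noteq> {}"
  obtain u w where u: "u \<in> U" and w: "w \<in> W" using ne by auto
  obtain V where V: "openin ?P V" "U = V \<inter> subshift A (A \<times> A)"
    using U by (auto simp: openin_subtopology)
  have w_in: "w i \<in> A" for i using W w by (auto simp: openin_subtopology subshift_def)
  have u_in: "u i \<in> A" for i using V u by (auto simp: subshift_def)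
  obtain Q where fin: "finite {i. Q i \<noteq> A}" and uQ: "u \<in> Pi\<^sub>E UNIV Q" and QV: "Pi\<^sub>E UNIV Q \<subseteq> V"
    using V u unfolding openin_product_topology_alt by (auto simp: topspace_discrete_topology)
  obtain N where N: "\<And>i. Q i \<noteq> A \<Longrightarrow> i < N"
    using fin by (auto simp: finite_nat_set_iff_bounded)
  show "\<exists>N. \<forall>n\<ge>N. (left_shift ^^ n) ` U \<inter> W \<noteq> {}"
  proof (intro exI allI impI)
    fix n assume n: "N \<le> n"
    define v where "v = (\<lambda>i. if i < n then u i else w (i - n))"
    have vA: "v i \<in> A" for i by (simp add: v_def u_in w_in)
    have "v i \<in> Q i" for i
    proof (cases "Q i = A")
      case True then show ?thesis using vA by simp
    next
      case False
      then have "v i = u i" using N n by (force simp: v_def)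
      then show ?thesis using uQ by auto
    qed
    then have "v \<in> U" using QV vA V(2) by (auto simp: subshift_def)
    moreover have "(left_shift ^^ n) v = w" by (simp add: fun_eq_iff funpow_left_shift v_def)
    ultimately show "(left_shift ^^ n) ` U \<inter> W \<noteq> {}" using w by blast
  qed
qed

lemma complex_linear_GL:
  fixes A :: "(complex ^ 'a) \<Rightarrow>\<^sub>L (complex ^ 'a::finite)"
  assumes A: "complex_linear A" and R: "A o\<^sub>L R = id_blinfun" "R o\<^sub>L A = id_blinfun"
  shows "blinfun_apply A \<in> GL_complex"
proof -
  have ap: "matrix (blinfun_apply B) *v x = B x" if "complex_linear B"
    for B :: "(complex ^ 'a) \<Rightarrow>\<^sub>L (complex ^ 'a)" and x
  proof (rule matrix_works)
    show "Vector_Spaces.linear (*s) (*s) (blinfun_apply B)"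
      by (intro Vector_Spaces.linear_iff[THEN iffD2])
        (use that in \<open>auto simp: complex_linear_def blinfun.add_right vec.vector_space_axioms\<close>)
  qed
  have AR: "A (R x) = x" and RA: "R (A x) = x" for x
    using R by (metis blinfun_apply_blinfun_compose blinfun_apply_id_blinfun)+
  note R' = complex_linear_inverse[OF A R]
  have "invertible (matrix (blinfun_apply A))"
    unfolding invertible_def
    by (intro exI[of _ "matrix (blinfun_apply R)"])
      (simp add: matrix_eq matrix_vector_mul_assoc[symmetric] ap A R' AR RA)
  then show ?thesis
    unfolding GL_complex_def using ap[OF A] by (auto simp: fun_eq_iff)
qed

lemma GL_complex_linear:
  assumes "blinfun_apply A \<in> GL_complex" shows "complex_linear A"
  using assms by (auto simp: GL_complex_def complex_linear_def vector_scalar_commute)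

lemma complex_linear_scaleR:
  "complex_linear A \<Longrightarrow> complex_linear (r *\<^sub>R A)"
  by (auto simp: complex_linear_def scaleR_blinfun.rep_eq vec_eq_iff)

lemma C1_holder_on_locally_affine:
  assumes "open U"
    and "\<And>x. x \<in> U \<Longrightarrow> \<exists>e>0. \<exists>A. \<forall>y \<in> U \<inter> ball x e. (f has_derivative A) (at y)"
  shows "C1_holder_on \<alpha> U f"
  unfolding C1_holder_on_def
proof (intro conjI ballI assms)
  fix x assume x: "x \<in> U"
  obtain e A where e: "e > 0" and A: "\<And>y. y \<in> U \<inter> ball x e \<Longrightarrow> (f has_derivative A) (at y)"
    using assms(2)[OF x] by blast
  show "f differentiable (at x)" using A[of x] x e by (auto simp: differentiable_def)
  have D: "Dat f y = A" if "y \<in> U \<inter> ball x e" for y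
    using frechet_derivative_at[OF A[OF that]] by simp
  show "\<exists>e>0. \<exists>C. \<forall>y \<in> U \<inter> ball x e. \<forall>z \<in> U \<inter> ball x e.
        onorm (\<lambda>v. Dat f y v - Dat f z v) \<le> C * dist y z powr \<alpha>"
    by (intro exI[of _ e] conjI e exI[of _ 0] ballI) (simp add: D onorm_zero)
qed

lemma conorm_ge:
  fixes A :: "'a::euclidean_space \<Rightarrow> 'b::real_normed_vector"
  assumes "\<And>v. norm v = 1 \<Longrightarrow> c \<le> norm (A v)"
  shows "c \<le> conorm A"
  unfolding conorm_def
proof (rule cINF_greatest)
  obtain v :: 'a where "norm v = 1" using vector_choose_size[of 1] by auto
  then show "{v::'a. norm v = 1} \<noteq> {}" by auto
qed (use assms in auto)

section \<open>Affine Cantor sets with round pieces\<close>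

text \<open>On the piece \<open>a\<close> the map sends \<open>p a + \<theta> T\<^sub>a\<^sup>-\<^sup>1 v\<close> to \<open>v\<close>.  The whole set has size \<open>\<sigma>\<close> and its pieces have size
  \<open>\<sigma>\<theta>\<close>.  The rate \<open>2\<theta>\<close> leaves room for the deviation of \<open>T\<^sub>a\<close> from an isometry.\<close>

definition ball_cantor :: "real \<Rightarrow> real \<Rightarrow> nat \<Rightarrow> (nat \<Rightarrow> complex ^ 'n) \<Rightarrow>
    (nat \<Rightarrow> (complex ^ 'n) \<Rightarrow>\<^sub>L (complex ^ 'n::finite)) \<Rightarrow> (nat, 'n) cantor_data" where
  "ball_cantor \<theta> \<sigma> m p T =
     \<lparr>alphabet = {..<m}, admissible = {..<m} \<times> {..<m},
      piece = (\<lambda>a. cball (p a) (\<sigma> * \<theta>)), nbhd = (\<Union>a<m. ball (p a) (3/2 * (\<sigma> * \<theta>))),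
      expander = (\<lambda>x. let a = (SOME a. a < m \<and> x \<in> ball (p a) (3/2 * (\<sigma> * \<theta>))) in T a (x - p a) /\<^sub>R \<theta>),
      rate = 2 * \<theta>, radius = \<sigma> * \<theta> / 4\<rparr>"

lemma ball_cantor_simps [simp]:
  "alphabet (ball_cantor \<theta> \<sigma> m p T) = {..<m}"
  "admissible (ball_cantor \<theta> \<sigma> m p T) = {..<m} \<times> {..<m}"
  "piece (ball_cantor \<theta> \<sigma> m p T) a = cball (p a) (\<sigma> * \<theta>)"
  "nbhd (ball_cantor \<theta> \<sigma> m p T) = (\<Union>a<m. ball (p a) (3/2 * (\<sigma> * \<theta>)))"
  "rate (ball_cantor \<theta> \<sigma> m p T) = 2 * \<theta>"
  "radius (ball_cantor \<theta> \<sigma> m p T) = \<sigma> * \<theta> / 4"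
  by (simp_all add: ball_cantor_def)

locale round_cantor =
  fixes \<alpha> \<theta> \<sigma> :: real and m :: nat and p :: "nat \<Rightarrow> complex ^ 'n::finite"
    and T :: "nat \<Rightarrow> (complex ^ 'n) \<Rightarrow>\<^sub>L (complex ^ 'n)"
  assumes \<alpha>: "0 < \<alpha>" "\<alpha> < 1" and \<theta>: "0 < \<theta>" "\<theta> \<le> 1/16" and \<theta>_powr: "(2 * \<theta>) powr \<alpha> \<le> 1/8"
    and \<sigma>: "0 < \<sigma>" "\<sigma> \<le> 1" and m: "2 \<le> m"
    and p_small: "\<And>a. a < m \<Longrightarrow> norm (p a) \<le> \<sigma> / 2"
    and p_separated: "\<And>a b. a < m \<Longrightarrow> b < m \<Longrightarrow> a \<noteq> b \<Longrightarrow> 4 * (\<sigma> * \<theta>) \<le> dist (p a) (p b)"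
    and T_near_id: "\<And>a. a < m \<Longrightarrow> norm (T a - id_blinfun) \<le> 1/8"
    and T_complex: "\<And>a. a < m \<Longrightarrow> complex_linear (T a)"
begin

abbreviation K where "K \<equiv> ball_cantor \<theta> \<sigma> m p T"
abbreviation g where "g \<equiv> expander K"

lemma \<sigma>\<theta>: "0 < \<sigma> * \<theta>" "\<sigma> * \<theta> \<le> \<sigma> / 16" "\<sigma> * \<theta> \<le> \<theta>"
  using \<sigma> \<theta> mult_left_mono[of \<theta> "1/16" \<sigma>] mult_right_mono[of \<sigma> 1 \<theta>] by auto

lemma far_apart:
  assumes "a < m" "b < m" "dist (p a) x \<le> 3/2 * (\<sigma> * \<theta>)" "dist (p b) x \<le> 3/2 * (\<sigma> * \<theta>)"
  shows "a = b"
proof (rule ccontr)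
  assume "a \<noteq> b"
  then have "4 * (\<sigma> * \<theta>) \<le> dist (p a) (p b)" using p_separated assms by simp
  also have "\<dots> \<le> dist (p a) x + dist (p b) x" by (rule dist_triangle2)
  finally show False using assms \<sigma>\<theta> by linarith
qed

lemma g_eq:
  assumes "a < m" "x \<in> ball (p a) (3/2 * (\<sigma> * \<theta>))"
  shows "g x = T a (x - p a) /\<^sub>R \<theta>"
proof -
  have "(SOME a. a < m \<and> x \<in> ball (p a) (3/2 * (\<sigma> * \<theta>))) = a"
  proof (rule some_equality)
    show "a < m \<and> x \<in> ball (p a) (3/2 * (\<sigma> * \<theta>))" using assms by simp
    show "b = a" if "b < m \<and> x \<in> ball (p b) (3/2 * (\<sigma> * \<theta>))" for b
      using that assms by (intro far_apart[of b a x]) auto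
  qed
  then show ?thesis by (simp add: ball_cantor_def)
qed

lemma g_eq_cball:
  assumes "a < m" "x \<in> cball (p a) s" "s \<le> 5/4 * (\<sigma> * \<theta>)"
  shows "g x = T a (x - p a) /\<^sub>R \<theta>"
  using assms \<sigma>\<theta> by (intro g_eq) auto

lemma g_derivative:
  assumes "a < m" "x \<in> ball (p a) (3/2 * (\<sigma> * \<theta>))"
  shows "(g has_derivative blinfun_apply (T a /\<^sub>R \<theta>)) (at x)" "Dat g x = blinfun_apply (T a /\<^sub>R \<theta>)"
proof -
  show *: "(g has_derivative blinfun_apply (T a /\<^sub>R \<theta>)) (at x)"
    by (rule derivative_blinfun_affine[OF open_ball assms(2) g_eq[OF assms(1)]])
  show "Dat g x = blinfun_apply (T a /\<^sub>R \<theta>)" using frechet_derivative_at[OF *] by simp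
qed

lemma cantor_set_derivative:
  assumes "x \<in> cantor_set K"
  obtains a where "a < m" "Dat g x = blinfun_apply (T a /\<^sub>R \<theta>)"
proof -
  obtain a where a: "a < m" "x \<in> cball (p a) (\<sigma> * \<theta>)" using cantor_set_piece[OF assms] by auto
  then have "x \<in> ball (p a) (3/2 * (\<sigma> * \<theta>))" using \<sigma>\<theta> by auto
  then show ?thesis using that g_derivative a by blast
qed

lemma C1_holder_g: "C1_holder_on \<alpha> (nbhd K) g"
proof (rule C1_holder_on_locally_affine)
  show "open (nbhd K)" by auto
  fix x assume "x \<in> nbhd K"
  then obtain a where a: "a < m" "x \<in> ball (p a) (3/2 * (\<sigma> * \<theta>))" by auto
  then obtain e where "e > 0" "ball x e \<subseteq> ball (p a) (3/2 * (\<sigma> * \<theta>))"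
    using open_contains_ball open_ball by blast
  then show "\<exists>e>0. \<exists>A. \<forall>y \<in> nbhd K \<inter> ball x e. (g has_derivative A) (at y)"
    using g_derivative(1)[OF a(1)] by blast
qed

lemma T_lower: "a < m \<Longrightarrow> 7/8 * norm x \<le> norm (T a x)"
  using near_id_lower[OF T_near_id, of a x] by simp

lemma conorm_T: "a < m \<Longrightarrow> 7/8 / \<theta> \<le> conorm (blinfun_apply (T a /\<^sub>R \<theta>))"
proof (rule conorm_ge)
  fix v :: "complex ^ 'n" assume a: "a < m" and v: "norm v = 1"
  show "7/8 / \<theta> \<le> norm ((T a /\<^sub>R \<theta>) v)"
    using T_lower[OF a, of v] v \<theta> unfolding scaleR_blinfun.rep_eq norm_scaleR by (simp add: field_simps)
qed

lemma onorm_T: "a < m \<Longrightarrow> onorm (blinfun_apply (T a /\<^sub>R \<theta>)) \<le> 9/8 / \<theta>"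
  using norm_near_id[OF T_near_id, of a] \<theta>
  by (simp add: norm_blinfun.rep_eq[symmetric] field_simps)

lemma T_inverse:
  assumes "a < m"
  shows "T a (blinfun_inv (T a) x) = x" "blinfun_inv (T a) (T a x) = x"
    "norm (blinfun_inv (T a) x) \<le> 8/7 * norm x"
proof -
  have h: "norm (T a - id_blinfun) \<le> 1/2" using T_near_id[OF assms] by simp
  show "T a (blinfun_inv (T a) x) = x" "blinfun_inv (T a) (T a x) = x" by (rule blinfun_inv[OF h])+
  then show "norm (blinfun_inv (T a) x) \<le> 8/7 * norm x"
    using T_lower[OF assms, of "blinfun_inv (T a) x"] by simp
qed

lemma image_g:
  assumes a: "a < m" and s: "s \<le> 5/4 * (\<sigma> * \<theta>)" and y: "norm y \<le> 7/8 * (s / \<theta>)"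
  shows "y \<in> g ` cball (p a) s"
proof
  let ?x = "p a + \<theta> *\<^sub>R blinfun_inv (T a) y"
  have "\<theta> * norm (blinfun_inv (T a) y) \<le> \<theta> * (8/7 * (7/8 * (s / \<theta>)))"
    using T_inverse(3)[OF a, of y] y \<theta> by (intro mult_left_mono) auto
  then show x: "?x \<in> cball (p a) s" using \<theta> by (simp add: dist_norm)
  show "y = g ?x"
    unfolding g_eq_cball[OF a x s] using \<theta> by (simp add: blinfun.scaleR_right T_inverse[OF a])
qed

lemma diffeo_affine:
  assumes a: "a < m"
  shows "C1_holder_diffeo \<alpha> UNIV UNIV (\<lambda>x. T a (x - p a) /\<^sub>R \<theta>)"
proof -
  let ?h = "\<lambda>x. T a (x - p a) /\<^sub>R \<theta>" and ?k = "\<lambda>y. p a + \<theta> *\<^sub>R blinfun_inv (T a) y"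
  have hk: "?h (?k y) = y" "?k (?h x) = x" for x y
    using \<theta> by (simp_all add: blinfun.scaleR_right T_inverse[OF a])
  have inj: "inj ?h" by (rule inj_on_inverseI[of _ ?k]) (rule hk)
  have inv: "inv_into UNIV ?h = ?k"
  proof
    fix y show "inv_into UNIV ?h y = ?k y" using inv_f_f[OF inj, of "?k y"] hk(1)[of y] by simp
  qed
  have 1: "C1_holder_on \<alpha> UNIV ?h"
    by (rule C1_holder_on_locally_affine)
      (auto intro!: exI[of _ 1] exI[of _ "blinfun_apply (T a /\<^sub>R \<theta>)"] derivative_blinfun_affine[OF open_UNIV])
  have "(?k has_derivative (\<lambda>v. \<theta> *\<^sub>R blinfun_inv (T a) v)) (at y)" for y
    by (auto intro!: derivative_eq_intros)
  then have 2: "C1_holder_on \<alpha> UNIV ?k"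
    by (intro C1_holder_on_locally_affine open_UNIV exI[of _ "1::real"] conjI zero_less_one
        exI[of _ "\<lambda>v. \<theta> *\<^sub>R blinfun_inv (T a) v"] ballI)
  have "bij ?h" unfolding bij_def using inj surjI[of ?h ?k, OF hk(1)] by blast
  then show ?thesis unfolding C1_holder_diffeo_def inv using 1 2 by simp
qed

text \<open>The range of radii covers both the pieces \<open>G(a)\<close> and the closures of \<open>G\<^sup>*(a)\<close>.\<close>

lemma markov_balls:
  assumes s: "\<sigma> * \<theta> \<le> s" "s \<le> 5/4 * (\<sigma> * \<theta>)"
  shows "markov_pieces \<alpha> K (\<lambda>a. cball (p a) s)"
  unfolding markov_pieces_def
proof (intro conjI ballI)
  fix a assume a: "a \<in> alphabet K"
  then have am: "a < m" by simp
  show "compact (cball (p a) s)" "connected (cball (p a) s)" by (auto intro: convex_connected)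
  show "cball (p a) s \<noteq> {}" using s \<sigma>\<theta> by auto
  show "cball (p a) s \<subseteq> nbhd K" using am s \<sigma>\<theta> by (auto intro!: bexI[of _ a])
  show "\<exists>U W h. cball (p a) s \<subseteq> U \<and> C1_holder_diffeo \<alpha> U W h \<and> (\<forall>x \<in> cball (p a) s. h x = g x)"
    using diffeo_affine[OF am] g_eq_cball[OF am _ s(2)]
    by (intro exI[of _ UNIV] exI[of _ "\<lambda>x. T a (x - p a) /\<^sub>R \<theta>"]) auto
  fix b assume b: "b \<in> alphabet K"
  have "cball (p b) s \<subseteq> g ` cball (p a) s"
  proof
    fix y assume "y \<in> cball (p b) s"
    then have "norm y \<le> norm (p b) + s"
      using norm_triangle_sub[of y "p b"] by (simp add: dist_norm norm_minus_commute)
    also have "\<dots> \<le> 7/8 * \<sigma>" using p_small[OF b[simplified]] s \<sigma>\<theta> \<sigma> by linarith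
    also have "\<sigma> \<le> s / \<theta>" using s \<theta> by (simp add: field_simps)
    finally show "y \<in> g ` cball (p a) s" using image_g[OF am s(2)] by simp
  qed
  then show "if (a, b) \<in> admissible K then cball (p b) s \<subseteq> g ` cball (p a) s
        else cball (p b) s \<inter> g ` cball (p a) s = {}"
    using am b by simp
next
  show "disjoint_family_on (\<lambda>a. cball (p a) s) (alphabet K)"
    unfolding disjoint_family_on_def
  proof (intro ballI impI)
    fix a b assume ab: "a \<in> alphabet K" "b \<in> alphabet K" "a \<noteq> b"
    have False if "x \<in> cball (p a) s" "x \<in> cball (p b) s" for x
      using far_apart[of a b x] ab that s \<sigma>\<theta> by auto
    then show "cball (p a) s \<inter> cball (p b) s = {}" by blast
  qed
qed

lemma star_piece_eq: "star_piece K a = ball (p a) (5/4 * (\<sigma> * \<theta>))"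
proof
  show "star_piece K a \<subseteq> ball (p a) (5/4 * (\<sigma> * \<theta>))"
  proof
    fix y assume "y \<in> star_piece K a"
    then obtain x where "dist (p a) x \<le> \<sigma> * \<theta>" "dist x y < \<sigma> * \<theta> / 4" by (auto simp: star_piece_def)
    then show "y \<in> ball (p a) (5/4 * (\<sigma> * \<theta>))" using dist_triangle[of "p a" y x] by simp
  qed
  show "ball (p a) (5/4 * (\<sigma> * \<theta>)) \<subseteq> star_piece K a"
  proof
    fix y assume y: "y \<in> ball (p a) (5/4 * (\<sigma> * \<theta>))"
    \<comment> \<open>The factor is the quotient of the radii of the piece and of its neighbourhood.\<close>
    let ?x = "p a + (4/5) *\<^sub>R (y - p a)"
    have "p a - ?x = - ((4/5) *\<^sub>R (y - p a))" by simp
    then have 1: "dist (p a) ?x = 4/5 * dist (p a) y"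
      unfolding dist_norm by (simp add: norm_minus_commute)
    have "?x - y = - ((1/5) *\<^sub>R (y - p a))"
      by (simp add: algebra_simps flip: scaleR_add_left)
    then have 2: "dist ?x y = 1/5 * dist (p a) y"
      unfolding dist_norm by (simp add: norm_minus_commute)
    show "y \<in> star_piece K a"
      unfolding star_piece_def using y 1 2 by (auto intro!: bexI[of _ ?x])
  qed
qed

lemma g_expanding:
  assumes "a < m" "x \<in> cball (p a) (\<sigma> * \<theta>)" "y \<in> cball (p a) (\<sigma> * \<theta>)"
  shows "dist x y \<le> 2 * \<theta> * dist (g x) (g y)"
proof -
  have "T a (x - y) = \<theta> *\<^sub>R (g x - g y)"
    using g_eq_cball[OF assms(1,2)] g_eq_cball[OF assms(1,3)] \<sigma>\<theta> \<theta>
    by (simp add: blinfun.diff_right scaleR_diff_right)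
  then have "norm (T a (x - y)) = \<theta> * norm (g x - g y)" using \<theta> by simp
  then have "7/8 * norm (x - y) \<le> \<theta> * norm (g x - g y)" using T_lower[OF assms(1), of "x - y"] by simp
  then show ?thesis unfolding dist_norm using norm_ge_zero[of "x - y"] by argo
qed

lemma full: "a \<in> alphabet K \<Longrightarrow> b \<in> alphabet K \<Longrightarrow> piece K b \<subseteq> g ` piece K a"
  using markov_balls[of "\<sigma> * \<theta>"] \<sigma>\<theta> unfolding markov_pieces_def by auto

lemma cantor_set_small:
  assumes "x \<in> cantor_set K" shows "norm x \<le> \<sigma>"
proof -
  obtain a where "a < m" "x \<in> cball (p a) (\<sigma> * \<theta>)" using cantor_set_piece[OF assms] by auto
  then have "norm (p a) \<le> \<sigma> / 2" "norm (x - p a) \<le> \<sigma> * \<theta>"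
    using p_small[of a] by (simp_all add: dist_norm norm_minus_commute)
  then show ?thesis using \<sigma>\<theta> \<sigma> norm_triangle_sub[of x "p a"] by linarith
qed

text \<open>The fixed point of the branch \<open>0\<close> solves a linear equation close to the identity.\<close>

lemma cantor_set_nonempty: "cantor_set K \<noteq> {}"
proof -
  define R where "R = blinfun_inv (T 0)"
  have m0: "0 < m" using m by simp
  have "norm R \<le> 2" unfolding R_def using T_near_id[OF m0] by (intro blinfun_inv(3)) simp
  then have near: "norm (id_blinfun - \<theta> *\<^sub>R R - id_blinfun) \<le> 1/2"
    using \<theta> mult_mono[of \<theta> "1/16" "norm R" 2] by simp
  define x where "x = blinfun_inv (id_blinfun - \<theta> *\<^sub>R R) (p 0)"
  have "(id_blinfun - \<theta> *\<^sub>R R) x = p 0" unfolding x_def by (rule blinfun_inv(4)[OF near])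
  then have x: "x = p 0 + \<theta> *\<^sub>R R x" by (simp add: blinfun.diff_left scaleR_blinfun.rep_eq algebra_simps)
  have "norm (R x) \<le> 8/7 * norm x" unfolding R_def by (rule T_inverse(3)[OF m0])
  moreover have "norm x \<le> \<sigma> / 2 + \<theta> * norm (R x)"
    using norm_triangle_ineq[of "p 0" "\<theta> *\<^sub>R R x"] p_small[OF m0] \<theta> x by simp
  moreover have "\<theta> * norm (R x) \<le> 1/16 * norm (R x)" using \<theta> by (intro mult_right_mono) auto
  ultimately have "norm (R x) \<le> \<sigma>" using \<sigma> norm_ge_zero[of "R x"] by argo
  then have "\<theta> * norm (R x) \<le> \<theta> * \<sigma>" using \<theta> by (intro mult_left_mono) auto
  moreover have "dist (p 0) x = \<theta> * norm (R x)"
    by (subst x) (use \<theta> in \<open>simp add: dist_norm\<close>)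
  ultimately have xp: "x \<in> cball (p 0) (\<sigma> * \<theta>)" by (simp add: mult.commute)
  have "x - p 0 = \<theta> *\<^sub>R R x" using x by (metis add_diff_cancel_left')
  then have "g x = x"
    using g_eq_cball[OF m0 xp] \<sigma>\<theta> \<theta> by (simp add: blinfun.scaleR_right R_def T_inverse[OF m0])
  then have "(g ^^ n) x = x" for n by (induction n) auto
  then have "x \<in> cantor_set K" using xp m0 by (auto simp: mem_cantor_set)
  then show ?thesis by blast
qed

text \<open>Pulling back \<open>z\<close> along the itinerary of \<open>x\<close> gives points of the Cantor set near \<open>x\<close>; they differ from
  \<open>x\<close> when \<open>z\<close> is not the \<open>n\<close>-th image of \<open>x\<close>, and this makes the set perfect.\<close>

lemma cantor_set_preimages_dense:
  assumes "x \<in> cantor_set K" "z \<in> cantor_set K"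
  shows "\<exists>y \<in> cantor_set K. (g ^^ n) y = z \<and> dist x y \<le> (2 * \<theta>) ^ n * 2"
  using assms(1)
proof (induction n arbitrary: x)
  case 0
  have "dist x z \<le> norm x + norm z" unfolding dist_norm by (rule norm_triangle_ineq4)
  also have "\<dots> \<le> 2" using cantor_set_small[OF 0] cantor_set_small[OF assms(2)] \<sigma> by simp
  finally show ?case using assms(2) by (intro bexI[of _ z]) auto
next
  case (Suc n)
  obtain y where y: "y \<in> cantor_set K" "(g ^^ n) y = z" "dist (g x) y \<le> (2 * \<theta>) ^ n * 2"
    using Suc.IH[OF cantor_set_expander[OF Suc.prems]] by blast
  obtain a where a: "a \<in> alphabet K" "x \<in> piece K a" using cantor_set_piece[OF Suc.prems] .
  obtain v where v: "v \<in> cantor_set K" "v \<in> piece K a" "g v = y"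
    using cantor_set_branch[OF full y(1) a(1)] by blast
  have "dist x v \<le> 2 * \<theta> * dist (g x) (g v)" using g_expanding[of a x v] a v by simp
  also have "\<dots> \<le> 2 * \<theta> * ((2 * \<theta>) ^ n * 2)" using y(3) v(3) \<theta> by (intro mult_left_mono) auto
  finally have "dist x v \<le> (2 * \<theta>) ^ Suc n * 2" unfolding power_Suc by (simp only: mult.assoc)
  moreover have "(g ^^ Suc n) v = z" using y v by (simp add: funpow_swap1)
  ultimately show ?case using v(1) by blast
qed

lemma cantor_set_perfect:
  assumes x: "x \<in> cantor_set K" shows "x islimpt cantor_set K"
  unfolding islimpt_approachable
proof (intro allI impI)
  fix e :: real assume e: "0 < e"
  have "2 * \<theta> < 1" using \<theta> by simp
  then obtain n where n: "(2 * \<theta>) ^ n < e / 2" using real_arch_pow_inv[OF half_gt_zero[OF e]] by blast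
  have gx: "(g ^^ n) x \<in> cantor_set K"
    using x by (induction n) (auto intro: cantor_set_expander)
  obtain a where a: "a < m" "(g ^^ n) x \<in> piece K a" using cantor_set_piece[OF gx] by auto
  obtain b where b: "b < m" "b \<noteq> a" using m by (metis less_le_trans one_less_numeral_iff semiring_norm(76) zero_less_one zero_neq_one pos2)
  obtain z where z: "z \<in> cantor_set K" "z \<in> piece K b"
    using cantor_set_branch[OF full gx, of b] b by auto
  have "z \<noteq> (g ^^ n) x" using far_apart[of a b z] a b z \<sigma>\<theta> by auto
  moreover obtain y where "y \<in> cantor_set K" "(g ^^ n) y = z" "dist x y \<le> (2 * \<theta>) ^ n * 2"
    using cantor_set_preimages_dense[OF x z(1)] by blast
  ultimately show "\<exists>y \<in> cantor_set K. y \<noteq> x \<and> dist y x < e"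
    using n by (intro bexI[of _ y]) (auto simp: dist_commute)
qed

lemma regular: "regular_cantor \<alpha> K"
proof -
  have conorm: "inverse (rate K) < conorm (Dat g x)" if "x \<in> nbhd K" for x
  proof -
    obtain a where a: "a < m" "x \<in> ball (p a) (3/2 * (\<sigma> * \<theta>))" using \<open>x \<in> nbhd K\<close> by auto
    have "inverse (rate K) < 7/8 / \<theta>" using \<theta> by (simp add: field_simps)
    then show ?thesis using conorm_T[OF a(1)] g_derivative(2)[OF a] by simp
  qed
  have "closure (star_piece K a) = cball (p a) (5/4 * (\<sigma> * \<theta>))" for a
    unfolding star_piece_eq using \<sigma>\<theta> by simp
  moreover have "piece K = (\<lambda>a. cball (p a) (\<sigma> * \<theta>))" by (simp add: fun_eq_iff)
  moreover have "symbolic_type K = subshift {..<m} ({..<m} \<times> {..<m})" by (simp add: symbolic_type_def)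
  ultimately show ?thesis
    unfolding regular_cantor_def
    using C1_holder_g conorm markov_balls[of "\<sigma> * \<theta>"] markov_balls[of "5/4 * (\<sigma> * \<theta>)"] \<sigma>\<theta> \<theta>
      full_shift_mixing[of "{..<m}"] cantor_set_nonempty cantor_set_perfect
    by (simp del: ball_cantor_simps(3,4) split: prod.splits)
qed

lemma holomorphic: "holomorphic_cantor \<alpha> K"
  unfolding holomorphic_cantor_def
proof (intro conjI ballI regular)
  fix x assume "x \<in> cantor_set K"
  then obtain a where a: "a < m" "Dat g x = blinfun_apply (T a /\<^sub>R \<theta>)" using cantor_set_derivative by blast
  have "blinfun_apply (T a /\<^sub>R \<theta>) \<in> GL_complex"
  proof (rule complex_linear_GL)
    show "complex_linear (T a /\<^sub>R \<theta>)" by (intro complex_linear_scaleR T_complex a)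
    show "(T a /\<^sub>R \<theta>) o\<^sub>L (\<theta> *\<^sub>R blinfun_inv (T a)) = id_blinfun" "(\<theta> *\<^sub>R blinfun_inv (T a)) o\<^sub>L (T a /\<^sub>R \<theta>) = id_blinfun"
      using \<theta> by (auto intro!: blinfun_eqI simp: scaleR_blinfun.rep_eq blinfun.scaleR_right T_inverse[OF a(1)])
  qed
  then show "Dat g x \<in> GL_complex" using a by simp
qed

lemma affine: "affine_cantor K"
  unfolding affine_cantor_def
proof
  fix a assume "a \<in> alphabet K"
  then have a: "a < m" by simp
  have "1 < 7/8 / \<theta>" using \<theta> by (simp add: field_simps)
  then have "1 < conorm (blinfun_apply (T a /\<^sub>R \<theta>))" using conorm_T[OF a] by linarith
  moreover have "linear (blinfun_apply (T a /\<^sub>R \<theta>))"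
    by (simp add: blinfun.bounded_linear_right bounded_linear.linear)
  moreover have "g x = (T a /\<^sub>R \<theta>) x + (- (T a /\<^sub>R \<theta>) (p a))" if "x \<in> piece K a" for x
    using g_eq_cball[OF a, of x "\<sigma> * \<theta>"] that \<sigma>\<theta>
    by (simp add: scaleR_blinfun.rep_eq blinfun.diff_right scaleR_diff_right)
  ultimately show "\<exists>A c. linear A \<and> 1 < conorm A \<and> (\<forall>x\<in>piece K a. g x = A x + c)" by blast
qed

text \<open>One iterate suffices: the nonconformality of a branch is at most \<open>9/7\<close>.\<close>

lemma bunched: "bunched_cantor \<alpha> K"
  unfolding bunched_cantor_def
proof (intro exI[of _ 1] ballI)
  fix x assume "x \<in> cantor_set K"
  then obtain a where a: "a < m" "Dat g x = blinfun_apply (T a /\<^sub>R \<theta>)" using cantor_set_derivative by blast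
  have "inverse (conorm (Dat g x)) \<le> inverse (7/8 / \<theta>)"
    unfolding a(2) using conorm_T[OF a(1)] \<theta> by (intro le_imp_inverse_le) auto
  moreover have "0 \<le> conorm (Dat g x)"
    unfolding a(2) by (rule order_trans[OF _ conorm_T[OF a(1)]]) (use \<theta> in simp)
  ultimately have "onorm (Dat g x) * inverse (conorm (Dat g x)) * (2 * \<theta>) powr \<alpha> \<le> 9/8 / \<theta> * inverse (7/8 / \<theta>) * (1/8)"
    using onorm_T[OF a(1)] \<theta>_powr \<theta> unfolding a(2)
    by (intro mult_mono mult_nonneg_nonneg) auto
  also have "\<dots> < 1" using \<theta> by (simp add: field_simps)
  moreover have "g ^^ 1 = g" by (simp add: fun_eq_iff)
  ultimately show "onorm (Dat (g ^^ 1) x) * inverse (conorm (Dat (g ^^ 1) x)) * rate K powr (\<alpha> * real 1) < 1"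
    by simp
qed

end

section \<open>Hausdorff dimension of a round Cantor set\<close>

lemma hausdorff_pre_le_finite_cover:
  fixes S :: "'a::euclidean_space set"
  assumes cover: "S \<subseteq> (\<Union>i<N. U i)" and d: "0 \<le> d" "d \<le> \<eta>" and s: "0 < s"
    and U: "\<And>i x y. i < N \<Longrightarrow> x \<in> U i \<Longrightarrow> y \<in> U i \<Longrightarrow> dist x y \<le> d"
  shows "hausdorff_pre s \<eta> S \<le> ennreal (real N * d powr s)"
proof -
  define V where "V i = (if i < N then U i else {})" for i :: nat
  have V: "bounded (V i)" "diameter (V i) \<le> d" for i
  proof -
    show "diameter (V i) \<le> d"
      by (rule diameter_le) (use d U in \<open>auto simp: V_def dist_norm split: if_splits\<close>)
    show "bounded (V i)"
    proof (cases "V i = {}")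
      case False
      then obtain x where "x \<in> V i" by auto
      then show ?thesis unfolding bounded_def by (metis U V_def empty_iff)
    qed simp
  qed
  have subs: "(\<Union>i<N. U i) \<subseteq> (\<Union>i. V i)" by (auto simp: V_def)
  have "hausdorff_pre s \<eta> S \<le> (\<Sum>i. ennreal (diameter (V i) powr s))"
    unfolding hausdorff_pre_def
  proof (rule INF_lower)
    show "V \<in> {U. S \<subseteq> (\<Union>i. U i) \<and> (\<forall>i. bounded (U i) \<and> diameter (U i) \<le> \<eta>)}"
      using order_trans[OF cover subs] V(1) order_trans[OF V(2) d(2)] by simp
  qed
  also have "\<dots> = (\<Sum>i<N. ennreal (diameter (V i) powr s))"
    by (rule suminf_finite) (auto simp: V_def)
  also have "\<dots> \<le> (\<Sum>i<N. ennreal (d powr s))"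
    using V s by (intro sum_mono ennreal_leI powr_mono2 diameter_ge_0) auto
  also have "\<dots> = ennreal (real N * d powr s)"
    by (simp add: ennreal_mult ennreal_of_nat_eq_real_of_nat)
  finally show ?thesis .
qed

lemma power_powr_swap: "0 < (x::real) \<Longrightarrow> (x ^ n) powr s = (x powr s) ^ n"
  by (simp add: powr_realpow[symmetric] powr_powr mult.commute)

context round_cantor
begin

text \<open>The cylinders of length \<open>n\<close> are numbered by the integers below \<open>m\<^sup>n\<close>; the digit \<open>j mod m\<close> is the first
  symbol of the cylinder \<open>j\<close>, and \<open>j div m\<close> numbers its image under \<open>g\<close>.\<close>

lemma cantor_set_cover:
  "\<exists>U. cantor_set K \<subseteq> (\<Union>i<m^n. U i) \<and> (\<forall>i. \<forall>x\<in>U i. \<forall>y\<in>U i. dist x y \<le> (2 * \<theta>) ^ n * 2)"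
proof (induction n)
  case 0
  have "dist x y \<le> 2" if "x \<in> cantor_set K" "y \<in> cantor_set K" for x y
    using cantor_set_small[OF that(1)] cantor_set_small[OF that(2)] \<sigma> norm_triangle_ineq4[of x y]
    by (simp add: dist_norm)
  then show ?case by (intro exI[of _ "\<lambda>_. cantor_set K"]) (auto simp: lessThan_Suc)
next
  case (Suc n)
  then obtain U where U: "cantor_set K \<subseteq> (\<Union>i<m^n. U i)"
    and d: "\<And>i x y. x \<in> U i \<Longrightarrow> y \<in> U i \<Longrightarrow> dist x y \<le> (2 * \<theta>) ^ n * 2" by blast
  define W where "W j = {x \<in> cball (p (j mod m)) (\<sigma> * \<theta>). g x \<in> U (j div m)}" for j
  have "cantor_set K \<subseteq> (\<Union>j<m^Suc n. W j)"
  proof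
    fix x assume x: "x \<in> cantor_set K"
    obtain a where a: "a < m" "x \<in> cball (p a) (\<sigma> * \<theta>)" using cantor_set_piece[OF x] by auto
    obtain i where i: "i < m ^ n" "g x \<in> U i" using U cantor_set_expander[OF x] by blast
    have "i * m + a < (i + 1) * m" using a by simp
    also have "\<dots> \<le> m ^ n * m" using i by (intro mult_right_mono) auto
    finally have "i * m + a < m ^ Suc n" by (simp add: mult.commute)
    moreover have "x \<in> W (i * m + a)" using a i by (simp add: W_def)
    ultimately show "x \<in> (\<Union>j<m^Suc n. W j)" by blast
  qed
  moreover have "dist x y \<le> (2 * \<theta>) ^ Suc n * 2" if "x \<in> W j" "y \<in> W j" for x y j
  proof -
    have "j mod m < m" using m by simp
    then have "dist x y \<le> 2 * \<theta> * dist (g x) (g y)"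
      using that by (intro g_expanding[of "j mod m"]) (auto simp: W_def)
    also have "\<dots> \<le> 2 * \<theta> * ((2 * \<theta>) ^ n * 2)"
      using d[of "g x" "j div m" "g y"] that \<theta> by (intro mult_left_mono) (auto simp: W_def)
    finally show ?thesis by (simp add: mult.assoc)
  qed
  ultimately show ?case by blast
qed

lemma hausdorff_dim_le:
  assumes s: "0 < s" and small: "real m * (2 * \<theta>) powr s < 1"
  shows "hausdorff_dim (cantor_set K) \<le> ereal s"
proof -
  let ?q = "real m * (2 * \<theta>) powr s"
  have "hausdorff_pre s \<eta> (cantor_set K) \<le> 0" if \<eta>: "0 < \<eta>" for \<eta>
  proof (rule tendsto_lowerbound)
    have "(\<lambda>n. 2 powr s * ?q ^ n) \<longlonglongrightarrow> 2 powr s * 0"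
      using small by (intro tendsto_mult tendsto_const LIMSEQ_power_zero) auto
    then show "(\<lambda>n. ennreal (2 powr s * ?q ^ n)) \<longlonglongrightarrow> 0"
      using tendsto_ennrealI by fastforce
    have "(\<lambda>n. (2 * \<theta>) ^ n) \<longlonglongrightarrow> 0" using \<theta> by (intro LIMSEQ_power_zero) auto
    then have "\<forall>\<^sub>F n in sequentially. (2 * \<theta>) ^ n < \<eta> / 2" using \<eta> by (intro order_tendstoD(2)) auto
    then show "\<forall>\<^sub>F n in sequentially. hausdorff_pre s \<eta> (cantor_set K) \<le> ennreal (2 powr s * ?q ^ n)"
    proof (rule eventually_mono)
      fix n assume n: "(2 * \<theta>) ^ n < \<eta> / 2"
      obtain U where U: "cantor_set K \<subseteq> (\<Union>i<m^n. U i)"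
        and d: "\<And>i x y. x \<in> U i \<Longrightarrow> y \<in> U i \<Longrightarrow> dist x y \<le> (2 * \<theta>) ^ n * 2"
        using cantor_set_cover[of n] by blast
      have "hausdorff_pre s \<eta> (cantor_set K) \<le> ennreal (real (m ^ n) * ((2 * \<theta>) ^ n * 2) powr s)"
        using n \<theta> by (intro hausdorff_pre_le_finite_cover[OF U _ _ s d]) auto
      also have "((2 * \<theta>) ^ n * 2) powr s = ((2 * \<theta>) ^ n) powr s * 2 powr s"
        by (intro powr_mult)
      also have "((2 * \<theta>) ^ n) powr s = ((2 * \<theta>) powr s) ^ n"
        using \<theta> by (intro power_powr_swap) simp
      also have "real (m ^ n) * (((2 * \<theta>) powr s) ^ n * 2 powr s) = 2 powr s * ?q ^ n"
        by (simp add: power_mult_distrib)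
      finally show "hausdorff_pre s \<eta> (cantor_set K) \<le> ennreal (2 powr s * ?q ^ n)" .
    qed
  qed simp
  then have "hausdorff_measure s (cantor_set K) \<le> 0"
    unfolding hausdorff_measure_def by (intro SUP_least) auto
  then show ?thesis
    unfolding hausdorff_dim_def using s by (intro INF_lower) auto
qed

end

section \<open>Round Cantor sets that are close to each other\<close>

lemma onorm_blinfun_diff: "onorm (\<lambda>v. blinfun_apply A v - blinfun_apply B v) = norm (A - B)"
  by (simp add: norm_blinfun.rep_eq minus_blinfun.rep_eq)

lemma C1_holder_on_subset:
  assumes "C1_holder_on \<alpha> V f" "open U" "U \<subseteq> V"
  shows "C1_holder_on \<alpha> U f"
  unfolding C1_holder_on_def
proof (intro conjI ballI assms)
  fix x assume x: "x \<in> U"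
  then show "f differentiable (at x)" using assms by (auto simp: C1_holder_on_def)
  obtain e C where "e > 0" "\<forall>y \<in> V \<inter> ball x e. \<forall>z \<in> V \<inter> ball x e.
        onorm (\<lambda>v. Dat f y v - Dat f z v) \<le> C * dist y z powr \<alpha>"
    using assms(1,3) x unfolding C1_holder_on_def by blast
  then show "\<exists>e>0. \<exists>C. \<forall>y \<in> U \<inter> ball x e. \<forall>z \<in> U \<inter> ball x e.
        onorm (\<lambda>v. Dat f y v - Dat f z v) \<le> C * dist y z powr \<alpha>"
    using assms(3) by blast
qed

lemma close_ball_cantor:
  assumes "round_cantor \<alpha> \<theta> \<sigma> m p T" and "round_cantor \<alpha> \<theta> \<sigma> m p T\<^sub>0"
    and c: "0 \<le> c" "c < \<delta>" and near: "\<And>a. a < m \<Longrightarrow> norm (T a - T\<^sub>0 a) \<le> c * \<theta>"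
  shows "close_cantor \<alpha> \<delta> (ball_cantor \<theta> \<sigma> m p T) (ball_cantor \<theta> \<sigma> m p T\<^sub>0)"
proof -
  interpret A: round_cantor \<alpha> \<theta> \<sigma> m p T by fact
  interpret A0: round_cantor \<alpha> \<theta> \<sigma> m p T\<^sub>0 by fact
  have "C1_holder_close \<alpha> \<delta> (star_piece A.K a) A.g (star_piece A0.K a) A0.g" if a: "a < m" for a
  proof -
    let ?U = "ball (p a) (5/4 * (\<sigma> * \<theta>))"
    have U: "x \<in> ball (p a) (3/2 * (\<sigma> * \<theta>))" if "x \<in> ?U" for x using that A.\<sigma>\<theta> by auto
    have hold_id: "C1_holder_on \<alpha> ?U id"
      by (rule C1_holder_on_locally_affine) (auto intro!: exI[of _ "1::real"] exI[of _ "\<lambda>x. x"] simp: id_def)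
    have hold_inv: "C1_holder_on \<alpha> ?U (inv_into ?U id)"
    proof (rule C1_holder_on_locally_affine[OF open_ball])
      have deriv: "(inv_into ?U id has_derivative (\<lambda>v. v)) (at x)" if x: "x \<in> ?U" for x
      proof (rule has_derivative_transform_within_open[OF has_derivative_ident open_ball x])
        show "y = inv_into ?U id y" if "y \<in> ?U" for y
          using inv_into_f_f[of id ?U y] that by simp
      qed
      show "\<exists>e>0. \<exists>A. \<forall>y \<in> ?U \<inter> ball x e. (inv_into ?U id has_derivative A) (at y)" for x
        by (intro exI[of _ "1::real"] conjI zero_less_one exI[of _ "\<lambda>v. v"] ballI deriv) simp
    qed
    have sub: "?U \<subseteq> nbhd A.K" "?U \<subseteq> nbhd A0.K" using U a by auto
    have D: "Dat A.g x = blinfun_apply (T a /\<^sub>R \<theta>)" "Dat A0.g x = blinfun_apply (T\<^sub>0 a /\<^sub>R \<theta>)" if "x \<in> ?U" for x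
      using A.g_derivative(2)[OF a U[OF that]] A0.g_derivative(2)[OF a U[OF that]] by auto
    have n: "norm ((T a - T\<^sub>0 a) /\<^sub>R \<theta>) \<le> c"
      unfolding norm_scaleR using near[OF a] A.\<theta> by (simp add: field_simps)
    have "C1_holder_near \<alpha> \<delta> ?U (A.g \<circ> id) A0.g"
      unfolding C1_holder_near_def
    proof (intro conjI exI[of _ c] ballI c)
      show "C1_holder_on \<alpha> ?U (A.g \<circ> id)" "C1_holder_on \<alpha> ?U A0.g"
        using C1_holder_on_subset[OF A.C1_holder_g open_ball sub(1)]
          C1_holder_on_subset[OF A0.C1_holder_g open_ball sub(2)] by simp_all
      fix x assume x: "x \<in> ?U"
      have "(A.g \<circ> id) x - A0.g x = ((T a - T\<^sub>0 a) /\<^sub>R \<theta>) (x - p a)"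
        using A.g_eq[OF a U[OF x]] A0.g_eq[OF a U[OF x]]
        by (simp add: scaleR_blinfun.rep_eq blinfun.diff_left scaleR_diff_right)
      moreover have "norm (((T a - T\<^sub>0 a) /\<^sub>R \<theta>) (x - p a)) \<le> c * 1"
        using x A.\<sigma>\<theta> A.\<theta> by (intro norm_apply_le n) (simp add: dist_norm norm_minus_commute)
      ultimately show "norm ((A.g \<circ> id) x - A0.g x) \<le> c" by simp
      show "onorm (\<lambda>v. Dat (A.g \<circ> id) x v - Dat A0.g x v) \<le> c"
        using n by (simp add: D[OF x] onorm_blinfun_diff scaleR_diff_right)
      fix y assume y: "y \<in> ?U"
      show "onorm (\<lambda>v. Dat (A.g \<circ> id) x v - Dat A0.g x v - (Dat (A.g \<circ> id) y v - Dat A0.g y v))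
         \<le> c * dist x y powr \<alpha>"
        using c by (simp add: D[OF x] D[OF y] onorm_zero)
    qed
    moreover have "C1_holder_near \<alpha> \<delta> ?U id id"
      unfolding C1_holder_near_def using hold_id c by (intro conjI exI[of _ c]) (auto simp: onorm_zero)
    moreover have "C1_holder_diffeo \<alpha> ?U ?U id"
      unfolding C1_holder_diffeo_def using hold_id hold_inv by simp
    ultimately show ?thesis
      unfolding C1_holder_close_def A.star_piece_eq A0.star_piece_eq by blast
  qed
  then show ?thesis
    unfolding close_cantor_def using A.holomorphic A.bunched by (simp add: symbolic_type_def)
qed

lemma homothetical_ball_cantor:
  fixes p :: "nat \<Rightarrow> complex ^ 'n::finite"
  assumes "round_cantor \<alpha> \<theta> \<sigma> m p (\<lambda>_. id_blinfun)"
  shows "homothetical_cantor (ball_cantor \<theta> \<sigma> m p (\<lambda>_. id_blinfun))"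
    and "conformal_cantor (ball_cantor \<theta> \<sigma> m p (\<lambda>_. id_blinfun))"
proof -
  interpret round_cantor \<alpha> \<theta> \<sigma> m p "\<lambda>_. id_blinfun" by fact
  have *: "(\<lambda>v. Dat g x v /\<^sub>R onorm (Dat g x)) = id" if x: "x \<in> cantor_set K" for x
  proof -
    obtain a where D: "Dat g x = blinfun_apply (id_blinfun /\<^sub>R \<theta>)" using cantor_set_derivative[OF x] by blast
    have on: "onorm (Dat g x) = inverse \<theta>"
      unfolding D using \<theta> by (simp add: norm_blinfun.rep_eq[symmetric])
    show ?thesis
      unfolding on unfolding D using \<theta> by (simp add: fun_eq_iff scaleR_blinfun.rep_eq)
  qed
  show "homothetical_cantor K" unfolding homothetical_cantor_def using * by blast
  show "conformal_cantor K"
    unfolding conformal_cantor_def using * by (simp add: id_def)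
qed

section \<open>Cantor sets close to a round one\<close>

text \<open>Closeness only concerns the neighbourhoods \<open>G\<^sup>*(a)\<close>; nothing is known about the position of the
  pieces of \<open>L\<close> inside them.  This suffices, because the Markov property of the pieces of \<open>L\<close> alone yields
  inverse branches on the Cantor set of \<open>L\<close>.\<close>

lemma near_affine_branches_of_close:
  assumes "round_cantor \<alpha> \<theta> \<sigma> m p T" and \<eta>: "0 < \<eta>" "\<eta> \<le> 1/8"
    and close: "close_cantor \<alpha> (\<theta> * \<eta> / 12) L (ball_cantor \<theta> \<sigma> m p T)"
  shows "\<exists>f. near_affine_branches \<alpha> \<theta> \<eta> {..<m} (cantor_set L) (star_piece L) (expander L)
      (\<lambda>w. \<theta> *\<^sub>R derivative_blinfun (expander L) w) T f"
    and "compact (cantor_set L)" and "cantor_set L \<noteq> {}"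
    and "\<And>a. a < m \<Longrightarrow> star_piece L a \<subseteq> cball (p a) (5/4 * (\<sigma> * \<theta>) + \<theta> / 96)"
    and "\<And>a s. a < m \<Longrightarrow> 0 < s \<Longrightarrow> s + \<theta> / 96 < 5/4 * (\<sigma> * \<theta>) \<Longrightarrow> cball (p a) s \<subseteq> star_piece L a"
    and "\<And>a w. a < m \<Longrightarrow> w \<in> star_piece L a \<Longrightarrow> norm (expander L w - T a (w - p a) /\<^sub>R \<theta>) \<le> \<eta>"
    and "cantor_set L \<subseteq> (\<Union>a<m. star_piece L a)"
proof -
  interpret round_cantor \<alpha> \<theta> \<sigma> m p T by fact
  let ?G = "expander L"
  have holo: "holomorphic_cantor \<alpha> L" and alph: "alphabet L = {..<m}" and st: "symbolic_type L = symbolic_type K"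
    and cl: "\<And>a. a < m \<Longrightarrow> C1_holder_close \<alpha> (\<theta> * \<eta> / 12) (star_piece L a) ?G (ball (p a) (5/4 * (\<sigma> * \<theta>))) g"
    using close unfolding close_cantor_def star_piece_eq by auto
  have reg: "regular_cantor \<alpha> L" using holo by (simp add: holomorphic_cantor_def)
  show "compact (cantor_set L)" by (rule compact_cantor_set[OF reg])
  show "cantor_set L \<noteq> {}" using reg by (simp add: regular_cantor_def)
  have mp: "markov_pieces \<alpha> L (piece L)" "markov_pieces \<alpha> L (\<lambda>a. closure (star_piece L a))" "0 < radius L"
    and C1: "C1_holder_on \<alpha> (nbhd L) ?G"
    using reg by (auto simp: regular_cantor_def)
  have adm: "(a, b) \<in> admissible L" if "a < m" "b < m" for a b
  proof -
    have "(\<lambda>i::nat. if i = 0 then a else b) \<in> symbolic_type K"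
      using that by (simp add: symbolic_type_def subshift_def)
    then have "(\<lambda>i::nat. if i = 0 then a else b) \<in> subshift (alphabet L) (admissible L)"
      using st by (simp add: symbolic_type_def)
    then have "\<forall>i. ((if i = 0 then a else b), (if Suc i = 0 then a else b)) \<in> admissible L"
      unfolding subshift_def by blast
    from this[rule_format, of 0] show ?thesis by simp
  qed
  have full: "piece L b \<subseteq> ?G ` piece L a" if "a \<in> alphabet L" "b \<in> alphabet L" for a b
    using mp(1) that adm[of a b] alph unfolding markov_pieces_def by auto
  have piece_star: "piece L a \<subseteq> star_piece L a" for a
    unfolding star_piece_def using mp(3) by force
  show sub: "cantor_set L \<subseteq> (\<Union>a<m. star_piece L a)"
    using piece_star alph by (blast elim: cantor_set_piece)
  have diff: "?G differentiable (at x)" if "a < m" "x \<in> star_piece L a" for a x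
  proof -
    have "x \<in> closure (star_piece L a)" using that closure_subset by blast
    then have "x \<in> nbhd L" using mp(2) that(1) alph unfolding markov_pieces_def by blast
    then show ?thesis using C1 by (simp add: C1_holder_on_def)
  qed
  have g0: "g x = T a (x - p a) /\<^sub>R \<theta>" if "a < m" "x \<in> ball (p a) (5/4 * (\<sigma> * \<theta>))" for a x
    using that \<sigma>\<theta> by (intro g_eq) auto
  have \<theta>1: "\<theta> \<le> 1" and \<alpha>1: "\<alpha> \<le> 1" using \<theta> \<alpha> by auto
  note J = close_to_affine[OF \<alpha>(1) \<alpha>1 \<theta>(1) \<theta>1 \<eta>]
  have \<theta>\<eta>: "0 < \<theta> * \<eta> / 12" "\<theta> * \<eta> / 12 \<le> \<theta> / 96"
    using \<theta> \<eta> mult_left_mono[of \<eta> "1/8" \<theta>] by auto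
  show sup: "star_piece L a \<subseteq> cball (p a) (5/4 * (\<sigma> * \<theta>) + \<theta> / 96)" if a: "a < m" for a
  proof -
    have "star_piece L a \<subseteq> ball (p a) (5/4 * (\<sigma> * \<theta>) + \<theta> * \<eta> / 12)"
      by (rule J(5)[OF T_near_id[OF a] cl[OF a] g0[OF a] diff[OF a]])
    also have "\<dots> \<subseteq> cball (p a) (5/4 * (\<sigma> * \<theta>) + \<theta> / 96)"
      by (intro order_trans[OF ball_subset_cball] subset_cball) (use \<theta>\<eta>(2) in linarith)
    finally show ?thesis .
  qed
  show "cball (p a) s \<subseteq> star_piece L a" if a: "a < m" and s: "0 < s" "s + \<theta> / 96 < 5/4 * (\<sigma> * \<theta>)" for a s
  proof -
    have "s + \<theta> * \<eta> / 12 < 5/4 * (\<sigma> * \<theta>)" using \<theta>\<eta>(2) s(2) by linarith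
    then show ?thesis using J(6)[OF T_near_id[OF a] cl[OF a] g0[OF a] diff[OF a]] s(1) by blast
  qed
  show "norm (?G w - T a (w - p a) /\<^sub>R \<theta>) \<le> \<eta>" if a: "a < m" and w: "w \<in> star_piece L a" for a w
    by (rule J(4)[OF T_near_id[OF a] cl[OF a] g0[OF a] diff[OF a]]) (assumption | rule w)+
  define f where "f a x = (SOME y. y \<in> cantor_set L \<and> y \<in> piece L a \<and> ?G y = x)" for a x
  have f: "f a x \<in> cantor_set L \<and> f a x \<in> piece L a \<and> ?G (f a x) = x" if "a < m" "x \<in> cantor_set L" for a x
    unfolding f_def by (rule someI_ex) (use cantor_set_branch[OF full that(2), of a] that(1) alph in auto)
  have "near_affine_branches \<alpha> \<theta> \<eta> {..<m} (cantor_set L) (star_piece L) ?G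
      (\<lambda>w. \<theta> *\<^sub>R derivative_blinfun ?G w) T f"
  proof
    show "0 < \<alpha>" "\<alpha> \<le> 1" "0 < \<theta>" "0 \<le> \<eta>" "\<eta> \<le> 1/8" using \<alpha> \<theta> \<eta> by auto
    fix a u v w
    assume a: "a \<in> {..<m}"
    then have am: "a < m" by simp
    show "norm (T a - id_blinfun) \<le> 1/8" by (rule T_near_id[OF am])
    show "norm (\<theta> *\<^sub>R derivative_blinfun ?G w - T a) \<le> \<eta>" if "w \<in> star_piece L a"
      by (rule J(3)[OF T_near_id[OF am] cl[OF am] g0[OF am] diff[OF am]]) (assumption | rule that)+
    show "norm (\<theta> *\<^sub>R derivative_blinfun ?G u - \<theta> *\<^sub>R derivative_blinfun ?G v) \<le> \<eta> * norm (u - v) powr \<alpha>"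
      if "u \<in> star_piece L a" "v \<in> star_piece L a"
      by (rule J(2)[OF T_near_id[OF am] cl[OF am] g0[OF am] diff[OF am]]) (assumption | rule that)+
    show "norm (\<theta> *\<^sub>R (?G u - ?G v) - (\<theta> *\<^sub>R derivative_blinfun ?G w) (u - v))
        \<le> \<eta> * (norm (u - w) powr \<alpha> + norm (v - w) powr \<alpha>) * norm (u - v)"
      if "u \<in> star_piece L a" "v \<in> star_piece L a" "w \<in> star_piece L a"
      by (rule J(1)[OF T_near_id[OF am] cl[OF am] g0[OF am] diff[OF am]]) (assumption | rule that)+
    show "norm (u - v) \<le> 1" if "u \<in> star_piece L a" "v \<in> star_piece L a"
    proof -
      have "norm (p a - u) \<le> 5/4 * (\<sigma> * \<theta>) + \<theta> / 96" "norm (p a - v) \<le> 5/4 * (\<sigma> * \<theta>) + \<theta> / 96"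
        using sup[OF am] that by (auto simp: dist_norm)
      then show ?thesis
        using norm_triangle_ineq4[of "p a - v" "p a - u"] \<sigma>\<theta> \<theta> by simp
    qed
  next
    fix a x assume "a \<in> {..<m}" "x \<in> cantor_set L"
    then show "f a x \<in> cantor_set L \<and> f a x \<in> star_piece L a \<and> ?G (f a x) = x"
      using f piece_star by blast
  next
    fix x assume x: "x \<in> cantor_set L"
    then obtain a where "a < m" "x \<in> star_piece L a" using sub by blast
    then have "blinfun_apply (derivative_blinfun ?G x) = Dat ?G x" by (rule derivative_blinfun_apply(1)[OF diff])
    moreover have "Dat ?G x \<in> GL_complex" using holo x by (simp add: holomorphic_cantor_def)
    ultimately show "complex_linear (\<theta> *\<^sub>R derivative_blinfun ?G x)"
      by (intro complex_linear_scaleR GL_complex_linear) simp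
  qed
  then show "\<exists>f. near_affine_branches \<alpha> \<theta> \<eta> {..<m} (cantor_set L) (star_piece L) ?G
      (\<lambda>w. \<theta> *\<^sub>R derivative_blinfun ?G w) T f" by blast
qed

section \<open>Placing the pieces\<close>

lemma compact_finite_net:
  fixes S :: "'a::metric_space set"
  assumes "compact S" "0 < e"
  obtains W where "finite W" "W \<subseteq> S" "\<And>x. x \<in> S \<Longrightarrow> \<exists>w\<in>W. dist w x < e"
proof -
  obtain W where "finite W" "W \<subseteq> S" "S \<subseteq> (\<Union>w\<in>W. ball w e)"
    using seq_compact_imp_totally_bounded[of S] assms compact_imp_seq_compact by blast
  then show ?thesis using that[of W] by force
qed

lemma separated_subset:
  fixes W :: "'a::metric_space set"
  assumes "finite W"
  shows "\<exists>C\<subseteq>W. (\<forall>x\<in>C. \<forall>y\<in>C. x \<noteq> y \<longrightarrow> r \<le> dist x y) \<and> (\<forall>w\<in>W. \<exists>x\<in>C. dist w x < r \<or> w = x)"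
  using assms
proof (induction W)
  case empty
  then show ?case by simp
next
  case (insert w W)
  then obtain C where C: "C \<subseteq> W" "\<forall>x\<in>C. \<forall>y\<in>C. x \<noteq> y \<longrightarrow> r \<le> dist x y"
    "\<forall>w\<in>W. \<exists>x\<in>C. dist w x < r \<or> w = x" by blast
  show ?case
  proof (cases "\<exists>x\<in>C. dist w x < r")
    case True
    then show ?thesis using C by (intro exI[of _ C]) auto
  next
    case False
    then show ?thesis using C by (intro exI[of _ "insert w C"]) (auto simp: dist_commute not_less)
  qed
qed

text \<open>The points \<open>w j\<close> of a net may coincide; the pieces centred at them must not overlap.\<close>

lemma injective_perturbation:
  fixes w :: "'j \<Rightarrow> 'a::euclidean_space"
  assumes "finite J" "0 < e"
  shows "\<exists>q. inj_on q J \<and> (\<forall>j\<in>J. dist (q j) (w j) < e)"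
  using assms(1)
proof (induction J)
  case empty
  then show ?case by simp
next
  case (insert j J)
  then obtain q where q: "inj_on q J" "\<forall>j\<in>J. dist (q j) (w j) < e" by blast
  have "infinite (ball (w j) e - q ` J)"
    using insert.hyps \<open>0 < e\<close> finite_imp_not_open[of "ball (w j) e"] by (auto simp: Diff_infinite_finite)
  then obtain v where "v \<in> ball (w j) e - q ` J" by (metis finite.emptyI ex_in_conv)
  then have "inj_on (q(j := v)) (insert j J) \<and> (\<forall>i\<in>insert j J. dist ((q(j := v)) i) (w i) < e)"
    using q insert.hyps by (auto simp: dist_commute inj_on_def)
  then show ?case by blast
qed

lemma finite_separation:
  fixes q :: "nat \<Rightarrow> 'a::metric_space"
  assumes "inj_on q {..<m}"
  obtains s where "0 < s" "\<And>a b. a < m \<Longrightarrow> b < m \<Longrightarrow> a \<noteq> b \<Longrightarrow> s \<le> dist (q a) (q b)"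
proof -
  define Q where "Q = insert 1 ((\<lambda>(a, b). dist (q a) (q b)) ` {(a, b). a < m \<and> b < m \<and> a \<noteq> b})"
  have "{(a, b). a < m \<and> b < m \<and> a \<noteq> b} \<subseteq> {..<m} \<times> {..<m}" by auto
  then have fin: "finite Q" unfolding Q_def using finite_subset by (intro finite.insertI finite_imageI) auto
  have "\<forall>x\<in>Q. 0 < x" using assms by (auto simp: Q_def inj_on_def)
  then have "0 < Min Q" using fin by (subst Min_gr_iff) (auto simp: Q_def)
  moreover have "Min Q \<le> dist (q a) (q b)" if "a < m" "b < m" "a \<noteq> b" for a b
    using fin that by (intro Min_le) (auto simp: Q_def)
  ultimately show ?thesis using that by blast
qed

text \<open>The linear corrections and centres of the thin Cantor set, before scaling by \<open>\<rho>\<close> and \<open>\<theta>\<close>.  Neither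
  of these two numbers occurs, and hence \<open>m\<close> and \<open>s\<close> do not depend on them.\<close>

lemma thin_configuration:
  obtains m :: nat and Y :: "nat \<Rightarrow> (complex ^ 'n::finite) \<Rightarrow>\<^sub>L (complex ^ 'n)"
    and q :: "nat \<Rightarrow> complex ^ 'n" and s :: real
  where "2 \<le> m" "\<And>a. a < m \<Longrightarrow> complex_linear (Y a)" "\<And>a. a < m \<Longrightarrow> norm (Y a) \<le> 1"
    "\<And>a. a < m \<Longrightarrow> norm (q a) \<le> 6"
    "0 < s" "\<And>a b. a < m \<Longrightarrow> b < m \<Longrightarrow> a \<noteq> b \<Longrightarrow> s \<le> dist (q a) (q b)"
    "\<And>B v. complex_linear B \<Longrightarrow> norm B \<le> 1 \<Longrightarrow> norm v \<le> 5 \<Longrightarrow>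
       \<exists>a<m. norm (B - Y a) \<le> 1/8 \<and> norm (q a - v) \<le> 1/16"
proof -
  let ?S = "{B :: (complex ^ 'n) \<Rightarrow>\<^sub>L (complex ^ 'n). complex_linear B \<and> norm B \<le> 1}"
  have eq: "?S = cball 0 1 \<inter> (\<Inter>c. \<Inter>x. {B. blinfun_apply B (c *s x) - c *s blinfun_apply B x = 0})"
    by (auto simp: complex_linear_def)
  have lin: "closed {B :: (complex ^ 'n) \<Rightarrow>\<^sub>L (complex ^ 'n). blinfun_apply B (c *s x) - c *s blinfun_apply B x = 0}" for c x
  proof (rule closed_Collect_eq)
    show "continuous_on UNIV (\<lambda>B :: (complex ^ 'n) \<Rightarrow>\<^sub>L (complex ^ 'n). blinfun_apply B (c *s x) - c *s blinfun_apply B x)"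
      unfolding vector_scalar_mult_def by (intro continuous_intros)
  qed auto
  have "closed ?S" unfolding eq by (intro closed_Int closed_cball closed_INT ballI lin)
  moreover have "bounded ?S" by (rule bounded_subset[of "cball 0 1"]) auto
  ultimately have "compact ?S" by (simp add: compact_eq_bounded_closed)
  then obtain \<Y> where Y: "finite \<Y>" "\<Y> \<subseteq> ?S" "\<And>B. B \<in> ?S \<Longrightarrow> \<exists>y\<in>\<Y>. dist y B < 1/8"
    using compact_finite_net[of ?S "1/8"] by auto
  obtain W where W: "finite W" "W \<subseteq> cball (0 :: complex ^ 'n) 5" "\<And>v. v \<in> cball 0 5 \<Longrightarrow> \<exists>w\<in>W. dist w v < 1/32"
    using compact_finite_net[of "cball (0 :: complex ^ 'n) 5" "1/32"] by auto
  define J where "J = \<Y> \<times> W"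
  have finJ: "finite J" using Y W by (simp add: J_def)
  obtain r where r: "inj_on r J" "\<forall>j\<in>J. dist (r j) (snd j) < 1/32"
    using injective_perturbation[OF finJ, of "1/32" snd] by auto
  define m where "m = card J"
  obtain h where h: "bij_betw h {0..<m} J" using ex_bij_betw_nat_finite[OF finJ] unfolding m_def by blast
  have hJ: "h a \<in> J" if "a < m" for a using h that by (auto simp: bij_betw_def)
  have inj: "inj_on (r \<circ> h) {..<m}"
    using h r(1) by (intro comp_inj_on) (auto simp: bij_betw_def lessThan_atLeast0)
  obtain s where s: "0 < s" "\<And>a b. a < m \<Longrightarrow> b < m \<Longrightarrow> a \<noteq> b \<Longrightarrow> s \<le> dist ((r \<circ> h) a) ((r \<circ> h) b)"
    using finite_separation[OF inj] by blast
  have net: "\<exists>a<m. norm (B - fst (h a)) \<le> 1/8 \<and> norm ((r \<circ> h) a - v) \<le> 1/16"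
    if B: "complex_linear B" "norm B \<le> 1" and v: "norm v \<le> 5" for B v
  proof -
    obtain y where y: "y \<in> \<Y>" "dist y B < 1/8" using Y(3)[of B] B by blast
    obtain w where w: "w \<in> W" "dist w v < 1/32" using W(3)[of v] v by auto
    have "(y, w) \<in> J" using y w by (simp add: J_def)
    then have "(y, w) \<in> h ` {0..<m}" using h by (simp add: bij_betw_def)
    then obtain a where a: "a < m" "h a = (y, w)" by auto
    have "dist (r (h a)) w < 1/32" using r(2) \<open>(y, w) \<in> J\<close> a by fastforce
    then have "dist (r (h a)) v \<le> 1/16" using w dist_triangle[of "r (h a)" v w] by linarith
    then show ?thesis using a y by (intro exI[of _ a]) (auto simp: dist_norm norm_minus_commute)
  qed
  have "2 \<le> m"
  proof (rule ccontr)
    assume m: "\<not> 2 \<le> m"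
    obtain v :: "complex ^ 'n" where v: "norm v = 5" using vector_choose_size[of 5] by auto
    obtain a where a: "a < m" "norm ((r \<circ> h) a - 0) \<le> 1/16"
      using net[of 0 0] by (auto simp: complex_linear_def)
    obtain b where b: "b < m" "norm ((r \<circ> h) b - v) \<le> 1/16"
      using net[of 0 v] v by (auto simp: complex_linear_def)
    have "a = b" using a b m by simp
    then show False using a b v norm_triangle_ineq4[of "(r \<circ> h) b - 0" "(r \<circ> h) b - v"] by simp
  qed
  moreover have "norm ((r \<circ> h) a) \<le> 6" if "a < m" for a
  proof -
    have "dist (r (h a)) (snd (h a)) < 1/32" "norm (snd (h a)) \<le> 5"
      using r(2) hJ[OF that] W(2) by (auto simp: J_def)
    then show ?thesis using norm_triangle_sub[of "r (h a)" "snd (h a)"] by (simp add: dist_norm)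
  qed
  moreover have "complex_linear (fst (h a))" "norm (fst (h a)) \<le> 1" if "a < m" for a
    using hJ[OF that] Y(2) by (auto simp: J_def)
  ultimately show ?thesis
    using that[of m "\<lambda>a. fst (h a)" "r \<circ> h" s] s net by blast
qed

text \<open>Separation makes room for disjoint balls of radius \<open>\<theta>\<close>, while density guarantees that the centres
  are met by translates of a net in a ball of radius \<open>5\<theta>\<close>.\<close>

lemma thick_configuration:
  fixes \<theta> :: real
  assumes \<theta>: "0 < \<theta>" "\<theta> \<le> 1/24"
  obtains m :: nat and c :: "nat \<Rightarrow> complex ^ 'n::finite"
  where "2 \<le> m" "\<And>b. b < m \<Longrightarrow> norm (c b) \<le> 1/2"
    "\<And>a b. a < m \<Longrightarrow> b < m \<Longrightarrow> a \<noteq> b \<Longrightarrow> 4 * \<theta> \<le> dist (c a) (c b)"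
    "\<And>t. norm t \<le> 1/2 \<Longrightarrow> \<exists>b<m. dist t (c b) \<le> 5 * \<theta>"
proof -
  obtain W where W: "finite W" "W \<subseteq> cball (0 :: complex ^ 'n) (1/2)" "\<And>v. v \<in> cball 0 (1/2) \<Longrightarrow> \<exists>w\<in>W. dist w v < \<theta>"
    using compact_finite_net[of "cball (0 :: complex ^ 'n) (1/2)" \<theta>] \<theta> by auto
  obtain C where C: "C \<subseteq> W" "\<forall>x\<in>C. \<forall>y\<in>C. x \<noteq> y \<longrightarrow> 4 * \<theta> \<le> dist x y"
    "\<forall>w\<in>W. \<exists>x\<in>C. dist w x < 4 * \<theta> \<or> w = x"
    using separated_subset[OF W(1), of "4 * \<theta>"] by blast
  have finC: "finite C" using C(1) W(1) finite_subset by blast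
  define m where "m = card C"
  obtain c where c: "bij_betw c {0..<m} C" using ex_bij_betw_nat_finite[OF finC] unfolding m_def by blast
  have cC: "c b \<in> C" if "b < m" for b using c that by (auto simp: bij_betw_def)
  have net: "\<exists>b<m. dist t (c b) \<le> 5 * \<theta>" if t: "norm t \<le> 1/2" for t
  proof -
    obtain w where w: "w \<in> W" "dist w t < \<theta>" using W(3)[of t] t by auto
    obtain x where x: "x \<in> C" "dist w x < 4 * \<theta> \<or> w = x" using C(3) w(1) by blast
    have "x \<in> c ` {0..<m}" using c x(1) by (simp add: bij_betw_def)
    then obtain b where b: "b < m" "c b = x" by auto
    have "dist t x \<le> dist w t + dist w x" by (rule dist_triangle3)
    then show ?thesis using w x \<theta> b by (intro exI[of _ b]) auto
  qed
  have "2 \<le> m"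
  proof (rule ccontr)
    assume m: "\<not> 2 \<le> m"
    obtain v :: "complex ^ 'n" where v: "norm v = 1/2" using vector_choose_size[of "1/2"] by auto
    obtain a where a: "a < m" "dist 0 (c a) \<le> 5 * \<theta>" using net[of 0] by auto
    obtain b where b: "b < m" "dist v (c b) \<le> 5 * \<theta>" using net[of v] v by auto
    have "a = b" using a b m by simp
    then have "dist 0 v \<le> 10 * \<theta>" using a b dist_triangle2[of 0 v "c b"] by simp
    then show False using v \<theta> by simp
  qed
  moreover have "norm (c b) \<le> 1/2" if "b < m" for b using cC[OF that] C(1) W(2) by auto
  moreover have "4 * \<theta> \<le> dist (c a) (c b)" if "a < m" "b < m" "a \<noteq> b" for a b
  proof -
    have "c a \<noteq> c b" using c that by (auto simp: bij_betw_def inj_on_def)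
    then show ?thesis using C(2) cC that by blast
  qed
  ultimately show ?thesis using that net by blast
qed

lemma small_powr:
  fixes a b :: real
  assumes "0 < a" "0 < b"
  obtains r where "0 < r" "\<And>x. 0 < x \<Longrightarrow> x \<le> r \<Longrightarrow> x powr a \<le> b"
proof
  show "0 < b powr (1 / a)" using assms by simp
  fix x :: real assume "0 < x" "x \<le> b powr (1 / a)"
  then have "x powr a \<le> (b powr (1 / a)) powr a" using assms by (intro powr_mono2) auto
  then show "x powr a \<le> b" using assms by (simp add: powr_powr)
qed

section \<open>Stable intersection\<close>

text \<open>The size of the allowed perturbation is fixed last, through \<open>\<eta>\<close>, when all other parameters
  are known; \<open>\<kappa> = \<rho>/16\<close> and \<open>\<eta> = \<kappa>/22\<close>.\<close>

lemma stable_intersection_ball_cantor: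
  fixes q :: "nat \<Rightarrow> complex ^ 'n::finite" and Y :: "nat \<Rightarrow> (complex ^ 'n) \<Rightarrow>\<^sub>L (complex ^ 'n)"
  assumes K: "round_cantor \<alpha> \<theta> \<sigma> m (\<lambda>a. \<theta> *\<^sub>R q a) (\<lambda>a. id_blinfun + \<rho> *\<^sub>R Y a)"
    and K': "round_cantor \<alpha> \<theta> 1 m' c (\<lambda>_. id_blinfun)"
    and \<sigma>: "\<sigma> \<le> 1/16" and \<rho>: "0 < \<rho>" "\<rho> \<le> \<theta> / 4"
    and thin: "\<And>B v. complex_linear B \<Longrightarrow> norm B \<le> 1 \<Longrightarrow> norm v \<le> 5 \<Longrightarrow>
       \<exists>a<m. norm (B - Y a) \<le> 1/8 \<and> norm (q a - v) \<le> 1/16"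
    and thick: "\<And>t. norm t \<le> 1/2 \<Longrightarrow> \<exists>b<m'. dist t (c b) \<le> 5 * \<theta>"
  shows "stable_intersection \<alpha> (ball_cantor \<theta> \<sigma> m (\<lambda>a. \<theta> *\<^sub>R q a) (\<lambda>a. id_blinfun + \<rho> *\<^sub>R Y a))
     (ball_cantor \<theta> 1 m' c (\<lambda>_. id_blinfun))"
proof -
  interpret A: round_cantor \<alpha> \<theta> \<sigma> m "\<lambda>a. \<theta> *\<^sub>R q a" "\<lambda>a. id_blinfun + \<rho> *\<^sub>R Y a" by (rule K)
  interpret A': round_cantor \<alpha> \<theta> 1 m' c "\<lambda>_. id_blinfun" by (rule K')
  define \<eta> where "\<eta> = \<rho> / 352"
  have \<eta>: "0 < \<eta>" "\<eta> \<le> 1/8" "\<eta> \<le> 1/16" using \<rho> A.\<theta> by (auto simp: \<eta>_def)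
  show ?thesis
    unfolding stable_intersection_def
  proof (intro exI[of _ "\<theta> * \<eta> / 12"] conjI allI impI)
    show "0 < \<theta> * \<eta> / 12" using A.\<theta> \<eta> by simp
    fix L L' assume "close_cantor \<alpha> (\<theta> * \<eta> / 12) L A.K \<and> close_cantor \<alpha> (\<theta> * \<eta> / 12) L' A'.K"
    then have L: "close_cantor \<alpha> (\<theta> * \<eta> / 12) L A.K" and L': "close_cantor \<alpha> (\<theta> * \<eta> / 12) L' A'.K"
      by blast+
    note N = near_affine_branches_of_close[OF K \<eta>(1,2) L]
    note N' = near_affine_branches_of_close[OF K' \<eta>(1,2) L']
    obtain f where f: "near_affine_branches \<alpha> \<theta> \<eta> {..<m} (cantor_set L) (star_piece L) (expander L)
      (\<lambda>w. \<theta> *\<^sub>R derivative_blinfun (expander L) w) (\<lambda>a. id_blinfun + \<rho> *\<^sub>R Y a) f"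
      using N(1) by blast
    obtain f' where f': "near_affine_branches \<alpha> \<theta> \<eta> {..<m'} (cantor_set L') (star_piece L') (expander L')
      (\<lambda>w. \<theta> *\<^sub>R derivative_blinfun (expander L') w) (\<lambda>_. id_blinfun) f'"
      using N'(1) by blast
    have r: "5/4 * (\<sigma> * \<theta>) + \<theta> / 96 \<le> \<theta> / 8"
    proof -
      have "\<sigma> * \<theta> \<le> 1/16 * \<theta>" using A.\<theta> by (intro mult_right_mono \<sigma>) auto
      then show ?thesis using A.\<theta> by linarith
    qed
    have star: "norm (x - \<theta> *\<^sub>R q a) \<le> \<theta> / 8" if "a < m" "x \<in> star_piece L a" for a x
    proof -
      have "x \<in> cball (\<theta> *\<^sub>R q a) (5/4 * (\<sigma> * \<theta>) + \<theta> / 96)" using N(4)[OF that(1)] that(2) by blast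
      then show ?thesis using r by (simp add: dist_norm norm_minus_commute)
    qed
    have "renormalization \<alpha> \<theta> \<eta> {..<m} (cantor_set L) (star_piece L) (expander L)
      (\<lambda>w. \<theta> *\<^sub>R derivative_blinfun (expander L) w) (\<lambda>a. id_blinfun + \<rho> *\<^sub>R Y a) f
      {..<m'} (cantor_set L') (star_piece L') (expander L') (\<lambda>w. \<theta> *\<^sub>R derivative_blinfun (expander L') w) f'
      (\<lambda>a. \<theta> *\<^sub>R q a) c \<rho> (\<rho> / 16)"
    proof (intro renormalization.intro f f' renormalization_axioms.intro)
      show "(2 * \<theta>) powr \<alpha> \<le> 1/8" by (rule A.\<theta>_powr)
      show "0 \<le> \<rho> / 16" "22 * \<eta> \<le> \<rho> / 16" "4 * (\<rho> / 16) + 3 * \<eta> \<le> 3/8 * \<rho>" "\<rho> + 5 * (\<rho> / 16) \<le> \<theta> / 2"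
        "\<rho> \<le> 1/8" "\<rho> / 16 \<le> 1/8"
        using \<rho> A.\<theta> by (auto simp: \<eta>_def)
      show "cantor_set L \<noteq> {}" "cantor_set L' \<noteq> {}" by (rule N(3), rule N'(3))
      show "cantor_set L \<subseteq> cball 0 (1/16)"
      proof
        fix x assume "x \<in> cantor_set L"
        then obtain a where a: "a < m" "x \<in> star_piece L a" using N(7) by blast
        have "\<theta> \<le> 1/16" by (rule A.\<theta>)
        have "norm x \<le> \<sigma> / 2 + (5/4 * (\<sigma> * \<theta>) + \<theta> / 96)"
          using N(4)[OF a(1)] a(2) A.p_small[OF a(1)] norm_triangle_sub[of x "\<theta> *\<^sub>R q a"]
          by (force simp: dist_norm norm_minus_commute)
        also have "\<dots> \<le> 1/16" using r \<sigma> \<open>\<theta> \<le> 1/16\<close> by linarith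
        finally show "x \<in> cball 0 (1/16)" by simp
      qed
      show "cantor_set L' \<subseteq> cball 0 1"
      proof
        fix x assume "x \<in> cantor_set L'"
        then obtain a where a: "a < m'" "x \<in> star_piece L' a" using N'(7) by blast
        have "norm x \<le> 1 / 2 + (5/4 * (1 * \<theta>) + \<theta> / 96)"
          using N'(4)[OF a(1)] a(2) A'.p_small[OF a(1)] norm_triangle_sub[of x "c a"]
          by (force simp: dist_norm norm_minus_commute)
        also have "\<dots> \<le> 1" using A.\<theta> by simp
        finally show "x \<in> cball 0 1" by simp
      qed
      show "norm (f a x - \<theta> *\<^sub>R q a) \<le> \<theta> / 8" if "a \<in> {..<m}" "x \<in> cantor_set L" for a x
        using near_affine_branches.branch[OF f that] star that by simp
      show "cball (c b) (\<theta> / 2) \<subseteq> star_piece L' b" if "b \<in> {..<m'}" for b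
        using N'(5)[of b "\<theta> / 2"] that A.\<theta> by simp
      show "norm (expander L' u - (u - c b) /\<^sub>R \<theta>) \<le> 1/16" if "b \<in> {..<m'}" "u \<in> star_piece L' b" for b u
        using N'(6)[of b u] that \<eta> by simp
      show "\<exists>a\<in>{..<m}. \<exists>b\<in>{..<m'}. norm (B - (id_blinfun + \<rho> *\<^sub>R Y a)) \<le> \<rho> / 8 \<and> norm (t + \<theta> *\<^sub>R q a - c b) \<le> \<theta> / 16"
        if B: "complex_linear B" "norm (B - id_blinfun) \<le> \<rho>" and t: "norm t \<le> 1/2" for B t
      proof -
        obtain b where b: "b < m'" "dist t (c b) \<le> 5 * \<theta>" using thick[OF t] by blast
        define v where "v = (c b - t) /\<^sub>R \<theta>"
        define X where "X = (B - id_blinfun) /\<^sub>R \<rho>"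
        have "norm v \<le> 5" using b A.\<theta> unfolding v_def norm_scaleR
          by (simp add: dist_norm norm_minus_commute field_simps)
        moreover have "norm X \<le> 1" using B(2) \<rho> unfolding X_def norm_scaleR by (simp add: field_simps)
        moreover have "complex_linear X"
          using B(1) unfolding X_def
          by (intro complex_linear_scaleR) (simp add: complex_linear_def blinfun.diff_left vector_ssub_ldistrib)
        ultimately obtain a where a: "a < m" "norm (X - Y a) \<le> 1/8" "norm (q a - v) \<le> 1/16"
          using thin by blast
        have "B - (id_blinfun + \<rho> *\<^sub>R Y a) = \<rho> *\<^sub>R (X - Y a)"
          using \<rho> by (simp add: X_def scaleR_diff_right)
        then have "norm (B - (id_blinfun + \<rho> *\<^sub>R Y a)) = \<rho> * norm (X - Y a)" using \<rho> by simp
        moreover have "\<rho> * norm (X - Y a) \<le> \<rho> * (1/8)" using a \<rho> by (intro mult_left_mono) auto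
        moreover have "t + \<theta> *\<^sub>R q a - c b = \<theta> *\<^sub>R (q a - v)"
          using A.\<theta> by (simp add: v_def scaleR_diff_right)
        then have "norm (t + \<theta> *\<^sub>R q a - c b) = \<theta> * norm (q a - v)" using A.\<theta> by simp
        moreover have "\<theta> * norm (q a - v) \<le> \<theta> * (1/16)" using a A.\<theta> by (intro mult_left_mono) auto
        ultimately show ?thesis using a(1) b(1) by (intro bexI[of _ a] bexI[of _ b]) auto
      qed
    qed
    then show "cantor_set L \<inter> cantor_set L' \<noteq> {}"
      by (rule renormalization.intersect) (rule N(2), rule N'(2))
  qed
qed

text \<open>The order of the choices matters: the thin configuration determines \<open>m\<close> and \<open>\<sigma>\<close>; then \<open>\<theta>\<close> makes
  the dimension small and fits the centres \<open>\<theta> q\<^sub>a\<close> into a ball of radius \<open>\<sigma>/2\<close>; the thick configuration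
  depends on \<open>\<theta>\<close>; finally \<open>\<rho> < \<theta>\<delta>\<close> makes \<open>K\<close> \<open>\<delta>\<close>-close to the homothetical set with the same centres.
  The thick set is homothetical itself.\<close>

lemma affine_pair_with_stable_intersection:
  fixes \<alpha> \<epsilon> \<delta> :: real
  assumes \<alpha>: "0 < \<alpha>" "\<alpha> < 1" and \<epsilon>: "0 < \<epsilon>" and \<delta>: "0 < \<delta>"
  shows "\<exists>K K' :: (nat, 'n::finite) cantor_data.
            holomorphic_cantor \<alpha> K \<and> holomorphic_cantor \<alpha> K' \<and>
            stable_intersection \<alpha> K K' \<and> hausdorff_dim (cantor_set K) < ereal \<epsilon> \<and>
            affine_cantor K \<and> affine_cantor K' \<and>
            (\<exists>H. holomorphic_cantor \<alpha> H \<and> conformal_cantor H \<and> homothetical_cantor H \<and>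
                 close_cantor \<alpha> \<delta> K H) \<and>
            (\<exists>H'. holomorphic_cantor \<alpha> H' \<and> conformal_cantor H' \<and> homothetical_cantor H' \<and>
                 close_cantor \<alpha> \<delta> K' H')"
proof -
  obtain m :: nat and Y :: "nat \<Rightarrow> (complex ^ 'n) \<Rightarrow>\<^sub>L (complex ^ 'n)" and q :: "nat \<Rightarrow> complex ^ 'n" and s :: real
    where m: "2 \<le> m" and Y: "\<And>a. a < m \<Longrightarrow> complex_linear (Y a)" "\<And>a. a < m \<Longrightarrow> norm (Y a) \<le> 1"
    and q: "\<And>a. a < m \<Longrightarrow> norm (q a) \<le> 6"
    and s: "0 < s" "\<And>a b. a < m \<Longrightarrow> b < m \<Longrightarrow> a \<noteq> b \<Longrightarrow> s \<le> dist (q a) (q b)"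
    and thin: "\<And>B v. complex_linear B \<Longrightarrow> norm B \<le> 1 \<Longrightarrow> norm v \<le> 5 \<Longrightarrow>
       \<exists>a<m. norm (B - Y a) \<le> 1/8 \<and> norm (q a - v) \<le> 1/16"
    by (rule thin_configuration) blast
  define \<sigma> where "\<sigma> = min (1/16) (s/4)"
  have \<sigma>: "0 < \<sigma>" "\<sigma> \<le> 1/16" "4 * \<sigma> \<le> s" "\<sigma> \<le> 1" using s by (auto simp: \<sigma>_def)
  obtain r\<^sub>1 where r1: "0 < r\<^sub>1" "\<And>x. 0 < x \<Longrightarrow> x \<le> r\<^sub>1 \<Longrightarrow> x powr \<alpha> \<le> 1/8"
    using small_powr[OF \<alpha>(1), of "1/8"] by auto
  obtain r\<^sub>2 where r2: "0 < r\<^sub>2" "\<And>x. 0 < x \<Longrightarrow> x \<le> r\<^sub>2 \<Longrightarrow> x powr (\<epsilon>/2) \<le> 1 / (2 * real m)"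
    using small_powr[of "\<epsilon>/2" "1 / (2 * real m)"] \<epsilon> m by auto
  define \<theta> where "\<theta> = min (min (r\<^sub>1 / 2) (r\<^sub>2 / 2)) (min (1/24) (\<sigma> / 12))"
  have \<theta>: "0 < \<theta>" "\<theta> \<le> 1/24" "2 * \<theta> \<le> r\<^sub>1" "2 * \<theta> \<le> r\<^sub>2" "12 * \<theta> \<le> \<sigma>"
    using r1 r2 \<sigma> by (auto simp: \<theta>_def)
  have \<theta>_powr: "(2 * \<theta>) powr \<alpha> \<le> 1/8" using r1(2) \<theta> by simp
  define \<rho> where "\<rho> = min (\<theta> / 4) (\<theta> * \<delta> / 2)"
  have \<rho>: "0 < \<rho>" "\<rho> \<le> \<theta> / 4" "\<rho> \<le> \<theta> * \<delta> / 2" "\<rho> \<le> 1/8" using \<theta> \<delta> by (auto simp: \<rho>_def)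
  obtain m' :: nat and c :: "nat \<Rightarrow> complex ^ 'n" where m': "2 \<le> m'" and c: "\<And>b. b < m' \<Longrightarrow> norm (c b) \<le> 1/2"
    "\<And>a b. a < m' \<Longrightarrow> b < m' \<Longrightarrow> a \<noteq> b \<Longrightarrow> 4 * \<theta> \<le> dist (c a) (c b)"
    and thick: "\<And>t. norm t \<le> 1/2 \<Longrightarrow> \<exists>b<m'. dist t (c b) \<le> 5 * \<theta>"
    by (rule thick_configuration[OF \<theta>(1,2)]) blast
  let ?p = "\<lambda>a. \<theta> *\<^sub>R q a" and ?T = "\<lambda>a. id_blinfun + \<rho> *\<^sub>R Y a"
  have round: "round_cantor \<alpha> \<theta> \<sigma> m ?p S"
    if S: "\<And>a. a < m \<Longrightarrow> norm (S a - id_blinfun) \<le> 1/8" "\<And>a. a < m \<Longrightarrow> complex_linear (S a)" for S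
  proof
    show "0 < \<alpha>" "\<alpha> < 1" "0 < \<theta>" "\<theta> \<le> 1/16" "(2 * \<theta>) powr \<alpha> \<le> 1/8" "0 < \<sigma>" "\<sigma> \<le> 1" "2 \<le> m"
      using \<alpha> \<theta> \<theta>_powr \<sigma> m by auto
    fix a assume a: "a < m"
    have "norm (?p a) \<le> \<theta> * 6" using q[OF a] \<theta> by simp
    then show "norm (?p a) \<le> \<sigma> / 2" using \<theta> by linarith
    show "norm (S a - id_blinfun) \<le> 1/8" "complex_linear (S a)" by (rule S[OF a])+
    fix b assume b: "b < m" "a \<noteq> b"
    have "\<theta> * (4 * \<sigma>) \<le> \<theta> * dist (q a) (q b)" using s(2)[OF a b] \<sigma> \<theta> by (intro mult_left_mono) auto
    moreover have "dist (?p a) (?p b) = \<theta> * dist (q a) (q b)"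
      using \<theta> by (simp add: dist_norm flip: scaleR_diff_right)
    ultimately show "4 * (\<sigma> * \<theta>) \<le> dist (?p a) (?p b)" by (simp add: mult_ac)
  qed
  have T_near: "norm (?T a - id_blinfun) \<le> \<rho>" if "a < m" for a
    using Y(2)[OF that] \<rho> by (simp add: mult_left_le)
  have T_complex: "complex_linear (?T a)" if "a < m" for a
    using Y(1)[OF that] complex_linear_scaleR[OF Y(1)[OF that], of \<rho>]
    by (simp add: complex_linear_def blinfun.add_left vector_add_ldistrib)
  have "norm (?T a - id_blinfun) \<le> 1/8" if "a < m" for a
    by (rule order_trans[OF T_near[OF that] \<rho>(4)])
  then have K: "round_cantor \<alpha> \<theta> \<sigma> m ?p ?T" by (rule round[OF _ T_complex])
  have H: "round_cantor \<alpha> \<theta> \<sigma> m ?p (\<lambda>_. id_blinfun)"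
    by (intro round) (auto simp: complex_linear_id)
  have K': "round_cantor \<alpha> \<theta> 1 m' c (\<lambda>_. id_blinfun)"
    by unfold_locales (use \<alpha> \<theta> \<theta>_powr m' c in \<open>auto simp: complex_linear_id\<close>)
  interpret K: round_cantor \<alpha> \<theta> \<sigma> m ?p ?T by (rule K)
  interpret H: round_cantor \<alpha> \<theta> \<sigma> m ?p "\<lambda>_. id_blinfun" by (rule H)
  interpret K': round_cantor \<alpha> \<theta> 1 m' c "\<lambda>_. id_blinfun" by (rule K')
  have "real m * (2 * \<theta>) powr (\<epsilon>/2) \<le> real m * (1 / (2 * real m))"
    using r2(2)[of "2 * \<theta>"] \<theta> by (intro mult_left_mono) auto
  also have "\<dots> < 1" using m by simp
  finally have "hausdorff_dim (cantor_set K.K) \<le> ereal (\<epsilon>/2)" using \<epsilon> by (intro K.hausdorff_dim_le) auto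
  also have "\<dots> < ereal \<epsilon>" using \<epsilon> by simp
  finally have dim: "hausdorff_dim (cantor_set K.K) < ereal \<epsilon>" .
  have "norm (?T a - id_blinfun) \<le> \<rho> / \<theta> * \<theta>" if "a < m" for a using T_near[OF that] \<theta> by simp
  moreover have "\<rho> / \<theta> \<le> \<delta> / 2" using \<rho>(3) \<theta> by (simp add: field_simps)
  then have "\<rho> / \<theta> < \<delta>" using \<delta> by linarith
  ultimately have 1: "close_cantor \<alpha> \<delta> K.K H.K"
    using \<rho> \<theta> by (intro close_ball_cantor[OF K H, of "\<rho> / \<theta>"]) auto
  have 2: "close_cantor \<alpha> \<delta> K'.K K'.K"
    using \<delta> by (intro close_ball_cantor[OF K' K', of 0]) auto
  have 3: "stable_intersection \<alpha> K.K K'.K"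
    by (rule stable_intersection_ball_cantor[OF K K' \<sigma>(2) \<rho>(1,2) thin thick])
  show ?thesis
    by (rule exI[of _ K.K], rule exI[of _ K'.K])
      (use K.holomorphic K'.holomorphic H.holomorphic K.affine K'.affine 1 2 3 dim
        homothetical_ball_cantor[OF H] homothetical_ball_cantor[OF K'] in blast)
qed

theorem theorem2:
  fixes \<alpha> \<epsilon> :: real
  assumes "0 < \<alpha>" and "\<alpha> < 1" and "0 < \<epsilon>"
  shows "(\<exists>K K' :: (nat, 'n::finite) cantor_data.
            holomorphic_cantor \<alpha> K \<and> holomorphic_cantor \<alpha> K' \<and>
            stable_intersection \<alpha> K K' \<and> hausdorff_dim (cantor_set K) < ereal \<epsilon>) \<and>
         (\<forall>\<delta>>0. \<exists>K K' :: (nat, 'n) cantor_data.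
            holomorphic_cantor \<alpha> K \<and> holomorphic_cantor \<alpha> K' \<and>
            stable_intersection \<alpha> K K' \<and> hausdorff_dim (cantor_set K) < ereal \<epsilon> \<and>
            affine_cantor K \<and> affine_cantor K' \<and>
            (\<exists>H. holomorphic_cantor \<alpha> H \<and> conformal_cantor H \<and> homothetical_cantor H \<and>
                 close_cantor \<alpha> \<delta> K H) \<and>
            (\<exists>H'. holomorphic_cantor \<alpha> H' \<and> conformal_cantor H' \<and> homothetical_cantor H' \<and>
                 close_cantor \<alpha> \<delta> K' H'))"
proof
  note affine_pair = affine_pair_with_stable_intersection[where 'n='n, OF assms]
  show "\<exists>K K' :: (nat, 'n) cantor_data.
            holomorphic_cantor \<alpha> K \<and> holomorphic_cantor \<alpha> K' \<and>
            stable_intersection \<alpha> K K' \<and> hausdorff_dim (cantor_set K) < ereal \<epsilon>"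
    using affine_pair[OF zero_less_one] by blast
qed (use affine_pair_with_stable_intersection[where 'n='n, OF assms] in blast)

end
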